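(* Suppose that for some $\Omega_X,\Omega_Y>0$, $\sup_{x_1,x_2\in X}V_X(x_1,x_2)\le\Omega_X^2$ and $\sup_{y_1,y_2\in Y}V_Y(y_1,y_2)\le\Omega_Y^2$, and let $D_X:=\Omega_X\sqrt{2/\alpha_X}$, $D_Y:=\Omega_Y\sqrt{2/\alpha_Y}$. Let $N\ge2$ be given and let the parameters of the stochastic APD algorithm described in the context be set to $$\beta_t=\frac{t+1}2,\quad\theta_t=\frac{t-1}t,\quad\eta_t=\frac{2\alpha_XD_Xt}{6L_GD_X+3L_KD_Y(N-1)+3\sigma_xN\sqrt{N-1}},$$ $$\tau_t=\frac{2\alpha_YD_Yt}{3L_KD_X(N-1)+3\sigma_yN\sqrt{N-1}}.$$ Then under assumption A1 (bounded variance, see context), $$\mathbb E[g(z_N^{ag})]\le\mathcal C_0(N):=\frac{6L_GD_X^2}{N(N-1)}+\frac{6L_KD_XD_Y}{N}+\frac{4(\sigma_xD_X+\sigma_yD_Y)}{\sqrt{N-1}}.$$ If in addition assumption A2 (light tails, see context) holds, then for all $\lambda>0$, $$\mathrm{Prob}\{g(z_N^{ag})>\mathcal C_0(N)+\lambda\mathcal C_1(N)\}\le3\exp\{-\lambda^2/3\}+3\exp\{-\lambda\},\qquad\text{where }\ \mathcal C_1(N)=\frac{3(\sigma_xD_X+\sigma_yD_Y)}{\sqrt{N-1}}.$$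
   Context: Setting. $\mathcal X,\mathcal Y$ are finite-dimensional real vector spaces, each equipped with an inner product $\langle\cdot,\cdot\rangle$ and a norm $\|\cdot\|$, with dual norm $\|\cdot\|_*$; $X\subseteq\mathcal X$, $Y\subseteq\mathcal Y$ are closed convex sets and $Z=X\times Y$. $G$ is a smooth convex function with $G(y)-G(x)-\langle\nabla G(x),y-x\rangle\le\frac{L_G}{2}\|y-x\|^2$ for all $x,y\in X$, for some $L_G\ge0$. $K:\mathcal X\to\mathcal Y$ is linear with transpose $K^T$ and induced norm $L_K=\|K\|$ (so $\|Kx\|_*\le L_K\|x\|$ and $\langle Kx,y\rangle\le L_K\|x\|\|y\|$). $J:Y\to\mathbb R$ is proper, convex and lower semicontinuous. The saddle point problem is $\min_{x\in X}\max_{y\in Y}G(x)+\langle Kx,y\rangle-J(y)$. The denominators in the stepsizes are understood to be positive. Bregman divergences: $V_X(x,u)=d_X(x)-d_X(u)-\langle\nabla d_X(u),x-u\rangle$ and $V_Y(y,v)=d_Y(y)-d_Y(v)-\langle\nabla d_Y(v),y-v\rangle$, where $d_X$, $d_Y$ are strongly convex (differentiable) functions with strong convexity parameters $\alpha_X,\alpha_Y>0$ with respect to the given norms. Stochastic oracle. A stochastic oracle returns unbiased estimators $\hat{\mathcal G}(x)=\mathcal G(x,\xi)$, $\hat{\mathcal K}_x(x)=\mathcal K_x(x,\xi)$, $\hat{\mathcal K}_y(y)=\mathcal K_y(y,\xi)$, with i.i.d. random vectors $\xi$: $\mathbb E[\hat{\mathcal G}(x)]=\nabla G(x)$, $\mathbb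 E[\hat{\mathcal K}_x(x)]=Kx$, $\mathbb E[\hat{\mathcal K}_y(y)]=K^Ty$. The samples used for the three evaluations in each iteration are independent of each other and of all previous iterations. A1: for constants $\sigma_{x,G},\sigma_y,\sigma_{x,K}\ge0$ and all query points, $\mathbb E\|\hat{\mathcal G}(x)-\nabla G(x)\|_*^2\le\sigma_{x,G}^2$, $\mathbb E\|\hat{\mathcal K}_x(x)-Kx\|_*^2\le\sigma_y^2$, $\mathbb E\|\hat{\mathcal K}_y(y)-K^Ty\|_*^2\le\sigma_{x,K}^2$. A2: $\mathbb E[\exp\{\|\nabla G(x)-\hat{\mathcal G}(x)\|_*^2/\sigma_{x,G}^2\}]\le\exp\{1\}$, $\mathbb E[\exp\{\|Kx-\hat{\mathcal K}_x(x)\|_*^2/\sigma_y^2\}]\le\exp\{1\}$, $\mathbb E[\exp\{\|K^Ty-\hat{\mathcal K}_y(y)\|_*^2/\sigma_{x,K}^2\}]\le\exp\{1\}$. Notation: $\sigma_x:=\sqrt{\sigma_{x,G}^2+\sigma_{x,K}^2}$. Stochastic APD algorithm. Choose $x_1\in X$, $y_1\in Y$; set $x_1^{ag}=x_1$, $y_1^{ag}=y_1$, $\bar x_1=x_1$. For $t=1,2,\dots,N-1$: $x_t^{md}=(1-\beta_t^{-1})x_t^{ag}+\beta_t^{-1}x_t$; $y_{t+1}=\operatorname{argmin}_{y\in Y}\langle-\hat{\mathcal K}_x(\bar x_t),y\rangle+J(y)+\frac1{\tau_t}V_Y(y,y_t)$; $x_{t+1}=\operatorname{argmin}_{x\in X}\langle\hat{\mathcal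 G}(x_t^{md}),x\rangle+\langle x,\hat{\mathcal K}_y(y_{t+1})\rangle+\frac1{\eta_t}V_X(x,x_t)$; $x_{t+1}^{ag}=(1-\beta_t^{-1})x_t^{ag}+\beta_t^{-1}x_{t+1}$; $y_{t+1}^{ag}=(1-\beta_t^{-1})y_t^{ag}+\beta_t^{-1}y_{t+1}$; $\bar x_{t+1}=\theta_{t+1}(x_{t+1}-x_t)+x_{t+1}$. Output $z_N^{ag}=(x_N^{ag},y_N^{ag})$. Gap function. For $\tilde z=(\tilde x,\tilde y)$, $z=(x,y)\in Z$: $Q(\tilde z,z)=[G(\tilde x)+\langle K\tilde x,y\rangle-J(y)]-[G(x)+\langle Kx,\tilde y\rangle-J(\tilde y)]$, and $g(\tilde z)=\max_{z\in Z}Q(\tilde z,z)$ (understood as a supremum). *)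

theory Defs
  imports "HOL-Probability.Probability"
begin

text \<open>The two spaces are Euclidean spaces as far as the inner product and the topology are
  concerned, but they also carry an arbitrary second norm, given as a function.\<close>

definition is_norm :: "('a::real_vector \<Rightarrow> real) \<Rightarrow> bool" where
  "is_norm n \<longleftrightarrow>
     (\<forall>x. n x \<ge> 0) \<and> (\<forall>x. n x = 0 \<longleftrightarrow> x = 0) \<and>
     (\<forall>c x. n (c *\<^sub>R x) = \<bar>c\<bar> * n x) \<and> (\<forall>x y. n (x + y) \<le> n x + n y)"

definition dual_norm :: "('a::euclidean_space \<Rightarrow> real) \<Rightarrow> 'a \<Rightarrow> real" where
  "dual_norm n v = (SUP x\<in>{x. n x \<le> 1}. v \<bullet> x)"

definition induced_norm ::
  "('a::euclidean_space \<Rightarrow> real) \<Rightarrow> ('b::euclidean_space \<Rightarrow> real) \<Rightarrow> ('a \<Rightarrow> 'b) \<Rightarrow> real" where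
  "induced_norm nX nY K = (SUP x\<in>{x. nX x \<le> 1}. dual_norm nY (K x))"

text \<open>Differentiability is taken within \<open>S\<close>, because the functions concerned are only
  constrained on \<open>S\<close>. This covers functions differentiable on a neighbourhood of \<open>S\<close>.\<close>

definition has_gradient_on ::
  "('a::euclidean_space \<Rightarrow> real) \<Rightarrow> ('a \<Rightarrow> 'a) \<Rightarrow> 'a set \<Rightarrow> bool" where
  "has_gradient_on f df S \<longleftrightarrow> (\<forall>x\<in>S. (f has_derivative (\<lambda>h. df x \<bullet> h)) (at x within S))"

definition lower_semicontinuous_on :: "'a::topological_space set \<Rightarrow> ('a \<Rightarrow> real) \<Rightarrow> bool" where
  "lower_semicontinuous_on S f \<longleftrightarrow> (\<forall>x\<in>S. \<forall>c < f x. \<forall>\<^sub>F y in at x within S. c < f y)"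

definition strongly_convex_on ::
  "('a::real_vector \<Rightarrow> real) \<Rightarrow> real \<Rightarrow> 'a set \<Rightarrow> ('a \<Rightarrow> real) \<Rightarrow> bool" where
  "strongly_convex_on n \<alpha> S f \<longleftrightarrow> convex S \<and>
     (\<forall>x\<in>S. \<forall>y\<in>S. \<forall>u\<ge>0. \<forall>v\<ge>0. u + v = 1 \<longrightarrow>
        f (u *\<^sub>R x + v *\<^sub>R y) \<le> u * f x + v * f y - \<alpha> / 2 * u * v * (n (x - y))\<^sup>2)"

definition bregman ::
  "('a::real_inner \<Rightarrow> real) \<Rightarrow> ('a \<Rightarrow> 'a) \<Rightarrow> 'a \<Rightarrow> 'a \<Rightarrow> real" where
  "bregman d dd x u = d x - d u - dd u \<bullet> (x - u)"

definition gap_Q ::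
  "('a \<Rightarrow> real) \<Rightarrow> ('a \<Rightarrow> 'b::real_inner) \<Rightarrow> ('b \<Rightarrow> real) \<Rightarrow> 'a \<times> 'b \<Rightarrow> 'a \<times> 'b \<Rightarrow> real" where
  "gap_Q G K J = (\<lambda>(x', y') (x, y). (G x' + K x' \<bullet> y - J y) - (G x + K x \<bullet> y' - J y'))"

definition gap ::
  "'a set \<Rightarrow> 'b set \<Rightarrow> ('a \<Rightarrow> real) \<Rightarrow> ('a \<Rightarrow> 'b::real_inner) \<Rightarrow> ('b \<Rightarrow> real) \<Rightarrow> 'a \<times> 'b \<Rightarrow> ereal"
  where
  "gap X Y G K J z' = (SUP z\<in>X \<times> Y. ereal (gap_Q G K J z' z))"

text \<open>The expectation of the gap is an integral of \<open>e2ennreal\<close> of it; by the next lemma the truncation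
  of negative values in \<open>e2ennreal\<close> has no effect on \<open>X \<times> Y\<close>.\<close>

lemma gap_nonneg:
  assumes "z \<in> X \<times> Y"
  shows "gap X Y G K J z \<ge> 0"
proof -
  have "ereal (gap_Q G K J z z) \<le> gap X Y G K J z"
    unfolding gap_def using assms by (rule SUP_upper)
  moreover have "gap_Q G K J z z = 0"
    by (simp add: gap_Q_def split: prod.split)
  ultimately show ?thesis
    by (simp add: zero_ereal_def)
qed

text \<open>\<open>F q s\<close> is the answer to query \<open>q\<close> when the random vector takes the value \<open>s\<close>; the
  distribution of the random vector is \<open>P\<close>, and \<open>S\<close> is the set of admissible queries.\<close>

definition unbiased_oracle ::
  "'s measure \<Rightarrow> 'q set \<Rightarrow> ('q::euclidean_space \<Rightarrow> 's \<Rightarrow> 'v::euclidean_space) \<Rightarrow> ('q \<Rightarrow> 'v) \<Rightarrow> bool"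
  where
  "unbiased_oracle P S F m \<longleftrightarrow>
     (\<lambda>(q, s). F q s) \<in> borel_measurable (restrict_space borel S \<Otimes>\<^sub>M P) \<and>
     (\<forall>q\<in>S. has_bochner_integral P (F q) (m q))"

definition bounded_variance ::
  "('v::euclidean_space \<Rightarrow> real) \<Rightarrow> 's measure \<Rightarrow> 'q set \<Rightarrow> ('q \<Rightarrow> 's \<Rightarrow> 'v) \<Rightarrow> ('q \<Rightarrow> 'v) \<Rightarrow> real \<Rightarrow> bool"
  where
  "bounded_variance n P S F m \<sigma> \<longleftrightarrow>
     (\<forall>q\<in>S. (\<integral>\<^sup>+ s. ennreal ((dual_norm n (F q s - m q))\<^sup>2) \<partial>P) \<le> ennreal (\<sigma>\<^sup>2))"

text \<open>For \<open>\<sigma> = 0\<close> the quotient is \<open>0\<close> and this holds trivially, but then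
  \<open>bounded_variance\<close> already forces the noise to vanish almost surely.\<close>

definition light_tail ::
  "('v::euclidean_space \<Rightarrow> real) \<Rightarrow> 's measure \<Rightarrow> 'q set \<Rightarrow> ('q \<Rightarrow> 's \<Rightarrow> 'v) \<Rightarrow> ('q \<Rightarrow> 'v) \<Rightarrow> real \<Rightarrow> bool"
  where
  "light_tail n P S F m \<sigma> \<longleftrightarrow>
     (\<forall>q\<in>S. (\<integral>\<^sup>+ s. ennreal (exp ((dual_norm n (m q - F q s))\<^sup>2 / \<sigma>\<^sup>2)) \<partial>P) \<le> ennreal (exp 1))"

text \<open>The oracle for \<open>K\<close> is queried at \<open>\<theta> (x\<^sub>t - x\<^sub>t\<^sub>-\<^sub>1) + x\<^sub>t\<close> with \<open>\<theta> \<in> [0,1]\<close>, which need not lie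
  in \<open>X\<close>.\<close>

definition extrapolations :: "'a::real_vector set \<Rightarrow> 'a set" where
  "extrapolations X = {r *\<^sub>R (x - x') + x | r x x'. 0 \<le> r \<and> r \<le> 1 \<and> x \<in> X \<and> x' \<in> X}"

datatype oracle_call = Call_G | Call_Kx | Call_Ky

text \<open>A single trajectory of the stochastic accelerated primal-dual method. The arguments \<open>oG t\<close>,
  \<open>oKx t\<close> and \<open>oKy t\<close> are the realizations of the three estimators in iteration \<open>t\<close>.\<close>

definition APD_trajectory ::
  "'a::euclidean_space set \<Rightarrow> 'b::euclidean_space set \<Rightarrow> ('b \<Rightarrow> real) \<Rightarrow>
   ('a \<Rightarrow> 'a \<Rightarrow> real) \<Rightarrow> ('b \<Rightarrow> 'b \<Rightarrow> real) \<Rightarrow>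
   (nat \<Rightarrow> real) \<Rightarrow> (nat \<Rightarrow> real) \<Rightarrow> (nat \<Rightarrow> real) \<Rightarrow> (nat \<Rightarrow> real) \<Rightarrow> nat \<Rightarrow>
   (nat \<Rightarrow> 'a \<Rightarrow> 'a) \<Rightarrow> (nat \<Rightarrow> 'a \<Rightarrow> 'b) \<Rightarrow> (nat \<Rightarrow> 'b \<Rightarrow> 'a) \<Rightarrow> 'a \<Rightarrow> 'b \<Rightarrow>
   (nat \<Rightarrow> 'a) \<Rightarrow> (nat \<Rightarrow> 'b) \<Rightarrow> (nat \<Rightarrow> 'a) \<Rightarrow> (nat \<Rightarrow> 'a) \<Rightarrow> (nat \<Rightarrow> 'b) \<Rightarrow> (nat \<Rightarrow> 'a) \<Rightarrow> bool"
  where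
  "APD_trajectory X Y J VX VY \<beta> \<theta> \<eta> \<tau> N oG oKx oKy x1 y1 x y xmd xag yag xbar \<longleftrightarrow>
     x 1 = x1 \<and> y 1 = y1 \<and> xag 1 = x1 \<and> yag 1 = y1 \<and> xbar 1 = x1 \<and>
     (\<forall>t\<in>{1..N - 1}.
        xmd t = (1 - inverse (\<beta> t)) *\<^sub>R xag t + inverse (\<beta> t) *\<^sub>R x t \<and>
        is_arg_min (\<lambda>v. - oKx t (xbar t) \<bullet> v + J v + 1 / \<tau> t * VY v (y t))
          (\<lambda>v. v \<in> Y) (y (t + 1)) \<and>
        is_arg_min (\<lambda>u. oG t (xmd t) \<bullet> u + u \<bullet> oKy t (y (t + 1)) + 1 / \<eta> t * VX u (x t))
          (\<lambda>u. u \<in> X) (x (t + 1)) \<and>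
        xag (t + 1) = (1 - inverse (\<beta> t)) *\<^sub>R xag t + inverse (\<beta> t) *\<^sub>R x (t + 1) \<and>
        yag (t + 1) = (1 - inverse (\<beta> t)) *\<^sub>R yag t + inverse (\<beta> t) *\<^sub>R y (t + 1) \<and>
        xbar (t + 1) = \<theta> (t + 1) *\<^sub>R (x (t + 1) - x t) + x (t + 1))"

end

theory Submission
  imports Defs
begin

text \<open>
  Along every single realization of the noise the iterates satisfy an energy inequality. For a
  comparison point \<open>z = (u, v)\<close>, the gap function at the averaged iterates, weighted with
  \<open>t (t + 1) / 2\<close>, plus the Bregman distances of the current iterates to \<open>z\<close>, plus the bilinear
  term that the extrapolation of \<open>xbar\<close> has not yet cancelled, grows in each iteration by at most a noise
  term (\<open>potential_step\<close>). The strong convexity terms that the two proximal steps leave over pay for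
  the curvature \<open>LG\<close> of \<open>G\<close>, for the coupling through \<open>K\<close>, and for the part of the oracle error that
  is correlated with the new iterate. The noise term consists of squared dual norms of the errors
  and of the inner products \<open>e\<^sub>t \<bullet> (z - z\<^sub>t)\<close> of the errors with the distance to \<open>z\<close>.

  The gap is a supremum over \<open>z\<close>, so \<open>z\<close> depends on all the noise and these inner products are
  not martingale differences. They become so once \<open>z\<close> is replaced by a sequence of
  regularized leaders, each of which depends on the past errors only: by the regret bound
  \<open>follow_the_regularized_leader_regret\<close>, the replacement costs one more squared radius of the domain and
  one more sum of squared errors. This gives the pathwise bound \<open>gap_path_bound\<close>.

  Given the past, each error is a fresh sample at a query that is already known
  (\<open>nn_integral_past_sample\<close>). Hence the martingale sums have mean zero and the squares are bounded by
  the variances, which yields the expectation. For the tails, the squares are treated by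
  convexity of the exponential (\<open>squared_err_tail\<close>), the martingale sums by exponential moments
  (\<open>correlation_tail\<close>). There are three oracle calls per iteration and each contributes one event of
  either kind.

  The norms need not be Euclidean, so the errors of the two calls that enter the step for \<open>x\<close> are not
  orthogonal, and the square of their sum costs a factor two. The step sizes leave room for it, because the
  whole \<open>\<sigma>\<close>-part of \<open>1 / \<eta>\<^sub>t\<close> and \<open>1 / \<tau>\<^sub>t\<close> can be spent on the noise. With \<open>\<sigma>D\<close> for
  \<open>\<sigma>x * DX + \<sigma>y * DY\<close>, the step sizes contribute \<open>3 \<sigma>D / sqrt (N - 1)\<close>, and the
  squared errors \<open>(8/9) \<sigma>D / sqrt (N - 1)\<close>, together at most \<open>4 \<sigma>D / sqrt (N - 1)\<close>; in
  the tail bound the coefficient of the deviation \<open>lam\<close> is \<open>2 + 8/9\<close>, at most \<open>3\<close>.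
\<close>

section \<open>Norms and dual norms\<close>

lemma is_normD:
  assumes "is_norm n"
  shows "n x \<ge> 0" "n 0 = 0" "n x = 0 \<longleftrightarrow> x = 0" "n (c *\<^sub>R x) = \<bar>c\<bar> * n x" "n (x + y) \<le> n x + n y"
  using assms unfolding is_norm_def by blast+

lemma is_norm_minus: "is_norm n \<Longrightarrow> n (- x) = n x"
  using is_normD(4)[of n "-1" x] by simp

lemma is_norm_diff_commute: "is_norm n \<Longrightarrow> n (x - y) = n (y - x)"
  using is_norm_minus[of n "x - y"] by simp

lemma is_norm_convex_on: "is_norm n \<Longrightarrow> convex_on UNIV n"
proof (rule convex_onI)
  fix t :: real and x y assume n: "is_norm n" and t: "0 < t" "t < 1"
  have "n ((1 - t) *\<^sub>R x + t *\<^sub>R y) \<le> n ((1 - t) *\<^sub>R x) + n (t *\<^sub>R y)"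
    by (rule is_normD(5)[OF n])
  then show "n ((1 - t) *\<^sub>R x + t *\<^sub>R y) \<le> (1 - t) * n x + t * n y"
    using t by (simp add: is_normD(4)[OF n])
qed simp

lemma is_norm_continuous_on:
  fixes n :: "'a::euclidean_space \<Rightarrow> real"
  assumes "is_norm n"
  shows "continuous_on S n"
  using convex_on_continuous[OF open_UNIV is_norm_convex_on[OF assms]]
    continuous_on_subset by blast

text \<open>By compactness the norm has a positive minimum on the Euclidean unit sphere. This is what ties the
  given norm to the Euclidean topology of the space.\<close>

lemma is_norm_dominates_norm:
  fixes n :: "'a::euclidean_space \<Rightarrow> real"
  assumes "is_norm n"
  obtains C where "C > 0" "\<And>x. norm x \<le> C * n x"
proof -
  obtain a :: 'a where "norm a = 1" using vector_choose_size[of 1] by auto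
  then have "a \<in> sphere 0 1" by simp
  then have ne: "sphere (0::'a) 1 \<noteq> {}" by blast
  obtain e where e: "e \<in> sphere (0::'a) 1" "\<And>x. x \<in> sphere 0 1 \<Longrightarrow> n e \<le> n x"
    using continuous_attains_inf[OF compact_sphere ne is_norm_continuous_on[OF assms]] by blast
  have pos: "n e > 0"
    using e(1) is_normD(1)[OF assms, of e] is_normD(3)[OF assms, of e] by force
  have "norm x \<le> 1 / n e * n x" for x
  proof (cases "x = 0")
    case False
    then have "n e \<le> n (inverse (norm x) *\<^sub>R x)" by (intro e) simp
    also have "\<dots> = n x / norm x"
      by (simp add: is_normD(4)[OF assms] divide_inverse mult.commute)
    finally show ?thesis using False pos by (simp add: field_simps)
  qed (simp add: is_normD[OF assms])
  then show ?thesis using that[of "1 / n e"] pos by simp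
qed

lemma is_norm_compact_unit_ball:
  fixes n :: "'a::euclidean_space \<Rightarrow> real"
  assumes "is_norm n"
  shows "compact {x. n x \<le> 1}"
proof -
  obtain C where C: "C > 0" "\<And>x. norm x \<le> C * n x"
    using is_norm_dominates_norm[OF assms] by blast
  have "{x. n x \<le> 1} \<subseteq> cball 0 C"
    using C(1) by (auto intro!: order_trans[OF C(2)] simp: mult_left_le)
  then have "bounded {x. n x \<le> 1}"
    using bounded_subset bounded_cball by blast
  moreover have "closed {x. n x \<le> 1}"
    by (intro closed_Collect_le continuous_intros is_norm_continuous_on[OF assms])
  ultimately show ?thesis by (simp add: compact_eq_bounded_closed)
qed

lemma dual_norm_bdd_above:
  fixes n :: "'a::euclidean_space \<Rightarrow> real"
  assumes "is_norm n"
  shows "bdd_above ((\<lambda>x. v \<bullet> x) ` {x. n x \<le> 1})"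
  by (intro bounded_imp_bdd_above compact_imp_bounded compact_continuous_image
      is_norm_compact_unit_ball[OF assms] continuous_intros)

lemma inner_le_dual_norm:
  fixes n :: "'a::euclidean_space \<Rightarrow> real"
  assumes "is_norm n"
  shows "v \<bullet> x \<le> dual_norm n v * n x"
proof (cases "x = 0")
  case False
  then have pos: "n x > 0" using is_normD(1,3)[OF assms, of x] by linarith
  have "v \<bullet> (inverse (n x) *\<^sub>R x) \<le> dual_norm n v"
    unfolding dual_norm_def using pos
    by (intro cSUP_upper dual_norm_bdd_above assms) (simp add: is_normD(4)[OF assms])
  then show ?thesis using pos by (simp add: field_simps)
qed (simp add: is_normD(2)[OF assms])

lemma dual_norm_le:
  fixes n :: "'a::euclidean_space \<Rightarrow> real"
  assumes "is_norm n" "\<And>x. n x \<le> 1 \<Longrightarrow> v \<bullet> x \<le> r"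
  shows "dual_norm n v \<le> r"
proof -
  have "0 \<in> {x. n x \<le> 1}" using is_normD(2)[OF assms(1)] by simp
  then show ?thesis unfolding dual_norm_def using assms(2) by (intro cSUP_least) auto
qed

text \<open>Being a norm itself, the dual norm is continuous and hence measurable.\<close>

lemma dual_norm_is_norm:
  fixes n :: "'a::euclidean_space \<Rightarrow> real"
  assumes n: "is_norm n"
  shows "is_norm (dual_norm n)"
proof -
  have ge: "v \<bullet> x \<le> dual_norm n v" if "n x \<le> 1" for v x
    unfolding dual_norm_def using that by (intro cSUP_upper dual_norm_bdd_above n) auto
  have nonneg: "dual_norm n v \<ge> 0" for v
    using ge[of 0 v] by (simp add: is_normD(2)[OF n])
  have zero: "dual_norm n v = 0 \<longleftrightarrow> v = 0" for v
  proof
    assume "dual_norm n v = 0"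
    then have "v \<bullet> v \<le> 0" using inner_le_dual_norm[OF n, of v v] by simp
    then show "v = 0" by (metis inner_eq_zero_iff inner_ge_zero order_antisym)
  next
    assume "v = 0"
    then have "dual_norm n v \<le> 0" by (intro dual_norm_le n) simp
    then show "dual_norm n v = 0" using nonneg[of v] by simp
  qed
  have scale_le: "dual_norm n (c *\<^sub>R v) \<le> \<bar>c\<bar> * dual_norm n v" for c v
  proof (rule dual_norm_le[OF n])
    fix x assume x: "n x \<le> 1"
    have "(c *\<^sub>R v) \<bullet> x = \<bar>c\<bar> * (v \<bullet> (sgn c *\<^sub>R x))"
      by (simp add: sgn_if)
    also have "\<dots> \<le> \<bar>c\<bar> * dual_norm n v"
      by (intro mult_left_mono ge) (use x in \<open>auto simp: sgn_if is_norm_minus[OF n] is_normD(2)[OF n]\<close>)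
    finally show "(c *\<^sub>R v) \<bullet> x \<le> \<bar>c\<bar> * dual_norm n v" .
  qed
  have scale: "dual_norm n (c *\<^sub>R v) = \<bar>c\<bar> * dual_norm n v" for c v
  proof (cases "c = 0")
    case False
    have "dual_norm n v \<le> \<bar>inverse c\<bar> * dual_norm n (c *\<^sub>R v)"
      using scale_le[of "inverse c" "c *\<^sub>R v"] False by simp
    then have "\<bar>c\<bar> * dual_norm n v \<le> dual_norm n (c *\<^sub>R v)"
      using False by (simp add: field_simps abs_inverse)
    then show ?thesis using scale_le[of c v] by simp
  qed (simp add: zero)
  have "dual_norm n (v + w) \<le> dual_norm n v + dual_norm n w" for v w
    by (rule dual_norm_le[OF n]) (simp add: inner_add_left add_mono ge)
  then show ?thesis unfolding is_norm_def using nonneg zero scale by blast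
qed

lemma dual_norm_nonneg: "is_norm n \<Longrightarrow> dual_norm n v \<ge> 0"
  using is_normD(1)[OF dual_norm_is_norm] .

lemma abs_inner_le_dual_norm:
  fixes n :: "'a::euclidean_space \<Rightarrow> real"
  assumes "is_norm n"
  shows "\<bar>v \<bullet> x\<bar> \<le> dual_norm n v * n x"
  using inner_le_dual_norm[OF assms, of v x] inner_le_dual_norm[OF assms, of v "- x"]
  by (simp add: is_norm_minus[OF assms])

lemma dual_norm_borel_measurable:
  fixes n :: "'a::euclidean_space \<Rightarrow> real"
  assumes "is_norm n"
  shows "dual_norm n \<in> borel_measurable borel"
  by (intro borel_measurable_continuous_onI is_norm_continuous_on dual_norm_is_norm assms)

lemma dual_norm_add_power2_le:
  fixes n :: "'a::euclidean_space \<Rightarrow> real"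
  assumes "is_norm n"
  shows "(dual_norm n (v + w))\<^sup>2 \<le> 2 * ((dual_norm n v)\<^sup>2 + (dual_norm n w)\<^sup>2)"
proof -
  have "(dual_norm n (v + w))\<^sup>2 \<le> (dual_norm n v + dual_norm n w)\<^sup>2"
    by (intro power_mono is_normD(5)[OF dual_norm_is_norm[OF assms]] dual_norm_nonneg[OF assms])
  also have "\<dots> \<le> 2 * ((dual_norm n v)\<^sup>2 + (dual_norm n w)\<^sup>2)"
    using sum_squares_bound[of "dual_norm n v" "dual_norm n w"] by (simp add: power2_sum)
  finally show ?thesis .
qed

lemma induced_norm_bound:
  fixes nX :: "'a::euclidean_space \<Rightarrow> real" and nY :: "'b::euclidean_space \<Rightarrow> real"
  assumes nX: "is_norm nX" and nY: "is_norm nY" and K: "linear K"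
  shows "induced_norm nX nY K \<ge> 0" "K x \<bullet> y \<le> induced_norm nX nY K * nX x * nY y"
proof -
  have "continuous_on {x. nX x \<le> 1} (\<lambda>x. dual_norm nY (K x))"
    by (rule continuous_on_compose2[OF is_norm_continuous_on[OF dual_norm_is_norm[OF nY], of UNIV]])
      (use K in \<open>auto intro!: linear_continuous_on simp: linear_conv_bounded_linear\<close>)
  then have bdd: "bdd_above ((\<lambda>x. dual_norm nY (K x)) ` {x. nX x \<le> 1})"
    by (intro bounded_imp_bdd_above compact_imp_bounded compact_continuous_image
        is_norm_compact_unit_ball[OF nX])
  have ge: "dual_norm nY (K x) \<le> induced_norm nX nY K" if "nX x \<le> 1" for x
    unfolding induced_norm_def using that by (intro cSUP_upper bdd) auto
  show nonneg: "induced_norm nX nY K \<ge> 0"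
    using order_trans[OF dual_norm_nonneg[OF nY] ge[of 0]] by (simp add: is_normD(2)[OF nX])
  have "dual_norm nY (K x) \<le> induced_norm nX nY K * nX x"
  proof (cases "x = 0")
    case True
    then show ?thesis
      by (simp add: linear_0[OF K] is_normD(2)[OF nX] is_normD(2)[OF dual_norm_is_norm[OF nY]])
  next
    case False
    then have pos: "nX x > 0" using is_normD(1,3)[OF nX, of x] by linarith
    have "dual_norm nY (K (inverse (nX x) *\<^sub>R x)) \<le> induced_norm nX nY K"
      using pos by (intro ge) (simp add: is_normD(4)[OF nX])
    then show ?thesis
      using pos by (simp add: linear_cmul[OF K] is_normD(4)[OF dual_norm_is_norm[OF nY]] field_simps)
  qed
  then have "dual_norm nY (K x) * nY y \<le> induced_norm nX nY K * nX x * nY y"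
    by (intro mult_right_mono is_normD(1)[OF nY])
  then show "K x \<bullet> y \<le> induced_norm nX nY K * nX x * nY y"
    using inner_le_dual_norm[OF nY, of "K x" y] by linarith
qed

lemma young_dual_norm:
  fixes n :: "'a::euclidean_space \<Rightarrow> real"
  assumes "is_norm n" "a > 0"
  shows "v \<bullet> x \<le> a * (n x)\<^sup>2 + (dual_norm n v)\<^sup>2 / (4 * a)"
proof -
  have "0 \<le> (2 * a * n x - dual_norm n v)\<^sup>2 / (4 * a)" using assms(2) by simp
  also have "\<dots> = a * (n x)\<^sup>2 + (dual_norm n v)\<^sup>2 / (4 * a) - dual_norm n v * n x"
    using assms(2) by (simp add: power2_eq_square field_simps)
  finally show ?thesis using inner_le_dual_norm[OF assms(1), of v x] by linarith
qed

lemma compact_if_bounded_distances: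
  fixes n :: "'a::euclidean_space \<Rightarrow> real"
  assumes n: "is_norm n" and S: "closed S" and D: "\<And>u v. u \<in> S \<Longrightarrow> v \<in> S \<Longrightarrow> n (u - v) \<le> D"
  shows "compact S"
proof (cases "S = {}")
  case False
  then obtain a where a: "a \<in> S" by blast
  obtain C where C: "C > 0" "\<And>x. norm x \<le> C * n x"
    using is_norm_dominates_norm[OF n] by blast
  have "S \<subseteq> cball a (C * D)"
  proof
    fix v assume "v \<in> S"
    then have "norm (a - v) \<le> C * D"
      using C(1) D[OF a] by (intro order_trans[OF C(2)] mult_left_mono) auto
    then show "v \<in> cball a (C * D)" by (simp add: dist_norm)
  qed
  then have "bounded S" using bounded_subset bounded_cball by blast
  then show ?thesis using S by (simp add: compact_eq_bounded_closed)
qed simp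

section \<open>Strong convexity, proximal steps and the regularized leader\<close>

text \<open>Differentiability within \<open>S\<close> determines the gradient only in directions that stay in
  \<open>S\<close>. These difference quotients along segments are all that the arguments below extract from
  it.\<close>

lemma has_gradient_on_tendsto_directional:
  assumes grad: "has_gradient_on f df S" and S: "convex S" "u \<in> S" "v \<in> S"
  shows "((\<lambda>s. (f (u + s *\<^sub>R (v - u)) - f u) / s) \<longlongrightarrow> df u \<bullet> (v - u)) (at_right 0)"
proof -
  define p where "p s = u + s *\<^sub>R (v - u)" for s :: real
  have p_mem: "p ` {0..1} \<subseteq> S"
    using S unfolding p_def by (auto simp: convex_alt algebra_simps)
  have "(f has_derivative (\<lambda>h. df u \<bullet> h)) (at (p 0) within p ` {0..1})"
    using grad S(2) p_mem unfolding has_gradient_on_def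
    by (auto simp: p_def intro: has_derivative_subset)
  moreover have "(p has_derivative (\<lambda>s. s *\<^sub>R (v - u))) (at 0 within {0..1})"
    unfolding p_def by (auto intro!: derivative_eq_intros)
  ultimately have "((\<lambda>s. f (p s)) has_derivative (\<lambda>s. df u \<bullet> (s *\<^sub>R (v - u)))) (at 0 within {0..1})"
    by (rule has_derivative_in_compose[rotated])
  then have "((\<lambda>s. f (p s)) has_real_derivative df u \<bullet> (v - u)) (at 0 within {0..1})"
    unfolding has_field_derivative_def by (rule has_derivative_eq_rhs) (auto simp: mult.commute)
  then show ?thesis
    by (simp add: has_field_derivative_iff at_within_Icc_at_right p_def)
qed

lemma has_gradient_on_continuous_on: "has_gradient_on f df S \<Longrightarrow> continuous_on S f"
  unfolding has_gradient_on_def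
  by (meson continuous_on_eq_continuous_within has_derivative_continuous)

text \<open>Strong convexity bounds the difference quotients along the segment from \<open>u\<close> to
  \<open>v\<close>, with a deficit that becomes the full quadratic term as the step tends to zero.\<close>

lemma strongly_convex_on_gradient_bound:
  assumes sc: "strongly_convex_on n \<alpha> S f" and grad: "has_gradient_on f df S"
    and S: "u \<in> S" "v \<in> S"
  shows "f v \<ge> f u + df u \<bullet> (v - u) + \<alpha> / 2 * (n (v - u))\<^sup>2"
proof -
  have conv: "convex S" using sc by (simp add: strongly_convex_on_def)
  have lim: "((\<lambda>s. f v - f u - \<alpha> / 2 * (1 - s) * (n (v - u))\<^sup>2) \<longlongrightarrow>
      f v - f u - \<alpha> / 2 * (1 - 0) * (n (v - u))\<^sup>2) (at_right 0)"
    by (intro tendsto_intros)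
  have "\<forall>\<^sub>F s in at_right 0. (f (u + s *\<^sub>R (v - u)) - f u) / s
      \<le> f v - f u - \<alpha> / 2 * (1 - s) * (n (v - u))\<^sup>2"
    unfolding eventually_at_right_field
  proof (intro exI[of _ 1] conjI allI impI)
    fix s :: real assume s: "0 < s" "s < 1"
    have "f (s *\<^sub>R v + (1 - s) *\<^sub>R u)
        \<le> s * f v + (1 - s) * f u - \<alpha> / 2 * s * (1 - s) * (n (v - u))\<^sup>2"
      using sc S s unfolding strongly_convex_on_def by auto
    also have "s *\<^sub>R v + (1 - s) *\<^sub>R u = u + s *\<^sub>R (v - u)" by (simp add: algebra_simps)
    finally have "f (u + s *\<^sub>R (v - u)) - f u
        \<le> (f v - f u - \<alpha> / 2 * (1 - s) * (n (v - u))\<^sup>2) * s"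
      by (simp add: algebra_simps)
    then show "(f (u + s *\<^sub>R (v - u)) - f u) / s
        \<le> f v - f u - \<alpha> / 2 * (1 - s) * (n (v - u))\<^sup>2"
      using s by (simp add: divide_le_eq)
  qed simp
  from tendsto_le[OF _ lim has_gradient_on_tendsto_directional[OF grad conv S] this]
  show ?thesis by simp
qed

lemma convex_on_gradient_bound:
  assumes "convex_on S f" "has_gradient_on f df S" "u \<in> S" "v \<in> S"
  shows "f v \<ge> f u + df u \<bullet> (v - u)"
proof -
  have "strongly_convex_on norm 0 S f"
    using assms(1) by (simp add: strongly_convex_on_def convex_on_def)
  from strongly_convex_on_gradient_bound[OF this assms(2-4)] show ?thesis by simp
qed

lemma bregman_lower_bound:
  assumes "strongly_convex_on n \<alpha> S d" "has_gradient_on d dd S" "u \<in> S" "v \<in> S"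
  shows "bregman d dd v u \<ge> \<alpha> / 2 * (n (v - u))\<^sup>2"
  using strongly_convex_on_gradient_bound[OF assms] by (simp add: bregman_def)

lemma is_arg_min_iff_le:
  fixes f :: "'a \<Rightarrow> real"
  shows "is_arg_min f (\<lambda>v. v \<in> S) z \<longleftrightarrow> z \<in> S \<and> (\<forall>v\<in>S. f z \<le> f v)"
  by (auto simp: is_arg_min_linorder)

text \<open>The minimality of \<open>z\<close> is tested against points on the segment from \<open>z\<close>
  to \<open>v\<close>: this gives the first-order condition at \<open>z\<close>, and the three-point identity
  for Bregman distances turns it into the claim.\<close>

lemma bregman_prox_inequality:
  assumes min: "is_arg_min (\<lambda>v. c \<bullet> v + j v + r * bregman d dd v w) (\<lambda>v. v \<in> S) z"
    and j: "convex_on S j" and grad: "has_gradient_on d dd S" and v: "v \<in> S"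
  shows "c \<bullet> (z - v) + j z - j v \<le> r * (bregman d dd v w - bregman d dd z w - bregman d dd v z)"
proof -
  have conv: "convex S" using j by (simp add: convex_on_def)
  have z: "z \<in> S" using min by (simp add: is_arg_min_iff_le)
  define L where "L s = c \<bullet> (v - z) + j v - j z
    + r * ((d (z + s *\<^sub>R (v - z)) - d z) / s - dd w \<bullet> (v - z))" for s
  have "(L \<longlongrightarrow> c \<bullet> (v - z) + j v - j z + r * (dd z \<bullet> (v - z) - dd w \<bullet> (v - z))) (at_right 0)"
    unfolding L_def by (intro tendsto_intros has_gradient_on_tendsto_directional[OF grad conv z v])
  moreover have "\<forall>\<^sub>F s in at_right 0. 0 \<le> L s"
    unfolding eventually_at_right_field
  proof (intro exI[of _ 1] conjI allI impI)
    fix s :: real assume s: "0 < s" "s < 1"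
    define q where "q = z + s *\<^sub>R (v - z)"
    have q_eq: "q = (1 - s) *\<^sub>R z + s *\<^sub>R v" by (simp add: q_def algebra_simps)
    have q: "q \<in> S" unfolding q_eq using conv z v s by (simp add: convex_alt)
    have jq: "j q \<le> (1 - s) * j z + s * j v"
      unfolding q_eq using j z v s by (simp add: convex_on_def)
    have "c \<bullet> z + j z + r * bregman d dd z w \<le> c \<bullet> q + j q + r * bregman d dd q w"
      using min q by (simp add: is_arg_min_iff_le)
    then have "0 \<le> s * (c \<bullet> (v - z) + j v - j z) + r * (d q - d z - dd w \<bullet> (q - z))"
      using jq by (simp add: bregman_def q_eq algebra_simps)
    also have "q - z = s *\<^sub>R (v - z)" by (simp add: q_def)
    also have "d q - d z = (d q - d z) / s * s" using s by simp
    finally have "0 \<le> s * (c \<bullet> (v - z) + j v - j z)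
        + r * ((d q - d z) / s * s - dd w \<bullet> (s *\<^sub>R (v - z)))" .
    then have "0 \<le> (c \<bullet> (v - z) + j v - j z + r * ((d q - d z) / s - dd w \<bullet> (v - z))) * s"
      unfolding inner_scaleR_right by (simp only: algebra_simps)
    then have "0 \<le> L s * s" by (simp only: L_def q_def)
    then show "0 \<le> L s" using s by (simp add: zero_le_mult_iff)
  qed simp
  ultimately have "0 \<le> c \<bullet> (v - z) + j v - j z + r * (dd z \<bullet> (v - z) - dd w \<bullet> (v - z))"
    by (intro tendsto_lowerbound) auto
  then show ?thesis by (simp add: bregman_def algebra_simps)
qed

lemma strongly_convex_on_add_convex:
  assumes "convex_on S j" "strongly_convex_on n \<alpha> S f" "r \<ge> 0"
  shows "strongly_convex_on n (r * \<alpha>) S (\<lambda>v. j v + r * f v)"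
  unfolding strongly_convex_on_def
proof (intro conjI ballI allI impI)
  show "convex S" using assms(1) by (simp add: convex_on_def)
  fix x y and u v :: real assume *: "x \<in> S" "y \<in> S" "u \<ge> 0" "v \<ge> 0" "u + v = 1"
  have "j (u *\<^sub>R x + v *\<^sub>R y) \<le> u * j x + v * j y"
    using assms(1) * by (simp add: convex_on_def)
  moreover have "r * f (u *\<^sub>R x + v *\<^sub>R y) \<le> r * (u * f x + v * f y - \<alpha> / 2 * u * v * (n (x - y))\<^sup>2)"
    using assms(2) * by (intro mult_left_mono assms(3)) (simp add: strongly_convex_on_def)
  ultimately show "j (u *\<^sub>R x + v *\<^sub>R y) + r * f (u *\<^sub>R x + v *\<^sub>R y)
      \<le> u * (j x + r * f x) + v * (j y + r * f y) - r * \<alpha> / 2 * u * v * (n (x - y))\<^sup>2"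
    by (simp add: algebra_simps)
qed

lemma convex_on_inner: "convex S \<Longrightarrow> convex_on S (\<lambda>v. c \<bullet> v)"
  by (simp add: convex_on_def inner_add_right)

lemma strongly_convex_on_bregman:
  assumes "strongly_convex_on n \<alpha> S d"
  shows "strongly_convex_on n \<alpha> S (\<lambda>v. bregman d dd v w)"
  unfolding strongly_convex_on_def
proof (intro conjI ballI allI impI)
  show "convex S" using assms by (simp add: strongly_convex_on_def)
  fix x y and u v :: real assume *: "x \<in> S" "y \<in> S" "u \<ge> 0" "v \<ge> 0" "u + v = 1"
  then have "d (u *\<^sub>R x + v *\<^sub>R y) \<le> u * d x + v * d y - \<alpha> / 2 * u * v * (n (x - y))\<^sup>2"
    using assms by (simp add: strongly_convex_on_def)
  moreover have "u * (d w - dd w \<bullet> w) + v * (d w - dd w \<bullet> w) = d w - dd w \<bullet> w"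
    using *(5) by (metis distrib_right mult_1)
  ultimately show "bregman d dd (u *\<^sub>R x + v *\<^sub>R y) w
      \<le> u * bregman d dd x w + v * bregman d dd y w - \<alpha> / 2 * u * v * (n (x - y))\<^sup>2"
    by (simp add: bregman_def inner_diff_right inner_add_right algebra_simps)
qed

text \<open>Points of the segment close to \<open>z\<close> have at least the value \<open>f z\<close>; strong
  convexity transports this to its other end with a quadratic gain.\<close>

lemma strongly_convex_on_arg_min_growth:
  assumes sc: "strongly_convex_on n \<alpha> S f" and min: "is_arg_min f (\<lambda>v. v \<in> S) z" and v: "v \<in> S"
  shows "f z + \<alpha> / 2 * (n (v - z))\<^sup>2 \<le> f v"
proof -
  have z: "z \<in> S" using min by (simp add: is_arg_min_iff_le)
  have lim: "((\<lambda>s. \<alpha> / 2 * (1 - s) * (n (v - z))\<^sup>2) \<longlongrightarrow> \<alpha> / 2 * (1 - 0) * (n (v - z))\<^sup>2) (at_right 0)"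
    by (intro tendsto_intros)
  have "\<forall>\<^sub>F s in at_right 0. \<alpha> / 2 * (1 - s) * (n (v - z))\<^sup>2 \<le> f v - f z"
    unfolding eventually_at_right_field
  proof (intro exI[of _ 1] conjI allI impI)
    fix s :: real assume s: "0 < s" "s < 1"
    have "s *\<^sub>R v + (1 - s) *\<^sub>R z \<in> S"
      using sc z v s by (simp add: strongly_convex_on_def convex_def)
    then have "f z \<le> f (s *\<^sub>R v + (1 - s) *\<^sub>R z)" using min by (simp add: is_arg_min_iff_le)
    also have "\<dots> \<le> s * f v + (1 - s) * f z - \<alpha> / 2 * s * (1 - s) * (n (v - z))\<^sup>2"
      using sc z v s unfolding strongly_convex_on_def by auto
    finally have "s * (\<alpha> / 2 * (1 - s) * (n (v - z))\<^sup>2) \<le> s * (f v - f z)"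
      by (simp add: algebra_simps)
    then show "\<alpha> / 2 * (1 - s) * (n (v - z))\<^sup>2 \<le> f v - f z" using s by simp
  qed simp
  from tendsto_upperbound[OF lim this] show ?thesis by simp
qed

text \<open>The step size \<open>\<alpha> r / (2 h)\<close> is weighted by \<open>r\<close>, so that the
  factors of the Bregman distances do not depend on the iteration \<open>r\<close> and telescope;
  \<open>h\<close> is then the amount of quadratic energy that the step makes available.\<close>

lemma scaled_prox_inequality:
  assumes min: "is_arg_min (\<lambda>v. c \<bullet> v + j v + 2 * h / (\<alpha> * r) * bregman d dd v w) (\<lambda>v. v \<in> S) z"
    and j: "convex_on S j" and d: "strongly_convex_on n \<alpha> S d" "has_gradient_on d dd S"
    and pos: "h > 0" "\<alpha> > 0" "r > 0" and w: "w \<in> S" and v: "v \<in> S"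
  shows "r * (c \<bullet> (z - v) + j z - j v)
    \<le> 2 * h / \<alpha> * bregman d dd v w - 2 * h / \<alpha> * bregman d dd v z - h * (n (z - w))\<^sup>2"
proof -
  have z: "z \<in> S" using min by (simp add: is_arg_min_iff_le)
  have "r * (c \<bullet> (z - v) + j z - j v) \<le> r * (2 * h / (\<alpha> * r)
      * (bregman d dd v w - bregman d dd z w - bregman d dd v z))"
    using bregman_prox_inequality[OF min j d(2) v] pos by (intro mult_left_mono) auto
  also have "\<dots> = 2 * h / \<alpha> * (bregman d dd v w - bregman d dd z w - bregman d dd v z)"
    using pos by simp
  also have "\<dots> = 2 * h / \<alpha> * bregman d dd v w - 2 * h / \<alpha> * bregman d dd z w
      - 2 * h / \<alpha> * bregman d dd v z"
    by (simp only: right_diff_distrib)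
  finally have "r * (c \<bullet> (z - v) + j z - j v) \<le> 2 * h / \<alpha> * bregman d dd v w
      - 2 * h / \<alpha> * bregman d dd z w - 2 * h / \<alpha> * bregman d dd v z" .
  moreover have "2 * h / \<alpha> * (\<alpha> / 2 * (n (z - w))\<^sup>2) \<le> 2 * h / \<alpha> * bregman d dd z w"
    using pos by (intro mult_left_mono bregman_lower_bound[OF d w z]) auto
  then have "h * (n (z - w))\<^sup>2 \<le> 2 * h / \<alpha> * bregman d dd z w" using pos by simp
  ultimately show ?thesis by linarith
qed

text \<open>Playing the minimizer of the past linear losses plus \<open>\<phi>\<close> is nearly as good as
  any fixed \<open>v\<close>: adding the loss \<open>g t\<close> raises the minimum of the cumulative
  objective by at least \<open>g t \<bullet> u t\<close> up to a quadratic term, because that objective grows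
  quadratically around \<open>u t\<close>.\<close>

lemma follow_the_regularized_leader_regret:
  fixes n :: "'a::euclidean_space \<Rightarrow> real" and T :: nat
  assumes n: "is_norm n" and sc: "strongly_convex_on n \<alpha> S \<phi>" and \<alpha>: "\<alpha> > 0"
    and \<phi>: "\<And>v. v \<in> S \<Longrightarrow> \<phi> v \<ge> 0"
    and u: "\<And>t. is_arg_min (\<lambda>v. (\<Sum>s\<in>{1..<t}. g s) \<bullet> v + \<phi> v) (\<lambda>v. v \<in> S) (u t)"
    and v: "v \<in> S"
  shows "(\<Sum>t=1..T. g t \<bullet> (u t - v)) \<le> \<phi> v + (\<Sum>t=1..T. (dual_norm n (g t))\<^sup>2 / (2 * \<alpha>))"
proof -
  have conv: "convex S" using sc by (simp add: strongly_convex_on_def)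
  have "(\<Sum>t=1..T. g t \<bullet> u t) - (\<Sum>t=1..T. (dual_norm n (g t))\<^sup>2 / (2 * \<alpha>))
      \<le> (\<Sum>t\<in>{1..<Suc T}. g t) \<bullet> v + \<phi> v"
    using v
  proof (induction T arbitrary: v)
    case 0
    then show ?case using \<phi> by simp
  next
    case (Suc T)
    define w where "w = u (Suc T)"
    define c where "c = (\<Sum>t\<in>{1..<Suc T}. g t)"
    have min: "is_arg_min (\<lambda>v. c \<bullet> v + \<phi> v) (\<lambda>v. v \<in> S) w"
      unfolding w_def c_def by (rule u)
    then have w: "w \<in> S" by (simp add: is_arg_min_iff_le)
    have "strongly_convex_on n \<alpha> S (\<lambda>v. c \<bullet> v + \<phi> v)"
      using strongly_convex_on_add_convex[OF convex_on_inner[OF conv] sc, of 1] by simp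
    from strongly_convex_on_arg_min_growth[OF this min Suc.prems]
    have "c \<bullet> w + \<phi> w + \<alpha> / 2 * (n (w - v))\<^sup>2 \<le> c \<bullet> v + \<phi> v"
      by (simp add: is_norm_diff_commute[OF n])
    moreover have "(\<Sum>t=1..T. g t \<bullet> u t) - (\<Sum>t=1..T. (dual_norm n (g t))\<^sup>2 / (2 * \<alpha>))
        \<le> c \<bullet> w + \<phi> w"
      unfolding c_def by (rule Suc.IH[OF w])
    moreover have "g (Suc T) \<bullet> (w - v)
        \<le> \<alpha> / 2 * (n (w - v))\<^sup>2 + (dual_norm n (g (Suc T)))\<^sup>2 / (2 * \<alpha>)"
      using young_dual_norm[OF n, of "\<alpha> / 2" "g (Suc T)" "w - v"] \<alpha> by simp
    ultimately have "(\<Sum>t=1..T. g t \<bullet> u t) - (\<Sum>t=1..T. (dual_norm n (g t))\<^sup>2 / (2 * \<alpha>))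
        + g (Suc T) \<bullet> (w - v) - (dual_norm n (g (Suc T)))\<^sup>2 / (2 * \<alpha>) \<le> c \<bullet> v + \<phi> v"
      by linarith
    then show ?case
      by (simp add: c_def w_def inner_diff_right inner_add_left algebra_simps)
  qed
  then show ?thesis
    by (simp add: inner_diff_right sum_subtractf inner_sum_left atLeastLessThanSuc_atLeastAtMost)
qed

text \<open>Quadratic growth around both minimizers bounds their squared distance by \<open>(c - c') \<bullet>
  (z' - z)\<close>. The minimizer is thus a continuous function of the linear term, on the set of linear terms
  for which it exists.\<close>

lemma strongly_convex_on_arg_min_linear_Lipschitz:
  fixes n :: "'a::euclidean_space \<Rightarrow> real"
  assumes n: "is_norm n" and sc: "strongly_convex_on n \<alpha> S f" and \<alpha>: "\<alpha> > 0"
  obtains C where "C \<ge> 0"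
    "\<And>c c' z z'. is_arg_min (\<lambda>v. c \<bullet> v + f v) (\<lambda>v. v \<in> S) z \<Longrightarrow>
      is_arg_min (\<lambda>v. c' \<bullet> v + f v) (\<lambda>v. v \<in> S) z' \<Longrightarrow> norm (z - z') \<le> C * norm (c - c')"
proof -
  have conv: "convex S" using sc by (simp add: strongly_convex_on_def)
  obtain B where B: "B > 0" "\<And>x. norm x \<le> B * n x"
    using is_norm_dominates_norm[OF n] by blast
  have bound: "norm (z - z') \<le> B\<^sup>2 / \<alpha> * norm (c - c')"
    if z: "is_arg_min (\<lambda>v. c \<bullet> v + f v) (\<lambda>v. v \<in> S) z"
      and z': "is_arg_min (\<lambda>v. c' \<bullet> v + f v) (\<lambda>v. v \<in> S) z'" for c c' z z'
  proof (cases "z = z'")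
    case False
    have sc': "strongly_convex_on n \<alpha> S (\<lambda>v. b \<bullet> v + f v)" for b
      using strongly_convex_on_add_convex[OF convex_on_inner[OF conv] sc, of 1] by simp
    have zS: "z \<in> S" "z' \<in> S" using z z' by (simp_all add: is_arg_min_iff_le)
    have "c \<bullet> z + f z + \<alpha> / 2 * (n (z' - z))\<^sup>2 \<le> c \<bullet> z' + f z'"
      by (rule strongly_convex_on_arg_min_growth[OF sc' z zS(2)])
    moreover have "c' \<bullet> z' + f z' + \<alpha> / 2 * (n (z - z'))\<^sup>2 \<le> c' \<bullet> z + f z"
      by (rule strongly_convex_on_arg_min_growth[OF sc' z' zS(1)])
    ultimately have "\<alpha> * (n (z - z'))\<^sup>2 \<le> (c - c') \<bullet> (z' - z)"
      by (simp add: is_norm_diff_commute[OF n, of z'] algebra_simps)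
    also have "\<dots> \<le> norm (c - c') * norm (z' - z)" by (rule norm_cauchy_schwarz)
    finally have "B\<^sup>2 * (\<alpha> * (n (z - z'))\<^sup>2) \<le> B\<^sup>2 * (norm (c - c') * norm (z - z'))"
      by (intro mult_left_mono) (simp_all add: norm_minus_commute)
    then have "\<alpha> * (B * n (z - z'))\<^sup>2 \<le> B\<^sup>2 * (norm (c - c') * norm (z - z'))"
      by (simp add: power_mult_distrib mult.left_commute)
    moreover have "\<alpha> * (norm (z - z'))\<^sup>2 \<le> \<alpha> * (B * n (z - z'))\<^sup>2"
      using \<alpha> B(2)[of "z - z'"] by (intro mult_left_mono power_mono) auto
    ultimately have "norm (z - z') * (\<alpha> * norm (z - z')) \<le> norm (z - z') * (B\<^sup>2 * norm (c - c'))"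
      by (simp add: power2_eq_square mult_ac)
    then have "\<alpha> * norm (z - z') \<le> B\<^sup>2 * norm (c - c')"
      using False by simp
    then show ?thesis using \<alpha> by (simp add: field_simps)
  qed (use \<alpha> in simp)
  show ?thesis using that[of "B\<^sup>2 / \<alpha>"] bound \<alpha> by simp
qed

lemma arg_min_linear_borel_measurable:
  fixes n :: "'a::euclidean_space \<Rightarrow> real"
  assumes n: "is_norm n" and sc: "strongly_convex_on n \<alpha> S f" and \<alpha>: "\<alpha> > 0"
    and c: "c \<in> borel_measurable A"
    and z: "\<And>\<omega>. \<omega> \<in> space A \<Longrightarrow> is_arg_min (\<lambda>v. c \<omega> \<bullet> v + f v) (\<lambda>v. v \<in> S) (z \<omega>)"
  shows "z \<in> borel_measurable A"
proof -
  obtain B where B: "B \<ge> 0"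
    "\<And>c c' z z'. is_arg_min (\<lambda>v. c \<bullet> v + f v) (\<lambda>v. v \<in> S) z \<Longrightarrow>
      is_arg_min (\<lambda>v. c' \<bullet> v + f v) (\<lambda>v. v \<in> S) z' \<Longrightarrow> norm (z - z') \<le> B * norm (c - c')"
    using strongly_convex_on_arg_min_linear_Lipschitz[OF n sc \<alpha>] by blast
  define C where "C = {c. \<exists>z. is_arg_min (\<lambda>v. c \<bullet> v + f v) (\<lambda>v. v \<in> S) z}"
  define p where "p c = (SOME z. is_arg_min (\<lambda>v. c \<bullet> v + f v) (\<lambda>v. v \<in> S) z)" for c
  have p: "is_arg_min (\<lambda>v. c \<bullet> v + f v) (\<lambda>v. v \<in> S) (p c)" if "c \<in> C" for c
    using that unfolding C_def p_def by (auto intro: someI_ex)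
  have cont: "continuous_on C p"
  proof (rule uniformly_continuous_imp_continuous, rule lipschitz_on_uniformly_continuous)
    show "B-lipschitz_on C p"
      using B(2)[OF p p] B(1) by (auto intro!: lipschitz_onI simp: dist_norm)
  qed
  have "c \<in> measurable A (restrict_space borel C)"
    using c z by (intro measurable_restrict_space2) (auto simp: C_def)
  from measurable_compose[OF this borel_measurable_continuous_on_restrict[OF cont]]
  have "(\<lambda>\<omega>. p (c \<omega>)) \<in> borel_measurable A" .
  moreover have "p (c \<omega>) = z \<omega>" if "\<omega> \<in> space A" for \<omega>
    using B(2)[OF p z[OF that], of "c \<omega>"] z[OF that] by (auto simp: C_def)
  ultimately show ?thesis by (simp cong: measurable_cong)
qed

text \<open>On a set of smaller dimension the gradient within \<open>S\<close> is arbitrary in directions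
  orthogonal to \<open>S\<close> and need not be measurable. Its projection \<open>h\<close> to the span of
  \<open>S - S\<close> is, since the inner products with \<open>v - u\<close> are limits of difference
  quotients, and it induces the same Bregman distances on \<open>S\<close>.\<close>

lemma gradient_on_measurable_representative:
  fixes S :: "'a::euclidean_space set"
  assumes conv: "convex S" and grad: "has_gradient_on d dd S"
  obtains h where "h \<in> borel_measurable (restrict_space borel S)"
    "\<And>u v w. u \<in> S \<Longrightarrow> v \<in> S \<Longrightarrow> w \<in> S \<Longrightarrow> h u \<bullet> (v - w) = dd u \<bullet> (v - w)"
proof (cases "S = {}")
  case True
  then show ?thesis using that[of "\<lambda>_. 0"] by simp
next
  case False
  then obtain a where a: "a \<in> S" by blast
  define R where "R = restrict_space borel S"
  define W where "W = span ((\<lambda>v. v - a) ` S)"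
  have cont: "continuous_on S d" by (rule has_gradient_on_continuous_on[OF grad])
  have dir: "(\<lambda>u. dd u \<bullet> (v - u)) \<in> borel_measurable R" if v: "v \<in> S" for v
  proof (rule borel_measurable_LIMSEQ_metric)
    fix i :: nat
    have "continuous_on S (\<lambda>u. (d (u + inverse (Suc i) *\<^sub>R (v - u)) - d u) / inverse (Suc i))"
    proof (intro continuous_intros cont continuous_on_compose2[OF cont])
      show "(\<lambda>u. u + inverse (Suc i) *\<^sub>R (v - u)) ` S \<subseteq> S"
      proof safe
        fix u assume "u \<in> S"
        then have "(1 - inverse (real (Suc i))) *\<^sub>R u + inverse (real (Suc i)) *\<^sub>R v \<in> S"
          using conv v by (intro convexD) (auto simp: field_simps)
        then show "u + inverse (Suc i) *\<^sub>R (v - u) \<in> S" by (simp add: algebra_simps)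
      qed
    qed auto
    then show "(\<lambda>u. (d (u + inverse (Suc i) *\<^sub>R (v - u)) - d u) / inverse (Suc i)) \<in> borel_measurable R"
      unfolding R_def by (rule borel_measurable_continuous_on_restrict)
  next
    fix u assume "u \<in> space R"
    then have u: "u \<in> S" by (simp add: R_def space_restrict_space)
    have "filterlim (\<lambda>i. inverse (real (Suc i))) (at_right 0) sequentially"
      by (intro tendsto_imp_filterlim_at_right LIMSEQ_inverse_real_of_nat always_eventually) auto
    from filterlim_compose[OF has_gradient_on_tendsto_directional[OF grad conv u v] this]
    show "(\<lambda>i. (d (u + inverse (Suc i) *\<^sub>R (v - u)) - d u) / inverse (Suc i)) \<longlonglongrightarrow> dd u \<bullet> (v - u)" .
  qed
  have W_measurable: "(\<lambda>u. dd u \<bullet> b) \<in> borel_measurable R" if "b \<in> W" for b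
    using that unfolding W_def
  proof (induction rule: span_induct_alt)
    case base
    then show ?case by simp
  next
    case (step c x y)
    then obtain v where v: "v \<in> S" "x = v - a" by blast
    have "(\<lambda>u. c * (dd u \<bullet> (v - u) - dd u \<bullet> (a - u)) + dd u \<bullet> y) \<in> borel_measurable R"
      by (intro borel_measurable_add borel_measurable_times borel_measurable_diff
          borel_measurable_const dir v(1) a step.IH)
    then show ?case by (simp add: v(2) algebra_simps)
  qed
  obtain B where B: "B \<subseteq> W" "pairwise orthogonal B" "\<And>x. x \<in> B \<Longrightarrow> norm x = 1" "independent B" "span B = W"
    using orthonormal_basis_subspace[of W] unfolding W_def by (metis subspace_span)
  have fin: "finite B" using B(4) independent_imp_finite by blast
  \<comment> \<open>The orthogonal projection of \<open>dd u\<close> to \<open>W\<close>.\<close>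
  define h where "h u = (\<Sum>b\<in>B. (dd u \<bullet> b) *\<^sub>R b)" for u
  have "h u \<bullet> x = dd u \<bullet> x" if "x \<in> W" for u x
  proof -
    have "x \<in> span B" using that B(5) by simp
    then show ?thesis
    proof (induction rule: span_induct_alt)
      case (step c b y)
      have "h u \<bullet> b = (\<Sum>b'\<in>B. if b' = b then dd u \<bullet> b else 0)"
        unfolding h_def inner_sum_left
        using B(2) B(3)[OF step(1)] step(1)
        by (intro sum.cong) (auto simp: pairwise_def orthogonal_def norm_eq_1)
      then show ?case using fin step by (simp add: inner_add_right)
    qed simp
  qed
  moreover have "v - w \<in> W" if "v \<in> S" "w \<in> S" for v w
  proof -
    have "(v - a) - (w - a) \<in> W"
      unfolding W_def using that by (intro span_diff span_base) auto
    then show ?thesis by simp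
  qed
  moreover have "h \<in> borel_measurable R"
    unfolding h_def using B(1) by (intro borel_measurable_sum borel_measurable_scaleR) (auto intro: W_measurable)
  ultimately show ?thesis using that[of h] unfolding R_def by blast
qed

text \<open>Up to a constant, the objective is a fixed strongly convex function plus the linear function
  \<open>c - r h(w)\<close>, so its minimizer is a continuous function of measurable data.\<close>

lemma prox_step_borel_measurable:
  fixes n :: "'a::euclidean_space \<Rightarrow> real"
  assumes n: "is_norm n" and sc: "strongly_convex_on n \<alpha> S d" and \<alpha>: "\<alpha> > 0"
    and grad: "has_gradient_on d dd S" and j: "convex_on S j" and r: "r > 0"
    and c: "c \<in> borel_measurable A" and w: "w \<in> measurable A (restrict_space borel S)"
    and z: "\<And>\<omega>. \<omega> \<in> space A \<Longrightarrow>
      is_arg_min (\<lambda>v. c \<omega> \<bullet> v + j v + r * bregman d dd v (w \<omega>)) (\<lambda>v. v \<in> S) (z \<omega>)"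
  shows "z \<in> measurable A (restrict_space borel S)"
proof -
  have conv: "convex S" using j by (simp add: convex_on_def)
  obtain h where h: "h \<in> borel_measurable (restrict_space borel S)"
    "\<And>u v w. u \<in> S \<Longrightarrow> v \<in> S \<Longrightarrow> w \<in> S \<Longrightarrow> h u \<bullet> (v - w) = dd u \<bullet> (v - w)"
    using gradient_on_measurable_representative[OF conv grad] by blast
  have wS: "w \<omega> \<in> S" if "\<omega> \<in> space A" for \<omega>
    using measurable_space[OF w that] by (simp add: space_restrict_space)
  have "z \<in> borel_measurable A"
  proof (rule arg_min_linear_borel_measurable[OF n strongly_convex_on_add_convex[OF j sc, of r]])
    show "(\<lambda>\<omega>. c \<omega> - r *\<^sub>R h (w \<omega>)) \<in> borel_measurable A"
      using c measurable_compose[OF w h(1)] by simp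
    fix \<omega> assume \<omega>: "\<omega> \<in> space A"
    define k where "k = r * (h (w \<omega>) \<bullet> w \<omega> - d (w \<omega>))"
    have eq: "c \<omega> \<bullet> v + j v + r * bregman d dd v (w \<omega>)
        = (c \<omega> - r *\<^sub>R h (w \<omega>)) \<bullet> v + (j v + r * d v) + k" if "v \<in> S" for v
      unfolding bregman_def k_def h(2)[OF wS[OF \<omega>] that wS[OF \<omega>], symmetric]
      by (simp add: algebra_simps)
    have zS: "z \<omega> \<in> S" using z[OF \<omega>] by (simp add: is_arg_min_iff_le)
    show "is_arg_min (\<lambda>v. (c \<omega> - r *\<^sub>R h (w \<omega>)) \<bullet> v + (j v + r * d v)) (\<lambda>v. v \<in> S) (z \<omega>)"
      unfolding is_arg_min_iff_le
    proof (intro conjI ballI zS)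
      fix v assume v: "v \<in> S"
      have "c \<omega> \<bullet> z \<omega> + j (z \<omega>) + r * bregman d dd (z \<omega>) (w \<omega>)
          \<le> c \<omega> \<bullet> v + j v + r * bregman d dd v (w \<omega>)"
        using z[OF \<omega>] v unfolding is_arg_min_iff_le by blast
      then show "(c \<omega> - r *\<^sub>R h (w \<omega>)) \<bullet> z \<omega> + (j (z \<omega>) + r * d (z \<omega>))
          \<le> (c \<omega> - r *\<^sub>R h (w \<omega>)) \<bullet> v + (j v + r * d v)"
        unfolding eq[OF v] eq[OF zS] by (rule add_le_imp_le_right)
    qed
  qed (use r \<alpha> in auto)
  then show ?thesis
    using z by (intro measurable_restrict_space2) (auto simp: is_arg_min_iff_le)
qed

text \<open>The losses are the errors with the sign and the weights \<open>s\<close> with which they enter the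
  energy inequality.\<close>

definition leader :: "'a::real_inner set \<Rightarrow> ('a \<Rightarrow> real) \<Rightarrow> (nat \<Rightarrow> 'a) \<Rightarrow> nat \<Rightarrow> 'a" where
  "leader S \<phi> e t = (SOME z. is_arg_min (\<lambda>v. (\<Sum>s\<in>{1..<t}. - (real s *\<^sub>R e s)) \<bullet> v + \<phi> v) (\<lambda>v. v \<in> S) z)"

lemma leader_is_arg_min:
  fixes S :: "'a::euclidean_space set"
  assumes "compact S" "S \<noteq> {}" "has_gradient_on d dd S"
  shows "is_arg_min (\<lambda>v. (\<Sum>s\<in>{1..<t}. - (real s *\<^sub>R e s)) \<bullet> v + r * bregman d dd v w) (\<lambda>v. v \<in> S)
    (leader S (\<lambda>v. r * bregman d dd v w) e t)"
proof -
  have "continuous_on S (\<lambda>v. c \<bullet> v + r * bregman d dd v w)" for c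
    unfolding bregman_def by (intro continuous_intros has_gradient_on_continuous_on[OF assms(3)])
  from continuous_attains_inf[OF assms(1,2) this] show ?thesis
    unfolding leader_def is_arg_min_iff_le Bex_def by (rule someI_ex)
qed

lemma leader_borel_measurable:
  fixes S :: "'a::euclidean_space set"
  assumes S: "compact S" "S \<noteq> {}" and grad: "has_gradient_on d dd S"
    and n: "is_norm n" and sc: "strongly_convex_on n \<alpha> S d" and pos: "\<alpha> > 0" "r > 0"
    and e: "\<And>s. s \<in> {1..<t} \<Longrightarrow> e s \<in> borel_measurable A"
  shows "(\<lambda>\<omega>. leader S (\<lambda>v. r * bregman d dd v w) (\<lambda>s. e s \<omega>) t) \<in> borel_measurable A"
proof (rule arg_min_linear_borel_measurable[OF n])
  have "convex_on S (\<lambda>_. 0::real)" using sc by (simp add: convex_on_def strongly_convex_on_def)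
  from strongly_convex_on_add_convex[OF this strongly_convex_on_bregman[OF sc], of r]
  show "strongly_convex_on n (r * \<alpha>) S (\<lambda>v. r * bregman d dd v w)" using pos by simp
  show "0 < r * \<alpha>" using pos by simp
  show "(\<lambda>\<omega>. \<Sum>s\<in>{1..<t}. - (real s *\<^sub>R e s \<omega>)) \<in> borel_measurable A"
    using e by (intro borel_measurable_sum) auto
qed (rule leader_is_arg_min[OF S grad])

text \<open>The inner products with a comparison point \<open>v\<close> that may anticipate the noise are
  bounded by those with the leaders. The regularizer \<open>2 a / \<alpha>\<close> times the Bregman distance
  is \<open>2 a\<close>-strongly convex and, on a domain of squared Bregman radius \<open>\<alpha> D\<^sup>2 /
  2\<close>, at most \<open>a D\<^sup>2\<close>.\<close>

lemma leader_regret: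
  fixes n :: "'a::euclidean_space \<Rightarrow> real" and T :: nat
  assumes n: "is_norm n" and sc: "strongly_convex_on n \<alpha> S d" and grad: "has_gradient_on d dd S"
    and pos: "\<alpha> > 0" "a > 0"
    and V: "\<And>v. v \<in> S \<Longrightarrow> bregman d dd v w \<le> \<alpha> * D\<^sup>2 / 2" and w: "w \<in> S"
    and p: "\<And>t. is_arg_min (\<lambda>v. (\<Sum>s\<in>{1..<t}. - (real s *\<^sub>R e s)) \<bullet> v + 2 * a / \<alpha> * bregman d dd v w)
      (\<lambda>v. v \<in> S) (p t)"
    and v: "v \<in> S"
  shows "(\<Sum>t=1..T. real t * (e t \<bullet> (v - q t)))
    \<le> a * D\<^sup>2 + (\<Sum>t=1..T. real t * (e t \<bullet> (p t - q t))) + (\<Sum>t=1..T. (real t)\<^sup>2 * (dual_norm n (e t))\<^sup>2 / (4 * a))"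
proof -
  have conv: "convex S" using sc by (simp add: strongly_convex_on_def)
  have "convex_on S (\<lambda>_. 0::real)" using conv by (simp add: convex_on_def)
  from strongly_convex_on_add_convex[OF this strongly_convex_on_bregman[OF sc], of "2 * a / \<alpha>"]
  have sc': "strongly_convex_on n (2 * a) S (\<lambda>v. 2 * a / \<alpha> * bregman d dd v w)"
    using pos by simp
  have nonneg: "0 \<le> 2 * a / \<alpha> * bregman d dd v w" if "v \<in> S" for v
    using order_trans[OF _ bregman_lower_bound[OF sc grad w that], of 0] pos by simp
  have "(\<Sum>t=1..T. - (real t *\<^sub>R e t) \<bullet> (p t - v)) \<le> 2 * a / \<alpha> * bregman d dd v w
      + (\<Sum>t=1..T. (dual_norm n (- (real t *\<^sub>R e t)))\<^sup>2 / (2 * (2 * a)))"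
    using pos by (intro follow_the_regularized_leader_regret[OF n sc' _ nonneg p v]) auto
  also have "2 * a / \<alpha> * bregman d dd v w \<le> 2 * a / \<alpha> * (\<alpha> * D\<^sup>2 / 2)"
    using pos by (intro mult_left_mono V v) auto
  also have "2 * a / \<alpha> * (\<alpha> * D\<^sup>2 / 2) = a * D\<^sup>2" using pos by simp
  finally have "(\<Sum>t=1..T. real t * (e t \<bullet> (v - p t)))
      \<le> a * D\<^sup>2 + (\<Sum>t=1..T. (real t)\<^sup>2 * (dual_norm n (e t))\<^sup>2 / (4 * a))"
    by (simp add: is_norm_minus[OF dual_norm_is_norm[OF n]] is_normD(4)[OF dual_norm_is_norm[OF n]]
        power_mult_distrib inner_diff_right right_diff_distrib)
  moreover have "(\<Sum>t=1..T. real t * (e t \<bullet> (v - q t)))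
      = (\<Sum>t=1..T. real t * (e t \<bullet> (v - p t))) + (\<Sum>t=1..T. real t * (e t \<bullet> (p t - q t)))"
    by (simp add: sum.distrib[symmetric] algebra_simps)
  ultimately show ?thesis by linarith
qed

section \<open>The energy estimate along one trajectory\<close>

locale saddle_point =
  fixes nX :: "'a::euclidean_space \<Rightarrow> real" and nY :: "'b::euclidean_space \<Rightarrow> real"
    and X :: "'a set" and Y :: "'b set"
    and G :: "'a \<Rightarrow> real" and dG :: "'a \<Rightarrow> 'a" and LG :: real
    and K :: "'a \<Rightarrow> 'b" and LK :: real and J :: "'b \<Rightarrow> real"
    and dX :: "'a \<Rightarrow> real" and ddX :: "'a \<Rightarrow> 'a" and \<alpha>X :: real
    and dY :: "'b \<Rightarrow> real" and ddY :: "'b \<Rightarrow> 'b" and \<alpha>Y :: real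
    and \<Omega>X \<Omega>Y DX DY :: real
  assumes norms: "is_norm nX" "is_norm nY"
    and sets: "closed X" "convex X" "closed Y" "convex Y"
    and G_convex: "convex_on X G" and G_gradient: "has_gradient_on G dG X"
    and LG_nonneg: "LG \<ge> 0"
    and G_smooth: "\<And>u v. u \<in> X \<Longrightarrow> v \<in> X \<Longrightarrow> G v - G u - dG u \<bullet> (v - u) \<le> LG / 2 * (nX (v - u))\<^sup>2"
    and K_linear: "linear K" and LK: "LK = induced_norm nX nY K"
    and J: "convex_on Y J" "lower_semicontinuous_on Y J"
    and \<alpha>_pos: "\<alpha>X > 0" "\<alpha>Y > 0"
    and dX: "strongly_convex_on nX \<alpha>X X dX" "has_gradient_on dX ddX X"
    and dY: "strongly_convex_on nY \<alpha>Y Y dY" "has_gradient_on dY ddY Y"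
    and \<Omega>_pos: "\<Omega>X > 0" "\<Omega>Y > 0"
    and \<Omega>X: "\<And>u v. u \<in> X \<Longrightarrow> v \<in> X \<Longrightarrow> bregman dX ddX u v \<le> \<Omega>X\<^sup>2"
    and \<Omega>Y: "\<And>u v. u \<in> Y \<Longrightarrow> v \<in> Y \<Longrightarrow> bregman dY ddY u v \<le> \<Omega>Y\<^sup>2"
    and DX: "DX = \<Omega>X * sqrt (2 / \<alpha>X)" and DY: "DY = \<Omega>Y * sqrt (2 / \<alpha>Y)"
begin

abbreviation "VX \<equiv> bregman dX ddX"
abbreviation "VY \<equiv> bregman dY ddY"

lemma D_pos: "DX > 0" "DY > 0"
  using \<alpha>_pos \<Omega>_pos by (simp_all add: DX DY)

lemma V_le: "u \<in> X \<Longrightarrow> u' \<in> X \<Longrightarrow> VX u u' \<le> \<alpha>X * DX\<^sup>2 / 2"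
  "v \<in> Y \<Longrightarrow> v' \<in> Y \<Longrightarrow> VY v v' \<le> \<alpha>Y * DY\<^sup>2 / 2"
  using \<Omega>X \<Omega>Y \<alpha>_pos by (simp_all add: DX DY power_mult_distrib)

lemma scaled_V_ge:
  "h \<ge> 0 \<Longrightarrow> u \<in> X \<Longrightarrow> u' \<in> X \<Longrightarrow> h * (nX (u - u'))\<^sup>2 \<le> 2 * h / \<alpha>X * VX u u'"
  "h \<ge> 0 \<Longrightarrow> v \<in> Y \<Longrightarrow> v' \<in> Y \<Longrightarrow> h * (nY (v - v'))\<^sup>2 \<le> 2 * h / \<alpha>Y * VY v v'"
  using mult_left_mono[OF bregman_lower_bound[OF dX], of u' u "2 * h / \<alpha>X"]
    mult_left_mono[OF bregman_lower_bound[OF dY], of v' v "2 * h / \<alpha>Y"] \<alpha>_pos by simp_all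

lemma scaled_V_le:
  "h \<ge> 0 \<Longrightarrow> u \<in> X \<Longrightarrow> u' \<in> X \<Longrightarrow> 2 * h / \<alpha>X * VX u u' \<le> h * DX\<^sup>2"
  "h \<ge> 0 \<Longrightarrow> v \<in> Y \<Longrightarrow> v' \<in> Y \<Longrightarrow> 2 * h / \<alpha>Y * VY v v' \<le> h * DY\<^sup>2"
  using mult_left_mono[OF V_le(1), of u u' "2 * h / \<alpha>X"]
    mult_left_mono[OF V_le(2), of v v' "2 * h / \<alpha>Y"] \<alpha>_pos by simp_all

lemma diameter: "u \<in> X \<Longrightarrow> u' \<in> X \<Longrightarrow> nX (u - u') \<le> DX"
  "v \<in> Y \<Longrightarrow> v' \<in> Y \<Longrightarrow> nY (v - v') \<le> DY"
proof -
  show "nX (u - u') \<le> DX" if "u \<in> X" "u' \<in> X"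
  proof (rule power2_le_imp_le)
    show "(nX (u - u'))\<^sup>2 \<le> DX\<^sup>2"
      using scaled_V_ge(1)[of 1, OF _ that] scaled_V_le(1)[of 1, OF _ that] by simp
  qed (use D_pos in simp)
  show "nY (v - v') \<le> DY" if "v \<in> Y" "v' \<in> Y"
  proof (rule power2_le_imp_le)
    show "(nY (v - v'))\<^sup>2 \<le> DY\<^sup>2"
      using scaled_V_ge(2)[of 1, OF _ that] scaled_V_le(2)[of 1, OF _ that] by simp
  qed (use D_pos in simp)
qed

lemma compact_domains: "compact X" "compact Y"
  using compact_if_bounded_distances[OF norms(1) sets(1) diameter(1)]
    compact_if_bounded_distances[OF norms(2) sets(3) diameter(2)] by blast+

lemma LK_nonneg: "LK \<ge> 0" and K_bound: "K u \<bullet> v \<le> LK * nX u * nY v"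
  unfolding LK using induced_norm_bound[OF norms K_linear] by simp_all

text \<open>Young's inequality, weighted by the diameters so that both sides scale in the same way: in terms
  of \<open>nX u / DX\<close> and \<open>nY v / DY\<close> it is symmetric.\<close>

lemma coupling_bound:
  assumes "c \<ge> 0"
  shows "c * (K u \<bullet> v) \<le> c * (LK * DY / (2 * DX)) * (nX u)\<^sup>2 + c * (LK * DX / (2 * DY)) * (nY v)\<^sup>2"
proof -
  have "2 * (nX u * DY) * (nY v * DX) \<le> (nX u * DY)\<^sup>2 + (nY v * DX)\<^sup>2"
    by (rule sum_squares_bound)
  then have "nX u * nY v \<le> DY / (2 * DX) * (nX u)\<^sup>2 + DX / (2 * DY) * (nY v)\<^sup>2"
    using D_pos by (simp add: field_simps power2_eq_square)
  then have "LK * (nX u * nY v) \<le> LK * (DY / (2 * DX) * (nX u)\<^sup>2 + DX / (2 * DY) * (nY v)\<^sup>2)"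
    by (rule mult_left_mono[OF _ LK_nonneg])
  then have "K u \<bullet> v \<le> LK * (DY / (2 * DX) * (nX u)\<^sup>2 + DX / (2 * DY) * (nY v)\<^sup>2)"
    using K_bound[of u v] by (simp add: mult.assoc)
  then have "c * (K u \<bullet> v) \<le> c * (LK * (DY / (2 * DX) * (nX u)\<^sup>2 + DX / (2 * DY) * (nY v)\<^sup>2))"
    by (rule mult_left_mono[OF _ assms])
  then show ?thesis by (simp add: algebra_simps)
qed

end

text \<open>One realization of the method. The numbers \<open>hX\<close> and \<open>hY\<close> encode the step
  sizes; \<open>aX\<close> and \<open>aY\<close> are the parts of them that remain for the noise after the
  curvature of \<open>G\<close> and the coupling have been paid for.\<close>

locale apd_path = saddle_point +
  fixes N :: nat and \<beta> \<theta> \<eta> \<tau> :: "nat \<Rightarrow> real" and hX hY aX aY :: real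
    and oG :: "nat \<Rightarrow> 'a \<Rightarrow> 'a" and oKx :: "nat \<Rightarrow> 'a \<Rightarrow> 'b" and oKy :: "nat \<Rightarrow> 'b \<Rightarrow> 'a"
    and x1 :: 'a and y1 :: 'b
    and x xmd xag xbar :: "nat \<Rightarrow> 'a" and y yag :: "nat \<Rightarrow> 'b"
  assumes N: "N \<ge> 2"
    and aX: "aX > 0" "aX + LG + (real N - 1) * (LK * DY / (2 * DX)) \<le> hX"
    and aY: "aY > 0" "aY + (real N - 1) * (LK * DX / (2 * DY)) \<le> hY"
    and \<beta>: "\<And>t. \<beta> t = (real t + 1) / 2"
    and \<theta>: "\<And>t. \<theta> t = (real t - 1) / real t"
    and \<eta>: "\<And>t. \<eta> t = \<alpha>X * real t / (2 * hX)"
    and \<tau>: "\<And>t. \<tau> t = \<alpha>Y * real t / (2 * hY)"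
    and start: "x1 \<in> X" "y1 \<in> Y"
    and trajectory: "APD_trajectory X Y J (bregman dX ddX) (bregman dY ddY) \<beta> \<theta> \<eta> \<tau> N
        oG oKx oKy x1 y1 x y xmd xag yag xbar"
begin

lemma h_pos: "hX > 0" "hY > 0"
  using aX aY LG_nonneg LK_nonneg D_pos N
  by (auto intro!: less_le_trans[OF _ aX(2)] less_le_trans[OF _ aY(2)] add_pos_nonneg mult_nonneg_nonneg)

lemma initial: "x 1 = x1" "y 1 = y1" "xag 1 = x1" "yag 1 = y1" "xbar 1 = x1"
  using trajectory by (simp_all add: APD_trajectory_def)

lemma recursion:
  assumes "t \<in> {1..N - 1}"
  shows "xmd t = (1 - 2 / (real t + 1)) *\<^sub>R xag t + (2 / (real t + 1)) *\<^sub>R x t"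
    "is_arg_min (\<lambda>v. - oKx t (xbar t) \<bullet> v + J v + 2 * hY / (\<alpha>Y * real t) * VY v (y t))
      (\<lambda>v. v \<in> Y) (y (t + 1))"
    "is_arg_min (\<lambda>u. (oG t (xmd t) + oKy t (y (t + 1))) \<bullet> u + 0 + 2 * hX / (\<alpha>X * real t) * VX u (x t))
      (\<lambda>u. u \<in> X) (x (t + 1))"
    "xag (t + 1) = (1 - 2 / (real t + 1)) *\<^sub>R xag t + (2 / (real t + 1)) *\<^sub>R x (t + 1)"
    "yag (t + 1) = (1 - 2 / (real t + 1)) *\<^sub>R yag t + (2 / (real t + 1)) *\<^sub>R y (t + 1)"
    "xbar (t + 1) = (real t / real (t + 1)) *\<^sub>R (x (t + 1) - x t) + x (t + 1)"
proof -
  have *: "xmd t = (1 - inverse ((real t + 1) / 2)) *\<^sub>R xag t + inverse ((real t + 1) / 2) *\<^sub>R x t \<and>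
    is_arg_min (\<lambda>v. - oKx t (xbar t) \<bullet> v + J v + 1 / (\<alpha>Y * real t / (2 * hY)) * VY v (y t))
      (\<lambda>v. v \<in> Y) (y (t + 1)) \<and>
    is_arg_min (\<lambda>u. oG t (xmd t) \<bullet> u + u \<bullet> oKy t (y (t + 1)) + 1 / (\<alpha>X * real t / (2 * hX)) * VX u (x t))
      (\<lambda>u. u \<in> X) (x (t + 1)) \<and>
    xag (t + 1) = (1 - inverse ((real t + 1) / 2)) *\<^sub>R xag t + inverse ((real t + 1) / 2) *\<^sub>R x (t + 1) \<and>
    yag (t + 1) = (1 - inverse ((real t + 1) / 2)) *\<^sub>R yag t + inverse ((real t + 1) / 2) *\<^sub>R y (t + 1) \<and>
    xbar (t + 1) = ((real (t + 1) - 1) / real (t + 1)) *\<^sub>R (x (t + 1) - x t) + x (t + 1)"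
    using trajectory assms unfolding APD_trajectory_def \<beta> \<theta> \<eta> \<tau> by blast
  have eq: "(oG t (xmd t) + oKy t (y (t + 1))) \<bullet> u = oG t (xmd t) \<bullet> u + u \<bullet> oKy t (y (t + 1))" for u
    by (simp add: inner_add_left inner_commute[of u])
  show "xmd t = (1 - 2 / (real t + 1)) *\<^sub>R xag t + (2 / (real t + 1)) *\<^sub>R x t"
    "xag (t + 1) = (1 - 2 / (real t + 1)) *\<^sub>R xag t + (2 / (real t + 1)) *\<^sub>R x (t + 1)"
    "yag (t + 1) = (1 - 2 / (real t + 1)) *\<^sub>R yag t + (2 / (real t + 1)) *\<^sub>R y (t + 1)"
    "xbar (t + 1) = (real t / real (t + 1)) *\<^sub>R (x (t + 1) - x t) + x (t + 1)"
    using * by simp_all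
  show "is_arg_min (\<lambda>v. - oKx t (xbar t) \<bullet> v + J v + 2 * hY / (\<alpha>Y * real t) * VY v (y t))
      (\<lambda>v. v \<in> Y) (y (t + 1))"
    "is_arg_min (\<lambda>u. (oG t (xmd t) + oKy t (y (t + 1))) \<bullet> u + 0 + 2 * hX / (\<alpha>X * real t) * VX u (x t))
      (\<lambda>u. u \<in> X) (x (t + 1))"
    unfolding eq using *[THEN conjunct2, THEN conjunct1] *[THEN conjunct2, THEN conjunct2, THEN conjunct1]
    by simp_all
qed

lemma averaging_weight:
  assumes "t \<ge> 1"
  shows "0 \<le> 1 - 2 / (real t + 1)" "0 \<le> 2 / (real t + 1)"
  using assms by (auto simp: field_simps)

lemma iterates_mem:
  assumes "t \<in> {1..N}"
  shows "x t \<in> X" "y t \<in> Y" "xag t \<in> X" "yag t \<in> Y"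
proof -
  have "x t \<in> X \<and> y t \<in> Y \<and> xag t \<in> X \<and> yag t \<in> Y"
    using assms
  proof (induction t)
    case 0
    then show ?case by simp
  next
    case (Suc t)
    show ?case
    proof (cases "t = 0")
      case True
      then show ?thesis using start initial by simp
    next
      case False
      with Suc have t: "t \<in> {1..N - 1}" "t \<ge> 1" "t \<in> {1..N}" by auto
      have "x (t + 1) \<in> X" "y (t + 1) \<in> Y"
        using recursion(2,3)[OF t(1)] by (simp_all add: is_arg_min_iff_le)
      moreover from this have "xag (t + 1) \<in> X" "yag (t + 1) \<in> Y"
        unfolding recursion(4,5)[OF t(1)] using Suc.IH[OF t(3)] averaging_weight[OF t(2)] sets
        by (auto intro!: convexD)
      ultimately show ?thesis by simp
    qed
  qed
  then show "x t \<in> X" "y t \<in> Y" "xag t \<in> X" "yag t \<in> Y" by simp_all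
qed

lemma xmd_mem: "t \<in> {1..N - 1} \<Longrightarrow> xmd t \<in> X"
  using iterates_mem[of t] averaging_weight[of t] sets
  by (auto simp: recursion(1) intro!: convexD)

lemma xbar_mem: "t \<in> {1..N} \<Longrightarrow> xbar t \<in> extrapolations X"
proof (cases "t = 1")
  case True
  have "x1 = 0 *\<^sub>R (x1 - x1) + x1" by simp
  then show ?thesis using True start unfolding extrapolations_def initial True by fastforce
next
  case False
  assume "t \<in> {1..N}"
  with False obtain s where s: "t = s + 1" "s \<in> {1..N - 1}"
    using N by (intro that[of "t - 1"]) auto
  have "x (s + 1) \<in> X" "x s \<in> X" using iterates_mem s by auto
  moreover have "0 \<le> real s / real (s + 1)" "real s / real (s + 1) \<le> 1" by auto
  ultimately show ?thesis
    unfolding s(1) recursion(6)[OF s(2)] extrapolations_def by blast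
qed

text \<open>Multiplied by \<open>t\<close>, the extrapolation step has the weight \<open>t - 1\<close> with
  which the previous step occurs in the energy, so that the bilinear terms telescope. For \<open>t = 1\<close>
  the value of \<open>x 0\<close> is multiplied by zero.\<close>

lemma xbar_eq:
  assumes "t \<in> {1..N}"
  shows "real t *\<^sub>R xbar t = (real t - 1) *\<^sub>R (x t - x (t - 1)) + real t *\<^sub>R x t"
proof (cases "t = 1")
  case True
  then show ?thesis using initial by simp
next
  case False
  with assms obtain s where s: "t = s + 1" "s \<in> {1..N - 1}"
    using N by (intro that[of "t - 1"]) auto
  have "real (s + 1) *\<^sub>R xbar (s + 1) = real s *\<^sub>R (x (s + 1) - x s) + real (s + 1) *\<^sub>R x (s + 1)"
    unfolding recursion(6)[OF s(2)] scaleR_add_right by simp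
  then show ?thesis by (simp add: s(1))
qed

definition eG :: "nat \<Rightarrow> 'a" where "eG t = oG t (xmd t) - dG (xmd t)"
definition eK :: "nat \<Rightarrow> 'a" where "eK t = oKy t (y (t + 1)) - adjoint K (y (t + 1))"
definition eY :: "nat \<Rightarrow> 'b" where "eY t = K (xbar t) - oKx t (xbar t)"

text \<open>Smoothness at \<open>xmd t\<close> bounds the value at the new average, convexity bounds the
  values at the old average and at \<open>u\<close> from below. Since \<open>xag (t + 1) - xmd t\<close> is
  \<open>2 / (t + 1)\<close> times the step of \<open>x\<close>, the quadratic term keeps a bounded factor
  although the weights grow like \<open>t\<^sup>2\<close>.\<close>

lemma G_aggregate_step:
  assumes t: "t \<in> {1..N - 1}" and u: "u \<in> X"
  shows "real t * (real t + 1) / 2 * (G (xag (t + 1)) - G u)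
    \<le> real t * (real t - 1) / 2 * (G (xag t) - G u) + real t * (dG (xmd t) \<bullet> (x (t + 1) - u))
      + LG * (nX (x (t + 1) - x t))\<^sup>2"
proof -
  define b where "b = 2 / (real t + 1)"
  define w where "w = real t * (real t + 1) / 2"
  define g where "g = dG (xmd t)"
  have t1: "t \<ge> 1" "t \<in> {1..N}" "t + 1 \<in> {1..N}" using t by auto
  have wb: "w * b = real t" "w * (1 - b) = real t * (real t - 1) / 2" "w \<ge> 0"
    by (auto simp: w_def b_def field_simps)
  have "w * b\<^sup>2 = w * b * b" by (simp add: power2_eq_square)
  also have "\<dots> = 2 * (real t / (real t + 1))" unfolding wb by (simp add: b_def)
  finally have wb2: "w * b\<^sup>2 = 2 * (real t / (real t + 1))" .
  have md: "xmd t = (1 - b) *\<^sub>R xag t + b *\<^sub>R x t"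
    and ag: "xag (t + 1) = (1 - b) *\<^sub>R xag t + b *\<^sub>R x (t + 1)"
    using recursion(1,4)[OF t] by (simp_all add: b_def)
  have diff: "xag (t + 1) - xmd t = b *\<^sub>R (x (t + 1) - x t)"
    unfolding md ag by (simp add: algebra_simps)
  have mem: "xmd t \<in> X" "xag t \<in> X" "xag (t + 1) \<in> X"
    using xmd_mem[OF t] iterates_mem[OF t1(2)] iterates_mem[OF t1(3)] by auto
  have "G (xag (t + 1)) \<le> G (xmd t) + g \<bullet> (xag (t + 1) - xmd t) + LG / 2 * (nX (xag (t + 1) - xmd t))\<^sup>2"
    using G_smooth[OF mem(1,3)] by (simp add: g_def)
  also have "(nX (xag (t + 1) - xmd t))\<^sup>2 = b\<^sup>2 * (nX (x (t + 1) - x t))\<^sup>2"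
    unfolding diff by (simp add: is_normD(4)[OF norms(1)] power_mult_distrib)
  finally have "w * G (xag (t + 1)) \<le> w * (G (xmd t) + g \<bullet> (xag (t + 1) - xmd t)
      + LG / 2 * (b\<^sup>2 * (nX (x (t + 1) - x t))\<^sup>2))"
    by (rule mult_left_mono[OF _ wb(3)])
  also have "\<dots> = w * (G (xmd t) + g \<bullet> (xag (t + 1) - xmd t))
      + (w * b\<^sup>2) * (LG / 2 * (nX (x (t + 1) - x t))\<^sup>2)"
    by (simp only: algebra_simps)
  also have "\<dots> = w * (G (xmd t) + g \<bullet> (xag (t + 1) - xmd t))
      + real t / (real t + 1) * (LG * (nX (x (t + 1) - x t))\<^sup>2)"
  proof -
    have "2 * r * (LG / 2 * q) = r * (LG * q)" for r q by simp
    then show ?thesis unfolding wb2 by presburger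
  qed
  also have "\<dots> \<le> w * (G (xmd t) + g \<bullet> (xag (t + 1) - xmd t)) + 1 * (LG * (nX (x (t + 1) - x t))\<^sup>2)"
    by (intro add_left_mono mult_right_mono) (auto simp: LG_nonneg)
  finally have 1: "w * G (xag (t + 1)) \<le> w * (G (xmd t) + g \<bullet> (xag (t + 1) - xmd t))
      + LG * (nX (x (t + 1) - x t))\<^sup>2" by simp
  have "w * (G (xmd t) + g \<bullet> (xag (t + 1) - xmd t))
      = w * (1 - b) * (G (xmd t) + g \<bullet> (xag t - xmd t)) + w * b * (G (xmd t) + g \<bullet> (x (t + 1) - xmd t))"
    unfolding ag by (simp add: algebra_simps)
  also have "w * (1 - b) * (G (xmd t) + g \<bullet> (xag t - xmd t)) \<le> w * (1 - b) * G (xag t)"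
    using convex_on_gradient_bound[OF G_convex G_gradient mem(1,2)] t1
    by (intro mult_left_mono) (auto simp: g_def wb)
  finally have 2: "w * (G (xmd t) + g \<bullet> (xag (t + 1) - xmd t))
      \<le> real t * (real t - 1) / 2 * G (xag t) + real t * (G (xmd t) + g \<bullet> (x (t + 1) - xmd t))"
    unfolding wb by simp
  have "real t * (G (xmd t) + g \<bullet> (u - xmd t)) \<le> real t * G u"
    using convex_on_gradient_bound[OF G_convex G_gradient mem(1) u]
    by (intro mult_left_mono) (auto simp: g_def)
  then have 3: "real t * (G (xmd t) + g \<bullet> (x (t + 1) - xmd t)) \<le> real t * G u + real t * (g \<bullet> (x (t + 1) - u))"
    by (simp add: algebra_simps)
  have "w * G u = real t * (real t - 1) / 2 * G u + real t * G u"
    by (simp add: w_def field_simps)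
  with 1 2 3 show ?thesis
    unfolding w_def[symmetric] g_def[symmetric] right_diff_distrib by linarith
qed

lemma J_aggregate_step:
  assumes t: "t \<in> {1..N - 1}"
  shows "real t * (real t + 1) / 2 * (J (yag (t + 1)) - J v)
    \<le> real t * (real t - 1) / 2 * (J (yag t) - J v) + real t * (J (y (t + 1)) - J v)"
proof -
  define b where "b = 2 / (real t + 1)"
  define w where "w = real t * (real t + 1) / 2"
  have t1: "t \<ge> 1" "t \<in> {1..N}" "t + 1 \<in> {1..N}" using t by auto
  have wb: "w * b = real t" "w * (1 - b) = real t * (real t - 1) / 2" "w \<ge> 0"
    by (auto simp: w_def b_def field_simps)
  have "J (yag (t + 1)) \<le> (1 - b) * J (yag t) + b * J (y (t + 1))"
    unfolding recursion(5)[OF t] b_def[symmetric]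
    using iterates_mem[OF t1(2)] iterates_mem[OF t1(3)] averaging_weight[OF t1(1)]
    by (intro convex_onD[OF J(1)]) (simp_all add: b_def)
  then have "w * J (yag (t + 1)) \<le> w * ((1 - b) * J (yag t) + b * J (y (t + 1)))"
    by (rule mult_left_mono[OF _ wb(3)])
  also have "\<dots> = w * (1 - b) * J (yag t) + w * b * J (y (t + 1))" by (simp add: algebra_simps)
  finally have "w * J (yag (t + 1)) \<le> real t * (real t - 1) / 2 * J (yag t) + real t * J (y (t + 1))"
    unfolding wb .
  moreover have "w * J v = real t * (real t - 1) / 2 * J v + real t * J v"
    by (simp add: w_def field_simps)
  ultimately show ?thesis
    unfolding w_def[symmetric] right_diff_distrib by linarith
qed

lemma K_aggregate_step:
  assumes t: "t \<in> {1..N - 1}"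
  shows "real t * (real t + 1) / 2 * (K (xag (t + 1)) \<bullet> v - K u \<bullet> yag (t + 1))
    = real t * (real t - 1) / 2 * (K (xag t) \<bullet> v - K u \<bullet> yag t)
      + real t * (K (x (t + 1)) \<bullet> v - K u \<bullet> y (t + 1))"
proof -
  define b where "b = 2 / (real t + 1)"
  define w where "w = real t * (real t + 1) / 2"
  have wb: "w * b = real t" "w * (1 - b) = real t * (real t - 1) / 2"
    by (auto simp: w_def b_def field_simps)
  have "w * (K (xag (t + 1)) \<bullet> v - K u \<bullet> yag (t + 1))
      = w * (1 - b) * (K (xag t) \<bullet> v - K u \<bullet> yag t) + w * b * (K (x (t + 1)) \<bullet> v - K u \<bullet> y (t + 1))"
    unfolding recursion(4,5)[OF t] b_def[symmetric] linear_add[OF K_linear] linear_cmul[OF K_linear]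
    by (simp add: algebra_simps)
  then show ?thesis unfolding wb by (simp only: w_def)
qed

lemma gap_Q_step:
  assumes t: "t \<in> {1..N - 1}" and u: "u \<in> X"
  shows "real t * (real t + 1) / 2 * gap_Q G K J (xag (t + 1), yag (t + 1)) (u, v)
    \<le> real t * (real t - 1) / 2 * gap_Q G K J (xag t, yag t) (u, v)
      + real t * (dG (xmd t) \<bullet> (x (t + 1) - u) + (J (y (t + 1)) - J v)
          + (K (x (t + 1)) \<bullet> v - K u \<bullet> y (t + 1)))
      + LG * (nX (x (t + 1) - x t))\<^sup>2"
proof -
  have eq: "gap_Q G K J (p, q) (u, v) = (G p - G u) + (J q - J v) + (K p \<bullet> v - K u \<bullet> q)" for p q
    by (simp add: gap_Q_def)
  show ?thesis
    using G_aggregate_step[OF t u] J_aggregate_step[OF t, of v] K_aggregate_step[OF t, of v u]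
    unfolding eq distrib_left by linarith
qed

lemma prox_steps:
  assumes t: "t \<in> {1..N - 1}" and u: "u \<in> X" and v: "v \<in> Y"
  shows "real t * ((oG t (xmd t) + oKy t (y (t + 1))) \<bullet> (x (t + 1) - u))
      \<le> 2 * hX / \<alpha>X * VX u (x t) - 2 * hX / \<alpha>X * VX u (x (t + 1)) - hX * (nX (x (t + 1) - x t))\<^sup>2"
    and "real t * (- oKx t (xbar t) \<bullet> (y (t + 1) - v) + J (y (t + 1)) - J v)
      \<le> 2 * hY / \<alpha>Y * VY v (y t) - 2 * hY / \<alpha>Y * VY v (y (t + 1)) - hY * (nY (y (t + 1) - y t))\<^sup>2"
proof -
  have t': "t \<in> {1..N}" "real t > 0" using t by auto
  have "convex_on X (\<lambda>_. 0::real)" using sets by (simp add: convex_on_def)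
  from scaled_prox_inequality[OF recursion(3)[OF t] this dX h_pos(1) \<alpha>_pos(1) t'(2) iterates_mem(1)[OF t'(1)] u]
  show "real t * ((oG t (xmd t) + oKy t (y (t + 1))) \<bullet> (x (t + 1) - u))
      \<le> 2 * hX / \<alpha>X * VX u (x t) - 2 * hX / \<alpha>X * VX u (x (t + 1)) - hX * (nX (x (t + 1) - x t))\<^sup>2"
    by simp
qed (rule scaled_prox_inequality[OF recursion(2)[OF t] J(1) dY h_pos(2) \<alpha>_pos(2) _ _ v];
    use t iterates_mem in auto)

text \<open>After the extrapolated point is inserted, the coupling terms of two consecutive iterations cancel
  except for the change of \<open>y\<close>, which is absorbed by squares of steps.\<close>

lemma bilinear_step:
  assumes t: "t \<in> {1..N - 1}"
  shows "real t * (- K (x (t + 1) - u) \<bullet> y (t + 1) + K (xbar t) \<bullet> (y (t + 1) - v)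
      + (K (x (t + 1)) \<bullet> v - K u \<bullet> y (t + 1)))
    \<le> (real t - 1) * (K (x t - x (t - 1)) \<bullet> (y t - v)) - real t * (K (x (t + 1) - x t) \<bullet> (y (t + 1) - v))
      + (real t - 1) * (LK * DY / (2 * DX)) * (nX (x t - x (t - 1)))\<^sup>2
      + (real t - 1) * (LK * DX / (2 * DY)) * (nY (y (t + 1) - y t))\<^sup>2"
proof -
  have t1: "t \<in> {1..N}" "real t - 1 \<ge> 0" using t by auto
  have "real t *\<^sub>R K (xbar t) = (real t - 1) *\<^sub>R K (x t - x (t - 1)) + real t *\<^sub>R K (x t)"
    using arg_cong[OF xbar_eq[OF t1(1)], of K]
    by (simp add: linear_add[OF K_linear] linear_cmul[OF K_linear])
  then have Kxbar: "(real t *\<^sub>R K (xbar t)) \<bullet> (y (t + 1) - v)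
      = ((real t - 1) *\<^sub>R K (x t - x (t - 1)) + real t *\<^sub>R K (x t)) \<bullet> (y (t + 1) - v)"
    by (rule arg_cong)
  have "(real t *\<^sub>R K (xbar t)) \<bullet> (y (t + 1) - v)
      = (real t - 1) * (K (x t - x (t - 1)) \<bullet> (y t - v)) + (real t - 1) * (K (x t - x (t - 1)) \<bullet> (y (t + 1) - y t))
        + real t * (K (x t) \<bullet> (y (t + 1) - v))"
    unfolding Kxbar by (simp add: inner_add_left inner_diff_right algebra_simps)
  moreover have "real t * (- K (x (t + 1) - u) \<bullet> y (t + 1) + K (xbar t) \<bullet> (y (t + 1) - v)
      + (K (x (t + 1)) \<bullet> v - K u \<bullet> y (t + 1)))
    = (real t *\<^sub>R K (xbar t)) \<bullet> (y (t + 1) - v) - real t * (K (x t) \<bullet> (y (t + 1) - v))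
      - real t * (K (x (t + 1) - x t) \<bullet> (y (t + 1) - v))"
    by (simp add: linear_diff[OF K_linear] algebra_simps)
  ultimately show ?thesis
    using coupling_bound[OF t1(2), of "x t - x (t - 1)" "y (t + 1) - y t"] by linarith
qed

text \<open>The new iterate \<open>p'\<close> depends on the error \<open>e\<close>; it is exchanged for the
  old one \<open>p\<close> at the cost of a squared step and a squared error.\<close>

lemma noise_step:
  fixes n :: "'c::euclidean_space \<Rightarrow> real"
  assumes "is_norm n" "a > 0"
  shows "- real t * (e \<bullet> (p' - u))
    \<le> real t * (e \<bullet> (u - p)) + a * (n (p' - p))\<^sup>2 + (real t)\<^sup>2 * (dual_norm n e)\<^sup>2 / (4 * a)"
proof -
  have "(real t *\<^sub>R e) \<bullet> (p - p') \<le> a * (n (p - p'))\<^sup>2 + (dual_norm n (real t *\<^sub>R e))\<^sup>2 / (4 * a)"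
    by (rule young_dual_norm[OF assms])
  then show ?thesis
    by (simp add: is_normD(4)[OF dual_norm_is_norm[OF assms(1)]] is_norm_diff_commute[OF assms(1), of p]
        power_mult_distrib algebra_simps)
qed

text \<open>What the oracle errors add to the potential below in one iteration.\<close>

definition noise :: "'a \<Rightarrow> 'b \<Rightarrow> nat \<Rightarrow> real" where
  "noise u v t = real t * ((eG t + eK t) \<bullet> (u - x t)) + real t * (eY t \<bullet> (v - y t))
    + (real t)\<^sup>2 * (dual_norm nX (eG t + eK t))\<^sup>2 / (4 * aX)
    + (real t)\<^sup>2 * (dual_norm nY (eY t))\<^sup>2 / (4 * aY)"

text \<open>The energy after \<open>t\<close> iterations, at the iterates with index \<open>t + 1\<close>. The
  last two terms are the coupling with the most recent step of \<open>x\<close> and the share of its square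
  that is kept back to dominate this coupling in the next iteration; both vanish for \<open>t =
  0\<close>.\<close>

definition potential :: "'a \<Rightarrow> 'b \<Rightarrow> nat \<Rightarrow> real" where
  "potential u v t = real t * (real t + 1) / 2 * gap_Q G K J (xag (t + 1), yag (t + 1)) (u, v)
    + 2 * hX / \<alpha>X * VX u (x (t + 1)) + 2 * hY / \<alpha>Y * VY v (y (t + 1))
    + real t * (K (x (t + 1) - x t) \<bullet> (y (t + 1) - v))
    + real t * (LK * DY / (2 * DX)) * (nX (x (t + 1) - x t))\<^sup>2"

text \<open>The inequalities for the gap function, the two proximal steps, the coupling and the errors are
  added up. The condition on \<open>hX\<close> and \<open>hY\<close> is that they cover all squared steps that
  occur on the right-hand side.\<close>

lemma potential_step:
  assumes t: "t \<in> {1..N - 1}" and u: "u \<in> X" and v: "v \<in> Y"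
  shows "potential u v t \<le> potential u v (t - 1) + noise u v t"
proof -
  define p where "p = (nX (x (t + 1) - x t))\<^sup>2"
  define q where "q = (nY (y (t + 1) - y t))\<^sup>2"
  have t1: "t \<ge> 1" "t - 1 + 1 = t" "real (t - 1) = real t - 1" "real t \<le> real N - 1" using t by auto
  have "real t * (LK * DY / (2 * DX)) \<le> (real N - 1) * (LK * DY / (2 * DX))"
    by (rule mult_right_mono) (use t1 LK_nonneg D_pos in auto)
  then have "aX + LG + real t * (LK * DY / (2 * DX)) \<le> hX" using aX(2) by linarith
  from mult_right_mono[OF this, of p]
  have px: "aX * p + LG * p + real t * (LK * DY / (2 * DX)) * p \<le> hX * p"
    by (simp only: distrib_right) (simp add: p_def)
  have "(real t - 1) * (LK * DX / (2 * DY)) \<le> (real N - 1) * (LK * DX / (2 * DY))"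
    by (rule mult_right_mono) (use t1 LK_nonneg D_pos in auto)
  then have "aY + (real t - 1) * (LK * DX / (2 * DY)) \<le> hY" using aY(2) by linarith
  from mult_right_mono[OF this, of q]
  have py: "aY * q + (real t - 1) * (LK * DX / (2 * DY)) * q \<le> hY * q"
    by (simp only: distrib_right) (simp add: q_def)
  have adj: "adjoint K (y (t + 1)) \<bullet> (x (t + 1) - u) = K (x (t + 1) - u) \<bullet> y (t + 1)"
    using adjoint_works[OF K_linear, of "x (t + 1) - u" "y (t + 1)"] by (simp add: inner_commute)
  have split: "real t * (dG (xmd t) \<bullet> (x (t + 1) - u) + (J (y (t + 1)) - J v)
          + (K (x (t + 1)) \<bullet> v - K u \<bullet> y (t + 1)))
    = real t * ((oG t (xmd t) + oKy t (y (t + 1))) \<bullet> (x (t + 1) - u))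
      + real t * (- oKx t (xbar t) \<bullet> (y (t + 1) - v) + J (y (t + 1)) - J v)
      + real t * (- K (x (t + 1) - u) \<bullet> y (t + 1) + K (xbar t) \<bullet> (y (t + 1) - v)
      + (K (x (t + 1)) \<bullet> v - K u \<bullet> y (t + 1)))
      + (- real t * ((eG t + eK t) \<bullet> (x (t + 1) - u))) + (- real t * (eY t \<bullet> (y (t + 1) - v)))"
    unfolding eG_def eK_def eY_def inner_add_left inner_diff_left adj
    by (simp add: algebra_simps)
  show ?thesis
    using gap_Q_step[OF t u, of v] split prox_steps[OF t u v]
      bilinear_step[OF t, of u v] px py
      noise_step[OF norms(1) aX(1), of t "eG t + eK t" "x (t + 1)" u "x t"]
      noise_step[OF norms(2) aY(1), of t "eY t" "y (t + 1)" v "y t"]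
    unfolding potential_def noise_def t1 p_def q_def by (simp add: algebra_simps)
qed

lemma potential_bound:
  assumes u: "u \<in> X" and v: "v \<in> Y" and "T \<le> N - 1"
  shows "potential u v T \<le> hX * DX\<^sup>2 + hY * DY\<^sup>2 + (\<Sum>t=1..T. noise u v t)"
  using assms(3)
proof (induction T)
  case 0
  show ?case
    using scaled_V_le(1)[OF _ u, of hX "x 1"] scaled_V_le(2)[OF _ v, of hY "y 1"] h_pos start
    by (simp add: potential_def initial[simplified])
next
  case (Suc T)
  then have "potential u v (Suc T) \<le> potential u v T + noise u v (Suc T)"
    using potential_step[OF _ u v, of "Suc T"] by simp
  with Suc show ?case by simp
qed

text \<open>At the end, the left-over coupling term is dominated by the square kept back in the potential and
  by the Bregman distance of \<open>y N\<close> to \<open>v\<close>.\<close>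

lemma gap_Q_path_bound:
  assumes u: "u \<in> X" and v: "v \<in> Y"
  shows "real N * (real N - 1) / 2 * gap_Q G K J (xag N, yag N) (u, v)
    \<le> hX * DX\<^sup>2 + hY * DY\<^sup>2 + (\<Sum>t=1..N - 1. noise u v t)"
proof -
  define w where "w = K (x N - x (N - 1)) \<bullet> (y N - v)"
  have N': "N - 1 + 1 = N" "real (N - 1) = real N - 1" "real N - 1 \<ge> 0" using N by auto
  have memN: "x N \<in> X" "y N \<in> Y" using iterates_mem[of N] N by auto
  have "(real N - 1) * (K (x N - x (N - 1)) \<bullet> (v - y N))
      \<le> (real N - 1) * (LK * DY / (2 * DX)) * (nX (x N - x (N - 1)))\<^sup>2
        + (real N - 1) * (LK * DX / (2 * DY)) * (nY (v - y N))\<^sup>2"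
    by (rule coupling_bound[OF N'(3)])
  moreover have "(real N - 1) * (LK * DX / (2 * DY)) * (nY (v - y N))\<^sup>2 \<le> hY * (nY (v - y N))\<^sup>2"
    using aY by (intro mult_right_mono) auto
  moreover have "hY * (nY (v - y N))\<^sup>2 \<le> 2 * hY / \<alpha>Y * VY v (y N)"
    using scaled_V_ge(2)[OF _ v memN(2)] h_pos by simp
  moreover have "0 \<le> 2 * hX / \<alpha>X * VX u (x N)"
    using order_trans[OF _ scaled_V_ge(1)[OF _ u memN(1), of hX], of 0] h_pos by simp
  moreover have "(real N - 1) * (K (x N - x (N - 1)) \<bullet> (v - y N)) = - ((real N - 1) * w)"
    by (simp add: w_def inner_diff_right right_diff_distrib)
  ultimately have "(real N - 1) * real N / 2 * gap_Q G K J (xag N, yag N) (u, v) \<le> potential u v (N - 1)"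
    unfolding potential_def N' w_def[symmetric] diff_add_cancel by linarith
  then show ?thesis
    using potential_bound[OF u v, of "N - 1"] by (simp add: mult.commute)
qed

text \<open>The right-hand side no longer refers to the comparison point, so it bounds the supremum.\<close>

lemma gap_path_bound:
  assumes pX: "\<And>t. is_arg_min
      (\<lambda>u. (\<Sum>s\<in>{1..<t}. - (real s *\<^sub>R (eG s + eK s))) \<bullet> u + 2 * aX / \<alpha>X * VX u x1) (\<lambda>u. u \<in> X) (pX t)"
    and pY: "\<And>t. is_arg_min
      (\<lambda>v. (\<Sum>s\<in>{1..<t}. - (real s *\<^sub>R eY s)) \<bullet> v + 2 * aY / \<alpha>Y * VY v y1) (\<lambda>v. v \<in> Y) (pY t)"
  shows "gap X Y G K J (xag N, yag N) \<le> ereal (2 / (real N * (real N - 1)) *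
     (2 * hX * DX\<^sup>2 + 2 * hY * DY\<^sup>2
      + (\<Sum>t=1..N - 1. real t * (eG t \<bullet> (pX t - x t)))
      + (\<Sum>t=1..N - 1. real t * (eK t \<bullet> (pX t - x t)))
      + (\<Sum>t=1..N - 1. real t * (eY t \<bullet> (pY t - y t)))
      + ((\<Sum>t=1..N - 1. (real t)\<^sup>2 * (dual_norm nX (eG t))\<^sup>2)
        + (\<Sum>t=1..N - 1. (real t)\<^sup>2 * (dual_norm nX (eK t))\<^sup>2)) / aX
      + (\<Sum>t=1..N - 1. (real t)\<^sup>2 * (dual_norm nY (eY t))\<^sup>2) / aY))"
  (is "_ \<le> ereal (_ * ?B)")
  unfolding gap_def
proof (rule SUP_least, clarify)
  fix u v assume u: "u \<in> X" and v: "v \<in> Y"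
  define T where "T = N - 1"
  define SG where "SG = (\<Sum>t=1..T. (real t)\<^sup>2 * (dual_norm nX (eG t))\<^sup>2)"
  define SK where "SK = (\<Sum>t=1..T. (real t)\<^sup>2 * (dual_norm nX (eK t))\<^sup>2)"
  define SY where "SY = (\<Sum>t=1..T. (real t)\<^sup>2 * (dual_norm nY (eY t))\<^sup>2)"
  define SX where "SX = (\<Sum>t=1..T. (real t)\<^sup>2 * (dual_norm nX (eG t + eK t))\<^sup>2 / (4 * aX))"
  define MG where "MG = (\<Sum>t=1..T. real t * (eG t \<bullet> (pX t - x t)))"
  define MK where "MK = (\<Sum>t=1..T. real t * (eK t \<bullet> (pX t - x t)))"
  define MY where "MY = (\<Sum>t=1..T. real t * (eY t \<bullet> (pY t - y t)))"
  define B where "B = 2 * hX * DX\<^sup>2 + 2 * hY * DY\<^sup>2 + MG + MK + MY + (SG + SK) / aX + SY / aY"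
  have N0: "real N * (real N - 1) > 0" using N by simp
  have "(\<Sum>t=1..T. noise u v t) = (\<Sum>t=1..T. real t * ((eG t + eK t) \<bullet> (u - x t)))
      + (\<Sum>t=1..T. real t * (eY t \<bullet> (v - y t))) + SX + SY / (4 * aY)"
    by (simp add: noise_def SX_def SY_def sum.distrib sum_divide_distrib)
  also have "(\<Sum>t=1..T. real t * ((eG t + eK t) \<bullet> (u - x t)))
      \<le> aX * DX\<^sup>2 + (\<Sum>t=1..T. real t * ((eG t + eK t) \<bullet> (pX t - x t))) + SX"
    unfolding SX_def
    by (rule leader_regret[OF norms(1) dX \<alpha>_pos(1) aX(1) V_le(1)[OF _ start(1)] start(1) pX u])
  also have "(\<Sum>t=1..T. real t * (eY t \<bullet> (v - y t)))
      \<le> aY * DY\<^sup>2 + MY + (\<Sum>t=1..T. (real t)\<^sup>2 * (dual_norm nY (eY t))\<^sup>2 / (4 * aY))"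
    unfolding MY_def
    by (rule leader_regret[OF norms(2) dY \<alpha>_pos(2) aY(1) V_le(2)[OF _ start(2)] start(2) pY v])
  also have "(\<Sum>t=1..T. (real t)\<^sup>2 * (dual_norm nY (eY t))\<^sup>2 / (4 * aY)) = SY / (4 * aY)"
    by (simp add: SY_def sum_divide_distrib)
  also have "(\<Sum>t=1..T. real t * ((eG t + eK t) \<bullet> (pX t - x t))) = MG + MK"
    by (simp add: MG_def MK_def inner_add_left distrib_left sum.distrib)
  finally have noise: "(\<Sum>t=1..T. noise u v t)
      \<le> aX * DX\<^sup>2 + aY * DY\<^sup>2 + MG + MK + MY + 2 * SX + SY / (2 * aY)"
    by simp
  have "SX \<le> (\<Sum>t=1..T. (real t)\<^sup>2 * (2 * ((dual_norm nX (eG t))\<^sup>2 + (dual_norm nX (eK t))\<^sup>2)) / (4 * aX))"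
    unfolding SX_def using aX
    by (intro sum_mono divide_right_mono mult_left_mono dual_norm_add_power2_le norms) auto
  also have "\<dots> = (SG + SK) / (2 * aX)"
  proof -
    have "(real t)\<^sup>2 * (2 * ((dual_norm nX (eG t))\<^sup>2 + (dual_norm nX (eK t))\<^sup>2)) / (4 * aX)
        = ((real t)\<^sup>2 * (dual_norm nX (eG t))\<^sup>2 + (real t)\<^sup>2 * (dual_norm nX (eK t))\<^sup>2) / (2 * aX)" for t
      using aX by (simp add: field_simps)
    then show ?thesis
      by (simp only: SG_def SK_def sum.distrib[symmetric] sum_divide_distrib)
  qed
  finally have "2 * SX \<le> (SG + SK) / aX" by simp
  moreover have "0 \<le> SY" unfolding SY_def by (intro sum_nonneg) auto
  then have "SY / (2 * aY) \<le> SY / aY" using aY by (simp add: field_simps)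
  moreover have "aX * DX\<^sup>2 \<le> hX * DX\<^sup>2"
    using aX LG_nonneg LK_nonneg D_pos N
    by (intro mult_right_mono order_trans[OF _ aX(2)]) (auto intro!: add_nonneg_nonneg)
  moreover have "aY * DY\<^sup>2 \<le> hY * DY\<^sup>2"
    using aY LK_nonneg D_pos N
    by (intro mult_right_mono order_trans[OF _ aY(2)]) auto
  ultimately have "real N * (real N - 1) / 2 * gap_Q G K J (xag N, yag N) (u, v) \<le> B"
    using gap_Q_path_bound[OF u v] noise unfolding B_def T_def[symmetric] by linarith
  then have "gap_Q G K J (xag N, yag N) (u, v) \<le> 2 / (real N * (real N - 1)) * B"
    using N0 by (simp add: field_simps)
  then show "ereal (gap_Q G K J (xag N, yag N) (u, v)) \<le> ereal (2 / (real N * (real N - 1)) * ?B)"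
    unfolding T_def[symmetric] SG_def[symmetric] SK_def[symmetric] SY_def[symmetric]
      MG_def[symmetric] MK_def[symmetric] MY_def[symmetric] B_def[symmetric] by simp
qed

end

section \<open>Exponential moments\<close>

lemma exp_le_add_exp_power2: "exp x \<le> x + exp (x\<^sup>2)" for x :: real
proof -
  consider "x \<ge> 1" | "0 \<le> x" "x \<le> 1" | "-1 \<le> x" "x \<le> 0" | "x \<le> -1" by linarith
  then show ?thesis
  proof cases
    case 1
    then have "x \<le> x\<^sup>2" by (simp add: power2_eq_square)
    then have "exp x \<le> exp (x\<^sup>2)" by simp
    with 1 show ?thesis by linarith
  next
    case 2
    then show ?thesis using exp_bound[of x] exp_ge_add_one_self[of "x\<^sup>2"] by linarith
  next
    case 3
    define s where "s = - x"
    have s: "0 \<le> s" "s \<le> 1" using 3 by (auto simp: s_def)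
    have "(1 + s) * exp (- s) \<le> 1"
      using exp_ge_add_one_self[of s] by (simp add: exp_minus field_simps)
    moreover have "(1 + s) * (1 - s + s\<^sup>2) \<ge> 1"
      using s by (simp add: power2_eq_square algebra_simps)
    ultimately have "(1 + s) * exp (- s) \<le> (1 + s) * (1 - s + s\<^sup>2)" by linarith
    then have "exp (- s) \<le> 1 - s + s\<^sup>2" using s by simp
    then have "exp x \<le> 1 + x + x\<^sup>2" by (simp add: s_def)
    then show ?thesis using exp_ge_add_one_self[of "x\<^sup>2"] by linarith
  next
    case 4
    then have "0 \<le> x + x\<^sup>2"
      using mult_nonpos_nonpos[of x "x + 1"] by (simp add: power2_eq_square algebra_simps)
    moreover have "exp x \<le> 1" using 4 by simp
    ultimately show ?thesis using exp_ge_add_one_self[of "x\<^sup>2"] by linarith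
  qed
qed

text \<open>Convexity of the exponential between \<open>0\<close> and \<open>z - 1\<close>; because of the
  shift by one, the right-hand side has expectation \<open>exp p\<close> if \<open>exp z\<close> has
  expectation \<open>exp 1\<close>.\<close>

lemma exp_scale_le_tangent:
  fixes p z :: real
  assumes "0 \<le> p" "p \<le> 1"
  shows "exp (p * z) \<le> exp p * (1 - p + p * exp (z - 1))"
proof -
  have "exp ((1 - p) *\<^sub>R 0 + p *\<^sub>R (z - 1)) \<le> (1 - p) * exp 0 + p * exp (z - 1)"
    using assms by (intro convex_onD[OF exp_convex]) auto
  then have "exp p * exp (p * (z - 1)) \<le> exp p * (1 - p + p * exp (z - 1))"
    by (intro mult_left_mono) auto
  then show ?thesis by (simp add: exp_add[symmetric] algebra_simps)
qed

lemma (in prob_space) exp_scale_expectation_le: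
  assumes [measurable]: "Z \<in> borel_measurable M"
    and light: "(\<integral>\<^sup>+\<omega>. ennreal (exp (Z \<omega>)) \<partial>M) \<le> ennreal (exp 1)" and p: "0 \<le> p" "p \<le> 1"
  shows "(\<integral>\<^sup>+\<omega>. ennreal (exp (p * Z \<omega>)) \<partial>M) \<le> ennreal (exp p)"
proof -
  have "(\<integral>\<^sup>+\<omega>. ennreal (exp (p * Z \<omega>)) \<partial>M)
      \<le> (\<integral>\<^sup>+\<omega>. ennreal (exp p * (1 - p)) + ennreal (exp p * p * exp (-1)) * ennreal (exp (Z \<omega>)) \<partial>M)"
  proof (intro nn_integral_mono)
    fix \<omega>
    have "exp (p * Z \<omega>) \<le> exp p * (1 - p) + exp p * p * exp (-1) * exp (Z \<omega>)"
      using exp_scale_le_tangent[OF p, of "Z \<omega>"] by (simp add: exp_diff exp_minus field_simps)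
    then have "ennreal (exp (p * Z \<omega>)) \<le> ennreal (exp p * (1 - p) + exp p * p * exp (-1) * exp (Z \<omega>))"
      by (rule ennreal_leI)
    then show "ennreal (exp (p * Z \<omega>))
        \<le> ennreal (exp p * (1 - p)) + ennreal (exp p * p * exp (-1)) * ennreal (exp (Z \<omega>))"
      using p by (simp add: ennreal_plus ennreal_mult)
  qed
  also have "\<dots> = ennreal (exp p * (1 - p))
      + ennreal (exp p * p * exp (-1)) * (\<integral>\<^sup>+\<omega>. ennreal (exp (Z \<omega>)) \<partial>M)"
    by (simp add: nn_integral_add nn_integral_cmult emeasure_space_1)
  also have "\<dots> \<le> ennreal (exp p * (1 - p)) + ennreal (exp p * p * exp (-1)) * ennreal (exp 1)"
    by (intro add_left_mono mult_left_mono light) auto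
  also have "\<dots> = ennreal (exp p * (1 - p) + exp p * p * exp (-1) * exp 1)"
    using p by (simp add: ennreal_plus ennreal_mult)
  also have "exp p * (1 - p) + exp p * p * exp (-1) * exp 1 = exp p"
    by (simp add: exp_minus algebra_simps)
  finally show ?thesis .
qed

text \<open>For \<open>\<bar>\<mu>\<bar> \<le> 1\<close> the inequality \<open>exp x \<le> x + exp
  (x\<^sup>2)\<close> removes the linear term, which has mean zero; for larger \<open>\<mu>\<close>, Young's
  inequality separates \<open>\<mu>\<close> from \<open>Z\<close>, and \<open>\<mu>\<^sup>2 / 2 + 1 / 2 \<le>
  \<mu>\<^sup>2\<close>.\<close>

lemma (in prob_space) subgaussian_exp_moment:
  assumes int: "integrable M Z" and mean: "expectation Z = 0"
    and light: "(\<integral>\<^sup>+\<omega>. ennreal (exp ((Z \<omega>)\<^sup>2)) \<partial>M) \<le> ennreal (exp 1)"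
  shows "(\<integral>\<^sup>+\<omega>. ennreal (exp (\<mu> * Z \<omega>)) \<partial>M) \<le> ennreal (exp (\<mu>\<^sup>2))"
proof -
  have [measurable]: "Z \<in> borel_measurable M" using int by simp
  have scale: "(\<integral>\<^sup>+\<omega>. ennreal (exp (p * (Z \<omega>)\<^sup>2)) \<partial>M) \<le> ennreal (exp p)"
    if "0 \<le> p" "p \<le> 1" for p
    using exp_scale_expectation_le[OF _ light that] by simp
  show ?thesis
  proof (cases "\<mu>\<^sup>2 \<le> 1")
    case True
    have le: "(\<integral>\<^sup>+\<omega>. ennreal (exp (\<mu>\<^sup>2 * (Z \<omega>)\<^sup>2)) \<partial>M) \<le> ennreal (exp (\<mu>\<^sup>2))"
      using True by (intro scale) auto
    then have int': "integrable M (\<lambda>\<omega>. exp (\<mu>\<^sup>2 * (Z \<omega>)\<^sup>2))"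
      by (intro integrableI_nonneg) (auto intro: le_less_trans)
    have "expectation (\<lambda>\<omega>. exp (\<mu>\<^sup>2 * (Z \<omega>)\<^sup>2)) \<le> exp (\<mu>\<^sup>2)"
      using le by (simp add: nn_integral_eq_integral[OF int'])
    moreover have "expectation (\<lambda>\<omega>. \<mu> * Z \<omega> + exp (\<mu>\<^sup>2 * (Z \<omega>)\<^sup>2))
        = expectation (\<lambda>\<omega>. exp (\<mu>\<^sup>2 * (Z \<omega>)\<^sup>2))"
      using int int' mean by simp
    moreover have "exp (\<mu> * Z \<omega>) \<le> \<mu> * Z \<omega> + exp (\<mu>\<^sup>2 * (Z \<omega>)\<^sup>2)" for \<omega>
      using exp_le_add_exp_power2[of "\<mu> * Z \<omega>"] by (simp add: power_mult_distrib)
    then have "(\<integral>\<^sup>+\<omega>. ennreal (exp (\<mu> * Z \<omega>)) \<partial>M)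
        \<le> (\<integral>\<^sup>+\<omega>. ennreal (\<mu> * Z \<omega> + exp (\<mu>\<^sup>2 * (Z \<omega>)\<^sup>2)) \<partial>M)"
      by (intro nn_integral_mono ennreal_leI)
    moreover have "(\<integral>\<^sup>+\<omega>. ennreal (\<mu> * Z \<omega> + exp (\<mu>\<^sup>2 * (Z \<omega>)\<^sup>2)) \<partial>M)
        = ennreal (expectation (\<lambda>\<omega>. \<mu> * Z \<omega> + exp (\<mu>\<^sup>2 * (Z \<omega>)\<^sup>2)))"
      using int int' exp_le_add_exp_power2[of "\<mu> * Z _"]
      by (intro nn_integral_eq_integral) (auto intro!: AE_I2 order_trans[OF less_imp_le[OF exp_gt_zero]] simp: power_mult_distrib)
    ultimately show ?thesis by (simp add: ennreal_leI order_trans)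
  next
    case False
    have "(\<integral>\<^sup>+\<omega>. ennreal (exp (\<mu> * Z \<omega>)) \<partial>M)
        \<le> (\<integral>\<^sup>+\<omega>. ennreal (exp (\<mu>\<^sup>2 / 2)) * ennreal (exp (1 / 2 * (Z \<omega>)\<^sup>2)) \<partial>M)"
    proof (intro nn_integral_mono)
      fix \<omega>
      have "\<mu> * Z \<omega> \<le> \<mu>\<^sup>2 / 2 + 1 / 2 * (Z \<omega>)\<^sup>2"
        using sum_squares_bound[of \<mu> "Z \<omega>"] by simp
      then have "exp (\<mu> * Z \<omega>) \<le> exp (\<mu>\<^sup>2 / 2) * exp (1 / 2 * (Z \<omega>)\<^sup>2)"
        by (simp add: exp_add[symmetric])
      then show "ennreal (exp (\<mu> * Z \<omega>)) \<le> ennreal (exp (\<mu>\<^sup>2 / 2)) * ennreal (exp (1 / 2 * (Z \<omega>)\<^sup>2))"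
        by (simp add: ennreal_mult[symmetric] ennreal_leI del: ennreal_le_iff)
    qed
    also have "\<dots> = ennreal (exp (\<mu>\<^sup>2 / 2)) * (\<integral>\<^sup>+\<omega>. ennreal (exp (1 / 2 * (Z \<omega>)\<^sup>2)) \<partial>M)"
      by (simp add: nn_integral_cmult)
    also have "\<dots> \<le> ennreal (exp (\<mu>\<^sup>2 / 2)) * ennreal (exp (1 / 2))"
      by (intro mult_left_mono scale) auto
    also have "\<dots> = ennreal (exp (\<mu>\<^sup>2 / 2 + 1 / 2))" by (simp add: ennreal_mult[symmetric] exp_add)
    also have "\<dots> \<le> ennreal (exp (\<mu>\<^sup>2))" using False by (intro ennreal_leI) simp
    finally show ?thesis .
  qed
qed

lemma (in prob_space) exp_moment_tail:
  assumes Z: "Z \<in> borel_measurable M" and \<mu>: "\<mu> > 0"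
    and moment: "(\<integral>\<^sup>+\<omega>. ennreal (exp (\<mu> * Z \<omega>)) \<partial>M) \<le> ennreal (exp k)"
  shows "prob {\<omega> \<in> space M. Z \<omega> > r} \<le> exp (k - \<mu> * r)"
proof -
  have "emeasure M {\<omega> \<in> space M. Z \<omega> > r} \<le> emeasure M {\<omega> \<in> space M. Z \<omega> \<ge> r}"
    using Z by (intro emeasure_mono) auto
  also have "\<dots> \<le> ennreal (exp (- \<mu> * r)) * (\<integral>\<^sup>+\<omega>. ennreal (exp (\<mu> * Z \<omega>)) * indicator (space M) \<omega> \<partial>M)"
    using Z \<mu> by (intro Chernoff_ineq_nn_integral_ge) auto
  also have "(\<integral>\<^sup>+\<omega>. ennreal (exp (\<mu> * Z \<omega>)) * indicator (space M) \<omega> \<partial>M) = (\<integral>\<^sup>+\<omega>. ennreal (exp (\<mu> * Z \<omega>)) \<partial>M)"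
    by (intro nn_integral_cong) auto
  also have "ennreal (exp (- \<mu> * r)) * \<dots> \<le> ennreal (exp (- \<mu> * r)) * ennreal (exp k)"
    by (intro mult_left_mono moment) auto
  also have "\<dots> = ennreal (exp (k - \<mu> * r))"
    by (simp add: ennreal_mult[symmetric] exp_add[symmetric])
  finally show ?thesis by (simp add: emeasure_eq_measure)
qed

lemma (in prob_space) AE_zero_tail:
  assumes "Z \<in> borel_measurable M" "AE \<omega> in M. Z \<omega> = 0" "r \<ge> (0::real)"
  shows "prob {\<omega> \<in> space M. Z \<omega> > r} = 0"
  using assms by (subst prob_eq_0) (auto simp: not_less elim: eventually_mono)

section \<open>Sampled oracles conditioned on the past\<close>

locale iid_samples = prob_space M + P: prob_space P
  for M :: "'w measure" and P :: "'s measure" +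
  fixes \<xi> :: "'i \<Rightarrow> 'w \<Rightarrow> 's" and I :: "'i set"
  assumes indep: "indep_vars (\<lambda>_. P) \<xi> I"
    and distr_sample: "\<And>i. i \<in> I \<Longrightarrow> distr M P (\<xi> i) = P"
begin

definition sample_tuple :: "'i set \<Rightarrow> 'w \<Rightarrow> 'i \<Rightarrow> 's" where
  "sample_tuple A \<omega> = restrict (\<lambda>i. \<xi> i \<omega>) A"

text \<open>The \<open>\<sigma>\<close>-algebra generated by the samples with index in \<open>A\<close>,
  packaged as a measure space with the null measure.\<close>

definition past :: "'i set \<Rightarrow> 'w measure" where
  "past A = vimage_algebra (space M) (sample_tuple A) (PiM A (\<lambda>_. P))"

lemma sample_measurable: "i \<in> I \<Longrightarrow> \<xi> i \<in> measurable M P"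
  using indep by (auto simp: indep_vars_def)

lemma sample_tuple_measurable: "A \<subseteq> I \<Longrightarrow> sample_tuple A \<in> measurable M (PiM A (\<lambda>_. P))"
  unfolding sample_tuple_def using sample_measurable by (intro measurable_restrict) auto

lemma space_past [simp]: "space (past A) = space M"
  by (simp add: past_def)

lemma sample_tuple_measurable_past:
  "A \<subseteq> I \<Longrightarrow> sample_tuple A \<in> measurable (past A) (PiM A (\<lambda>_. P))"
  unfolding past_def using measurable_space[OF sample_tuple_measurable]
  by (intro measurable_vimage_algebra1) auto

lemma sample_measurable_past:
  assumes "A \<subseteq> I" "i \<in> A"
  shows "\<xi> i \<in> measurable (past A) P"
proof -
  have "(\<lambda>\<omega>. sample_tuple A \<omega> i) \<in> measurable (past A) P"
    by (rule measurable_compose[OF sample_tuple_measurable_past[OF assms(1)]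
          measurable_component_singleton[OF assms(2)]])
  then show ?thesis using assms(2) by (simp add: sample_tuple_def cong: measurable_cong)
qed

lemma measurable_from_past:
  assumes "A \<subseteq> I" "f \<in> measurable (past A) L"
  shows "f \<in> measurable M L"
proof -
  have "(\<lambda>\<omega>. \<omega>) \<in> measurable M (past A)"
    unfolding past_def using sample_tuple_measurable[OF assms(1)]
    by (intro measurable_vimage_algebra2) auto
  from measurable_compose[OF this assms(2)] show ?thesis .
qed

lemma measurable_past_mono:
  assumes "A \<subseteq> B" "B \<subseteq> I" "f \<in> measurable (past A) L"
  shows "f \<in> measurable (past B) L"
proof -
  have "(\<lambda>\<omega>. restrict (sample_tuple B \<omega>) A) \<in> measurable (past B) (PiM A (\<lambda>_. P))"
    by (rule measurable_compose[OF sample_tuple_measurable_past[OF assms(2)]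
          measurable_restrict_subset[OF assms(1)]])
  moreover have "restrict (sample_tuple B \<omega>) A = sample_tuple A \<omega>" for \<omega>
    using assms(1) by (auto simp: sample_tuple_def restrict_def fun_eq_iff)
  ultimately have "(\<lambda>\<omega>. \<omega>) \<in> measurable (past B) (past A)"
    by (subst (2) past_def, intro measurable_vimage_algebra2) auto
  from measurable_compose[OF this assms(3)] show ?thesis .
qed

text \<open>The independence of a sample from the past, as a statement on the joint distribution: it is a
  product measure, which makes Fubini's theorem available. The two factors have different types, so this is
  verified on rectangles.\<close>

lemma distr_past_sample:
  assumes A: "A \<subseteq> I" and i: "i \<in> I" "i \<notin> A"
  shows "distr M (past A \<Otimes>\<^sub>M P) (\<lambda>\<omega>. (\<omega>, \<xi> i \<omega>)) = distr M (past A) (\<lambda>\<omega>. \<omega>) \<Otimes>\<^sub>M P"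
proof -
  let ?Z = "sample_tuple A" and ?T = "\<lambda>A. PiM A (\<lambda>_. P)"
  have id: "(\<lambda>\<omega>. \<omega>) \<in> measurable M (past A)"
    by (rule measurable_from_past[OF A measurable_ident_sets[OF refl]])
  have pair: "(\<lambda>\<omega>. (\<omega>, \<xi> i \<omega>)) \<in> measurable M (past A \<Otimes>\<^sub>M P)"
    using id sample_measurable[OF i(1)] by (intro measurable_Pair) auto
  interpret R: prob_space "distr M (past A) (\<lambda>\<omega>. \<omega>)" by (rule prob_space_distr[OF id])
  have "indep_var (?T A) ?Z (?T {i}) (sample_tuple {i})"
    unfolding sample_tuple_def[abs_def] by (rule indep_var_restrict[OF indep]) (use A i in auto)
  then have ind: "indep_set (sigma_sets (space M) {?Z -` S \<inter> space M | S. S \<in> sets (?T A)})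
      (sigma_sets (space M) {sample_tuple {i} -` S \<inter> space M | S. S \<in> sets (?T {i})})"
    unfolding indep_var_eq by blast
  have Z: "?Z \<in> space M \<rightarrow> space (?T A)"
    using measurable_space[OF sample_tuple_measurable[OF A]] by auto
  have "distr M (past A) (\<lambda>\<omega>. \<omega>) \<Otimes>\<^sub>M P = distr M (past A \<Otimes>\<^sub>M P) (\<lambda>\<omega>. (\<omega>, \<xi> i \<omega>))"
  proof (rule pair_measure_eqI)
    show "sigma_finite_measure (distr M (past A) (\<lambda>\<omega>. \<omega>))" "sigma_finite_measure P"
      by (rule R.sigma_finite_measure_axioms P.sigma_finite_measure_axioms)+
    show "sets (distr M (past A) (\<lambda>\<omega>. \<omega>) \<Otimes>\<^sub>M P) = sets (distr M (past A \<Otimes>\<^sub>M P) (\<lambda>\<omega>. (\<omega>, \<xi> i \<omega>)))"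
      by (simp cong: sets_pair_measure_cong)
    fix S B assume "S \<in> sets (distr M (past A) (\<lambda>\<omega>. \<omega>))" and B: "B \<in> sets P"
    then have S: "S \<in> sets (past A)" by simp
    have SM: "S \<subseteq> space M" using sets.sets_into_space[OF S] by simp
    have SB: "S \<times> B \<in> sets (past A \<Otimes>\<^sub>M P)" using S B by auto
    have "S \<in> sigma_sets (space M) {?Z -` S \<inter> space M | S. S \<in> sets (?T A)}"
      using S unfolding past_def sets_vimage_algebra .
    moreover have "(\<lambda>f. f i) \<in> measurable (?T {i}) P"
      by (rule measurable_component_singleton) simp
    from measurable_sets[OF this B]
    have "(\<lambda>f. f i) -` B \<inter> space (?T {i}) \<in> sets (?T {i})" .
    then have "sample_tuple {i} -` ((\<lambda>f. f i) -` B \<inter> space (?T {i})) \<inter> space M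
        \<in> sigma_sets (space M) {sample_tuple {i} -` S \<inter> space M | S. S \<in> sets (?T {i})}"
      by (intro sigma_sets.Basic) blast
    moreover have "sample_tuple {i} -` ((\<lambda>f. f i) -` B \<inter> space (?T {i})) \<inter> space M = \<xi> i -` B \<inter> space M"
      using measurable_space[OF sample_tuple_measurable[of "{i}"]] i by (auto simp: sample_tuple_def)
    ultimately have "prob (S \<inter> (\<xi> i -` B \<inter> space M)) = prob S * prob (\<xi> i -` B \<inter> space M)"
      using indep_setD[OF ind] by simp
    then have "emeasure M (S \<inter> (\<xi> i -` B \<inter> space M)) = emeasure M S * emeasure M (\<xi> i -` B \<inter> space M)"
      by (simp add: emeasure_eq_measure ennreal_mult)
    also have "emeasure M (\<xi> i -` B \<inter> space M) = emeasure P B"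
      using emeasure_distr[OF sample_measurable[OF i(1)] B] distr_sample[OF i(1)] by simp
    also have "emeasure M S = emeasure (distr M (past A) (\<lambda>\<omega>. \<omega>)) S"
      using emeasure_distr[OF id S] SM by (simp add: Int_absorb2)
    also have "S \<inter> (\<xi> i -` B \<inter> space M) = (\<lambda>\<omega>. (\<omega>, \<xi> i \<omega>)) -` (S \<times> B) \<inter> space M"
      using SM by auto
    also have "emeasure M ((\<lambda>\<omega>. (\<omega>, \<xi> i \<omega>)) -` (S \<times> B) \<inter> space M)
        = emeasure (distr M (past A \<Otimes>\<^sub>M P) (\<lambda>\<omega>. (\<omega>, \<xi> i \<omega>))) (S \<times> B)"
      by (rule emeasure_distr[OF pair SB, symmetric])
    finally show "emeasure (distr M (past A) (\<lambda>\<omega>. \<omega>)) S * emeasure P B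
        = emeasure (distr M (past A \<Otimes>\<^sub>M P) (\<lambda>\<omega>. (\<omega>, \<xi> i \<omega>))) (S \<times> B)" by simp
  qed
  then show ?thesis by simp
qed

lemma sample_pair_measurable:
  assumes A: "A \<subseteq> I" and i: "i \<in> I"
  shows "(\<lambda>\<omega>. (\<omega>, \<xi> i \<omega>)) \<in> measurable M (past A \<Otimes>\<^sub>M P)"
  using measurable_from_past[OF A measurable_ident_sets[OF refl]] sample_measurable[OF i]
  by (intro measurable_Pair) auto

text \<open>Conditionally on the past a new sample still has distribution \<open>P\<close>: it can be
  integrated out with everything else kept fixed.\<close>

lemma nn_integral_past_sample:
  assumes A: "A \<subseteq> I" and i: "i \<in> I" "i \<notin> A"
    and f: "f \<in> borel_measurable (past A \<Otimes>\<^sub>M P)"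
  shows "(\<integral>\<^sup>+\<omega>. f (\<omega>, \<xi> i \<omega>) \<partial>M) = (\<integral>\<^sup>+\<omega>. \<integral>\<^sup>+s. f (\<omega>, s) \<partial>P \<partial>M)"
proof -
  have id: "(\<lambda>\<omega>. \<omega>) \<in> measurable M (past A)"
    by (rule measurable_from_past[OF A measurable_ident_sets[OF refl]])
  have "(\<integral>\<^sup>+\<omega>. f (\<omega>, \<xi> i \<omega>) \<partial>M) = (\<integral>\<^sup>+z. f z \<partial>distr M (past A \<Otimes>\<^sub>M P) (\<lambda>\<omega>. (\<omega>, \<xi> i \<omega>)))"
    by (rule nn_integral_distr[symmetric]) (use f sample_pair_measurable[OF A i(1)] in simp_all)
  also have "\<dots> = (\<integral>\<^sup>+\<omega>. \<integral>\<^sup>+s. f (\<omega>, s) \<partial>P \<partial>distr M (past A) (\<lambda>\<omega>. \<omega>))"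
    unfolding distr_past_sample[OF A i] using f
    by (intro P.nn_integral_fst[symmetric]) (simp cong: measurable_cong_sets)
  also have "\<dots> = (\<integral>\<^sup>+\<omega>. \<integral>\<^sup>+s. f (\<omega>, s) \<partial>P \<partial>M)"
    using P.borel_measurable_nn_integral_fst[OF f] id by (intro nn_integral_distr) simp_all
  finally show ?thesis .
qed

lemma integral_past_sample:
  fixes f :: "'w \<times> 's \<Rightarrow> real"
  assumes A: "A \<subseteq> I" and i: "i \<in> I" "i \<notin> A"
    and f: "f \<in> borel_measurable (past A \<Otimes>\<^sub>M P)"
    and int: "integrable M (\<lambda>\<omega>. f (\<omega>, \<xi> i \<omega>))"
  shows "(\<integral>\<omega>. f (\<omega>, \<xi> i \<omega>) \<partial>M) = (\<integral>\<omega>. \<integral>s. f (\<omega>, s) \<partial>P \<partial>M)"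
proof -
  let ?R = "distr M (past A) (\<lambda>\<omega>. \<omega>)"
  have id: "(\<lambda>\<omega>. \<omega>) \<in> measurable M (past A)"
    by (rule measurable_from_past[OF A measurable_ident_sets[OF refl]])
  interpret R: prob_space ?R by (rule prob_space_distr[OF id])
  interpret RP: pair_prob_space ?R P ..
  have "integrable (?R \<Otimes>\<^sub>M P) f"
    unfolding distr_past_sample[OF A i, symmetric]
    using int by (subst integrable_distr_eq) (use f sample_pair_measurable[OF A i(1)] in simp_all)
  from RP.integral_fst'[OF this]
  have "(\<integral>\<omega>. \<integral>s. f (\<omega>, s) \<partial>P \<partial>?R) = (\<integral>z. f z \<partial>distr M (past A \<Otimes>\<^sub>M P) (\<lambda>\<omega>. (\<omega>, \<xi> i \<omega>)))"
    unfolding distr_past_sample[OF A i] .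
  also have "\<dots> = (\<integral>\<omega>. f (\<omega>, \<xi> i \<omega>) \<partial>M)"
    by (rule integral_distr) (use f sample_pair_measurable[OF A i(1)] in simp_all)
  also have "(\<integral>\<omega>. \<integral>s. f (\<omega>, s) \<partial>P \<partial>?R) = (\<integral>\<omega>. \<integral>s. f (\<omega>, s) \<partial>P \<partial>M)"
    using f id by (intro integral_distr P.borel_measurable_lebesgue_integral) simp_all
  finally show ?thesis by simp
qed

end

text \<open>The mean \<open>m\<close> is measurable on \<open>S\<close> because it is the parameter integral
  of the jointly measurable \<open>F\<close>.\<close>

lemma (in prob_space) unbiased_oracle_error_measurable:
  assumes "unbiased_oracle M S F m"
  shows "(\<lambda>(q, s). F q s - m q) \<in> borel_measurable (restrict_space borel S \<Otimes>\<^sub>M M)"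
proof -
  let ?R = "restrict_space borel S"
  have F: "(\<lambda>(q, s). F q s) \<in> borel_measurable (?R \<Otimes>\<^sub>M M)"
    using assms by (simp add: unbiased_oracle_def)
  have "(\<lambda>q. \<integral>s. F q s \<partial>M) \<in> borel_measurable ?R"
    by (rule borel_measurable_lebesgue_integral[OF F])
  moreover have "(\<integral>s. F q s \<partial>M) = m q" if "q \<in> space ?R" for q
    using that assms by (auto simp: unbiased_oracle_def space_restrict_space
        intro: has_bochner_integral_integral_eq)
  ultimately have "m \<in> borel_measurable ?R" by (simp cong: measurable_cong)
  from measurable_compose[OF measurable_fst this, of M] F
  show ?thesis by (simp add: split_beta')
qed

text \<open>Call \<open>t\<close> uses the sample \<open>i t\<close> at the query \<open>q t\<close>, which is
  determined by the samples in \<open>A t\<close>. Everything known at call \<open>s\<close>, together with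
  its own sample, is known at later calls.\<close>

locale sampled_oracle = iid_samples M P \<xi> I
  for M :: "'w measure" and P :: "'s measure" and \<xi> :: "'i \<Rightarrow> 'w \<Rightarrow> 's" and I +
  fixes n :: "'v::euclidean_space \<Rightarrow> real" and S :: "'q::euclidean_space set"
    and F :: "'q \<Rightarrow> 's \<Rightarrow> 'v" and m :: "'q \<Rightarrow> 'v" and \<sigma> :: real
    and T :: nat and i :: "nat \<Rightarrow> 'i" and A :: "nat \<Rightarrow> 'i set"
    and q :: "nat \<Rightarrow> 'w \<Rightarrow> 'q"
  assumes n: "is_norm n"
    and unbiased: "unbiased_oracle P S F m"
    and variance: "bounded_variance n P S F m \<sigma>" and \<sigma>: "\<sigma> \<ge> 0"
    and sample: "\<And>t. t \<in> {1..T} \<Longrightarrow> i t \<in> I" "\<And>t. t \<in> {1..T} \<Longrightarrow> i t \<notin> A t"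
    and past_subset: "\<And>t. t \<in> {1..T} \<Longrightarrow> A t \<subseteq> I"
    and past_increasing: "\<And>s t. 1 \<le> s \<Longrightarrow> s < t \<Longrightarrow> t \<le> T \<Longrightarrow> insert (i s) (A s) \<subseteq> A t"
    and query: "\<And>t. t \<in> {1..T} \<Longrightarrow> q t \<in> measurable (past (A t)) (restrict_space borel S)"
begin

definition err :: "nat \<Rightarrow> 'w \<Rightarrow> 'v" where
  "err t \<omega> = F (q t \<omega>) (\<xi> (i t) \<omega>) - m (q t \<omega>)"

lemma query_mem: "t \<in> {1..T} \<Longrightarrow> \<omega> \<in> space M \<Longrightarrow> q t \<omega> \<in> S"
  using measurable_space[OF query, of t \<omega>] by (simp add: space_restrict_space)

lemma fibre_error_measurable:
  assumes t: "t \<in> {1..T}"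
  shows "(\<lambda>(\<omega>, s). F (q t \<omega>) s - m (q t \<omega>)) \<in> borel_measurable (past (A t) \<Otimes>\<^sub>M P)"
proof -
  have "(\<lambda>z. (q t (fst z), snd z)) \<in> measurable (past (A t) \<Otimes>\<^sub>M P) (restrict_space borel S \<Otimes>\<^sub>M P)"
    using measurable_compose[OF measurable_fst query[OF t]]
    by (intro measurable_Pair) auto
  from measurable_compose[OF this P.unbiased_oracle_error_measurable[OF unbiased]]
  show ?thesis by (simp add: split_beta')
qed

lemma err_measurable_past:
  assumes t: "t \<in> {1..T}" and B: "insert (i t) (A t) \<subseteq> B" "B \<subseteq> I"
  shows "err t \<in> borel_measurable (past B)"
proof -
  have "(\<lambda>\<omega>. \<omega>) \<in> measurable (past B) (past (A t))"
    using B by (intro measurable_past_mono[OF _ B(2) measurable_ident_sets[OF refl]]) auto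
  moreover have "\<xi> (i t) \<in> measurable (past B) P"
    using B by (intro sample_measurable_past) auto
  ultimately have "(\<lambda>\<omega>. (\<omega>, \<xi> (i t) \<omega>)) \<in> measurable (past B) (past (A t) \<Otimes>\<^sub>M P)"
    by (rule measurable_Pair)
  from measurable_compose[OF this fibre_error_measurable[OF t]]
  show ?thesis by (simp add: err_def[abs_def])
qed

lemma err_measurable: "t \<in> {1..T} \<Longrightarrow> err t \<in> borel_measurable M"
  by (rule measurable_from_past[OF _ err_measurable_past[OF _ subset_refl]])
    (use sample past_subset in auto)

text \<open>The function \<open>f\<close> of the error may itself depend on the past, and so does the weight
  \<open>Z\<close>; a bound that is uniform over the past can be taken out.\<close>

lemma nn_integral_err:
  assumes t: "t \<in> {1..T}" and Z: "Z \<in> borel_measurable (past (A t))"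
    and f: "(\<lambda>(\<omega>, s). f \<omega> (F (q t \<omega>) s - m (q t \<omega>))) \<in> borel_measurable (past (A t) \<Otimes>\<^sub>M P)"
    and le: "\<And>\<omega>. \<omega> \<in> space M \<Longrightarrow> (\<integral>\<^sup>+s. f \<omega> (F (q t \<omega>) s - m (q t \<omega>)) \<partial>P) \<le> c"
  shows "(\<integral>\<^sup>+\<omega>. Z \<omega> * f \<omega> (err t \<omega>) \<partial>M) \<le> c * (\<integral>\<^sup>+\<omega>. Z \<omega> \<partial>M)"
proof -
  let ?f = "\<lambda>(\<omega>, s). Z \<omega> * f \<omega> (F (q t \<omega>) s - m (q t \<omega>))"
  have "?f \<in> borel_measurable (past (A t) \<Otimes>\<^sub>M P)"
    using f measurable_compose[OF measurable_fst Z, of P] by (simp add: split_beta')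
  from nn_integral_past_sample[OF past_subset[OF t] sample(1)[OF t] sample(2)[OF t] this]
  have "(\<integral>\<^sup>+\<omega>. Z \<omega> * f \<omega> (err t \<omega>) \<partial>M)
      = (\<integral>\<^sup>+\<omega>. \<integral>\<^sup>+s. Z \<omega> * f \<omega> (F (q t \<omega>) s - m (q t \<omega>)) \<partial>P \<partial>M)"
    by (simp add: err_def)
  also have "\<dots> \<le> (\<integral>\<^sup>+\<omega>. c * Z \<omega> \<partial>M)"
  proof (intro nn_integral_mono)
    fix \<omega> assume \<omega>: "\<omega> \<in> space M"
    have "(\<lambda>s. f \<omega> (F (q t \<omega>) s - m (q t \<omega>))) \<in> borel_measurable P"
      using measurable_Pair2[OF f, of \<omega>] \<omega> by simp
    then have "(\<integral>\<^sup>+s. Z \<omega> * f \<omega> (F (q t \<omega>) s - m (q t \<omega>)) \<partial>P)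
        = Z \<omega> * (\<integral>\<^sup>+s. f \<omega> (F (q t \<omega>) s - m (q t \<omega>)) \<partial>P)"
      by (rule nn_integral_cmult)
    also have "\<dots> \<le> Z \<omega> * c" by (intro mult_left_mono le \<omega>) auto
    finally show "(\<integral>\<^sup>+s. Z \<omega> * f \<omega> (F (q t \<omega>) s - m (q t \<omega>)) \<partial>P) \<le> c * Z \<omega>"
      by (simp add: mult.commute)
  qed
  also have "\<dots> = c * (\<integral>\<^sup>+\<omega>. Z \<omega> \<partial>M)"
    using measurable_from_past[OF past_subset[OF t] Z] by (rule nn_integral_cmult)
  finally show ?thesis .
qed

lemma nn_integral_err_le:
  assumes t: "t \<in> {1..T}" and f: "f \<in> borel_measurable borel"
    and le: "\<And>x. x \<in> S \<Longrightarrow> (\<integral>\<^sup>+s. f (F x s - m x) \<partial>P) \<le> c"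
  shows "(\<integral>\<^sup>+\<omega>. f (err t \<omega>) \<partial>M) \<le> c"
proof -
  have "(\<lambda>(\<omega>, s). f (F (q t \<omega>) s - m (q t \<omega>))) \<in> borel_measurable (past (A t) \<Otimes>\<^sub>M P)"
    using measurable_compose[OF fibre_error_measurable[OF t] f] by (simp add: split_beta')
  from nn_integral_err[OF t _ this, of "\<lambda>_. 1" c] le query_mem[OF t]
  show ?thesis by (simp add: emeasure_space_1)
qed

lemma dual_err_measurable: "t \<in> {1..T} \<Longrightarrow> (\<lambda>\<omega>. dual_norm n (err t \<omega>)) \<in> borel_measurable M"
  by (rule measurable_compose[OF err_measurable dual_norm_borel_measurable[OF n]])

lemma second_moment:
  assumes t: "t \<in> {1..T}"
  shows "(\<integral>\<^sup>+\<omega>. ennreal ((dual_norm n (err t \<omega>))\<^sup>2) \<partial>M) \<le> ennreal (\<sigma>\<^sup>2)"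
    and "integrable M (\<lambda>\<omega>. (dual_norm n (err t \<omega>))\<^sup>2)"
    and "expectation (\<lambda>\<omega>. (dual_norm n (err t \<omega>))\<^sup>2) \<le> \<sigma>\<^sup>2"
proof -
  have meas: "(\<lambda>v. ennreal ((dual_norm n v)\<^sup>2)) \<in> borel_measurable borel"
    using dual_norm_borel_measurable[OF n] by simp
  show le: "(\<integral>\<^sup>+\<omega>. ennreal ((dual_norm n (err t \<omega>))\<^sup>2) \<partial>M) \<le> ennreal (\<sigma>\<^sup>2)"
    using nn_integral_err_le[OF t meas, of "ennreal (\<sigma>\<^sup>2)"] variance
    by (simp add: bounded_variance_def)
  show int: "integrable M (\<lambda>\<omega>. (dual_norm n (err t \<omega>))\<^sup>2)"
    using dual_err_measurable[OF t] le by (intro integrableI_nonneg) (auto intro: le_less_trans)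
  show "expectation (\<lambda>\<omega>. (dual_norm n (err t \<omega>))\<^sup>2) \<le> \<sigma>\<^sup>2"
    using le by (simp add: nn_integral_eq_integral[OF int])
qed

lemma err_eq_0:
  assumes "\<sigma> = 0 \<or> T = 0"
  shows "AE \<omega> in M. \<forall>t\<in>{1..T}. err t \<omega> = 0"
proof (rule AE_finite_allI)
  fix t assume t: "t \<in> {1..T}"
  with assms have "(\<integral>\<^sup>+\<omega>. ennreal ((dual_norm n (err t \<omega>))\<^sup>2) \<partial>M) = 0"
    using second_moment(1)[OF t] by auto
  then have "AE \<omega> in M. ennreal ((dual_norm n (err t \<omega>))\<^sup>2) = 0"
    using dual_err_measurable[OF t] by (subst (asm) nn_integral_0_iff_AE) auto
  then show "AE \<omega> in M. err t \<omega> = 0"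
  proof eventually_elim
    case (elim \<omega>)
    then have "dual_norm n (err t \<omega>) = 0" by (simp add: ennreal_eq_0_iff)
    then show ?case by (simp add: is_normD(3)[OF dual_norm_is_norm[OF n]])
  qed
qed simp

lemma fibre_error_mean:
  assumes x: "x \<in> S"
  shows "has_bochner_integral P (\<lambda>s. (F x s - m x) \<bullet> v) 0"
proof -
  have "has_bochner_integral P (\<lambda>s. F x s - m x) (m x - m x)"
    using unbiased x
    by (intro has_bochner_integral_diff) (auto simp: unbiased_oracle_def has_bochner_integral_iff P.prob_space)
  from has_bochner_integral_inner_left[OF this, of v] show ?thesis by simp
qed

definition sum_squares :: real where "sum_squares = (\<Sum>t=1..T. (real t)\<^sup>2)"

definition squared_err :: "'w \<Rightarrow> real" where
  "squared_err \<omega> = (\<Sum>t=1..T. (real t)\<^sup>2 * (dual_norm n (err t \<omega>))\<^sup>2)"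

lemma squared_err_measurable: "squared_err \<in> borel_measurable M"
  unfolding squared_err_def[abs_def] using dual_err_measurable by (intro borel_measurable_sum) auto

lemma squared_err_expectation:
  "integrable M squared_err" "expectation squared_err \<le> \<sigma>\<^sup>2 * sum_squares"
proof -
  show "integrable M squared_err"
    unfolding squared_err_def[abs_def] using second_moment(2)
    by (intro Bochner_Integration.integrable_sum integrable_mult_right) auto
  have "expectation squared_err = (\<Sum>t=1..T. (real t)\<^sup>2 * expectation (\<lambda>\<omega>. (dual_norm n (err t \<omega>))\<^sup>2))"
    unfolding squared_err_def[abs_def] using second_moment(2)
    by (subst Bochner_Integration.integral_sum) auto
  also have "\<dots> \<le> (\<Sum>t=1..T. (real t)\<^sup>2 * \<sigma>\<^sup>2)"
    by (intro sum_mono mult_left_mono second_moment(3)) auto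
  also have "\<dots> = \<sigma>\<^sup>2 * sum_squares"
    by (simp add: sum_squares_def sum_distrib_left mult.commute)
  finally show "expectation squared_err \<le> \<sigma>\<^sup>2 * sum_squares" .
qed

lemma sum_squares_nonneg: "sum_squares \<ge> 0"
  by (simp add: sum_squares_def sum_nonneg)

lemma sum_squares_pos: "T \<noteq> 0 \<Longrightarrow> sum_squares > 0"
  unfolding sum_squares_def by (intro sum_pos) auto

context
  assumes light: "light_tail n P S F m \<sigma>"
begin

lemma light_tail_error:
  assumes "x \<in> S"
  shows "(\<integral>\<^sup>+s. ennreal (exp ((dual_norm n (F x s - m x))\<^sup>2 / \<sigma>\<^sup>2)) \<partial>P) \<le> ennreal (exp 1)"
proof -
  \<comment> \<open>The light tail condition has the error with the opposite sign.\<close>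
  have commute: "dual_norm n (m x - F x s) = dual_norm n (F x s - m x)" for s
    by (rule is_norm_diff_commute[OF dual_norm_is_norm[OF n]])
  have "(\<integral>\<^sup>+s. ennreal (exp ((dual_norm n (m x - F x s))\<^sup>2 / \<sigma>\<^sup>2)) \<partial>P) \<le> ennreal (exp 1)"
    using light assms unfolding light_tail_def by blast
  then show ?thesis unfolding commute .
qed

text \<open>By convexity, the exponential moment of a weighted mean of the normalized squares is at most the
  mean of their exponential moments, hence at most \<open>exp 1\<close>. Markov's inequality then gives the
  tail. If \<open>\<sigma> = 0\<close>, the normalization is meaningless but the errors vanish almost
  surely.\<close>

lemma squared_err_tail:
  assumes "lam > 0"
  shows "prob {\<omega> \<in> space M. squared_err \<omega> > (1 + lam) * \<sigma>\<^sup>2 * sum_squares} \<le> exp (- lam)"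
proof (cases "\<sigma> = 0 \<or> T = 0")
  case True
  have "AE \<omega> in M. squared_err \<omega> = 0"
    using err_eq_0[OF True] by eventually_elim
      (auto simp: squared_err_def is_normD(2)[OF dual_norm_is_norm[OF n]] intro: sum.neutral)
  then show ?thesis
    using assms sum_squares_nonneg by (subst AE_zero_tail[OF squared_err_measurable]) auto
next
  case False
  then have \<sigma>0: "\<sigma>\<^sup>2 > 0" and T: "T \<ge> 1" and W: "sum_squares > 0" using sum_squares_pos by auto
  define a where "a t = (real t)\<^sup>2 / sum_squares" for t :: nat
  have a: "a t \<ge> 0" "(\<Sum>t=1..T. a t) = 1" for t
    using W by (auto simp: a_def sum_squares_def sum_divide_distrib[symmetric])
  define E where "E t \<omega> = exp ((dual_norm n (err t \<omega>))\<^sup>2 / \<sigma>\<^sup>2)" for t \<omega>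
  define \<mu> where "\<mu> = 1 / (\<sigma>\<^sup>2 * sum_squares)"
  have expmeas: "(\<lambda>v. ennreal (exp ((dual_norm n v)\<^sup>2 / \<sigma>\<^sup>2))) \<in> borel_measurable borel"
    using dual_norm_borel_measurable[OF n] by simp
  have "(\<integral>\<^sup>+\<omega>. ennreal (exp (\<mu> * squared_err \<omega>)) \<partial>M)
      \<le> (\<integral>\<^sup>+\<omega>. (\<Sum>t=1..T. ennreal (a t) * ennreal (E t \<omega>)) \<partial>M)"
  proof (intro nn_integral_mono)
    fix \<omega>
    have "\<mu> * squared_err \<omega> = (\<Sum>t=1..T. a t *\<^sub>R ((dual_norm n (err t \<omega>))\<^sup>2 / \<sigma>\<^sup>2))"
      unfolding squared_err_def sum_distrib_left by (intro sum.cong) (auto simp: a_def \<mu>_def)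
    also have "exp \<dots> \<le> (\<Sum>t=1..T. a t * E t \<omega>)"
      unfolding E_def using a T by (intro convex_on_sum[OF _ _ exp_convex]) auto
    finally have "ennreal (exp (\<mu> * squared_err \<omega>)) \<le> ennreal (\<Sum>t=1..T. a t * E t \<omega>)"
      by (rule ennreal_leI)
    also have "\<dots> = (\<Sum>t=1..T. ennreal (a t) * ennreal (E t \<omega>))"
      using a by (subst sum_ennreal[symmetric]) (auto simp: ennreal_mult E_def)
    finally show "ennreal (exp (\<mu> * squared_err \<omega>)) \<le> (\<Sum>t=1..T. ennreal (a t) * ennreal (E t \<omega>))" .
  qed
  also have "\<dots> = (\<Sum>t=1..T. ennreal (a t) * (\<integral>\<^sup>+\<omega>. ennreal (E t \<omega>) \<partial>M))"
    unfolding E_def using dual_err_measurable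
    by (subst nn_integral_sum) (auto intro!: sum.cong nn_integral_cmult)
  also have "\<dots> \<le> (\<Sum>t=1..T. ennreal (a t) * ennreal (exp 1))"
    unfolding E_def by (intro sum_mono mult_left_mono nn_integral_err_le[OF _ expmeas light_tail_error]) auto
  also have "\<dots> = ennreal (exp 1)"
    using a by (simp add: sum_distrib_right[symmetric] sum_ennreal)
  finally have "prob {\<omega> \<in> space M. squared_err \<omega> > (1 + lam) * \<sigma>\<^sup>2 * sum_squares}
      \<le> exp (1 - \<mu> * ((1 + lam) * \<sigma>\<^sup>2 * sum_squares))"
    using \<sigma>0 W by (intro exp_moment_tail squared_err_measurable) (auto simp: \<mu>_def)
  also have "\<mu> * ((1 + lam) * \<sigma>\<^sup>2 * sum_squares) = 1 + lam" using \<sigma>0 W by (simp add: \<mu>_def)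
  finally show ?thesis by simp
qed

end

end

text \<open>The errors are paired with directions \<open>w t\<close> known before the call, which makes
  \<open>err t \<bullet> w t\<close> a martingale difference sequence.\<close>

locale oracle_martingale = sampled_oracle M P \<xi> I n S F m \<sigma> T i A q
  for M :: "'w measure" and P :: "'s measure" and \<xi> :: "'i \<Rightarrow> 'w \<Rightarrow> 's" and I
    and n :: "'v::euclidean_space \<Rightarrow> real" and S :: "'q::euclidean_space set"
    and F m \<sigma> T i A q +
  fixes w :: "nat \<Rightarrow> 'w \<Rightarrow> 'v" and D :: real
  assumes direction: "\<And>t. t \<in> {1..T} \<Longrightarrow> w t \<in> borel_measurable (past (A t))"
    and direction_bound: "\<And>t \<omega>. t \<in> {1..T} \<Longrightarrow> \<omega> \<in> space M \<Longrightarrow> n (w t \<omega>) \<le> D"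
    and D_pos: "D > 0"
begin

lemma direction_measurable: "t \<in> {1..T} \<Longrightarrow> w t \<in> borel_measurable M"
  by (rule measurable_from_past[OF past_subset direction])

lemma inner_err_bound:
  assumes "t \<in> {1..T}" "\<omega> \<in> space M"
  shows "\<bar>v \<bullet> w t \<omega>\<bar> \<le> dual_norm n v * D"
  using abs_inner_le_dual_norm[OF n, of v "w t \<omega>"]
    mult_left_mono[OF direction_bound[OF assms] dual_norm_nonneg[OF n, of v]] by linarith

lemma inner_err_integrable:
  assumes t: "t \<in> {1..T}"
  shows "integrable M (\<lambda>\<omega>. err t \<omega> \<bullet> w t \<omega>)"
proof (rule Bochner_Integration.integrable_bound)
  show "integrable M (\<lambda>\<omega>. (1 + (dual_norm n (err t \<omega>))\<^sup>2) * D)"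
    using second_moment(2)[OF t] by simp
  show "(\<lambda>\<omega>. err t \<omega> \<bullet> w t \<omega>) \<in> borel_measurable M"
    using err_measurable[OF t] direction_measurable[OF t] by simp
  show "AE \<omega> in M. norm (err t \<omega> \<bullet> w t \<omega>) \<le> norm ((1 + (dual_norm n (err t \<omega>))\<^sup>2) * D)"
  proof (rule AE_I2)
    fix \<omega> assume \<omega>: "\<omega> \<in> space M"
    have "r \<le> 1 + r\<^sup>2" for r :: real
      using zero_le_power2[of "r - 1 / 2"] by (simp add: power2_eq_square algebra_simps)
    then have "dual_norm n (err t \<omega>) * D \<le> (1 + (dual_norm n (err t \<omega>))\<^sup>2) * D"
      using D_pos by (intro mult_right_mono) auto
    moreover have "0 \<le> (1 + (dual_norm n (err t \<omega>))\<^sup>2) * D" using D_pos by simp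
    ultimately show "norm (err t \<omega> \<bullet> w t \<omega>) \<le> norm ((1 + (dual_norm n (err t \<omega>))\<^sup>2) * D)"
      using inner_err_bound[OF t \<omega>, of "err t \<omega>"] by simp
  qed
qed

lemma inner_err_mean:
  assumes t: "t \<in> {1..T}"
  shows "expectation (\<lambda>\<omega>. err t \<omega> \<bullet> w t \<omega>) = 0"
proof -
  let ?f = "\<lambda>(\<omega>, s). (F (q t \<omega>) s - m (q t \<omega>)) \<bullet> w t \<omega>"
  have "?f \<in> borel_measurable (past (A t) \<Otimes>\<^sub>M P)"
    using fibre_error_measurable[OF t] measurable_compose[OF measurable_fst direction[OF t], of P]
    by (simp add: split_beta')
  from integral_past_sample[OF past_subset[OF t] sample(1)[OF t] sample(2)[OF t] this]
    inner_err_integrable[OF t]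
  have "expectation (\<lambda>\<omega>. err t \<omega> \<bullet> w t \<omega>)
      = expectation (\<lambda>\<omega>. \<integral>s. (F (q t \<omega>) s - m (q t \<omega>)) \<bullet> w t \<omega> \<partial>P)"
    by (simp add: err_def)
  also have "\<dots> = expectation (\<lambda>_. 0)"
    using has_bochner_integral_integral_eq[OF fibre_error_mean] query_mem[OF t]
    by (intro Bochner_Integration.integral_cong) auto
  finally show ?thesis by simp
qed

definition correlation :: "'w \<Rightarrow> real" where
  "correlation \<omega> = (\<Sum>t=1..T. real t * (err t \<omega> \<bullet> w t \<omega>))"

lemma correlation_measurable: "correlation \<in> borel_measurable M"
  unfolding correlation_def[abs_def] using err_measurable direction_measurable
  by (intro borel_measurable_sum) auto

lemma correlation_expectation: "integrable M correlation" "expectation correlation = 0"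
proof -
  show "integrable M correlation"
    unfolding correlation_def[abs_def] using inner_err_integrable
    by (intro Bochner_Integration.integrable_sum integrable_mult_right) auto
  have "expectation correlation = (\<Sum>t=1..T. real t * expectation (\<lambda>\<omega>. err t \<omega> \<bullet> w t \<omega>))"
    unfolding correlation_def[abs_def] using inner_err_integrable
    by (subst Bochner_Integration.integral_sum) auto
  then show "expectation correlation = 0" using inner_err_mean by simp
qed

context
  assumes light: "light_tail n P S F m \<sigma>"
begin

lemma fibre_exp_moment:
  assumes \<sigma>0: "\<sigma> > 0" and x: "x \<in> S" and v: "n v \<le> D"
  shows "(\<integral>\<^sup>+s. ennreal (exp (\<mu> * ((F x s - m x) \<bullet> v))) \<partial>P) \<le> ennreal (exp (\<mu>\<^sup>2 * (\<sigma> * D)\<^sup>2))"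
proof -
  define c where "c = \<sigma> * D"
  have c: "c > 0" using \<sigma>0 D_pos by (simp add: c_def)
  define Z where "Z s = (F x s - m x) \<bullet> v / c" for s
  have mean: "has_bochner_integral P Z (0 / c)"
    unfolding Z_def[abs_def] using c by (intro has_bochner_integral_divide fibre_error_mean x)
  have "(\<integral>\<^sup>+s. ennreal (exp ((Z s)\<^sup>2)) \<partial>P)
      \<le> (\<integral>\<^sup>+s. ennreal (exp ((dual_norm n (F x s - m x))\<^sup>2 / \<sigma>\<^sup>2)) \<partial>P)"
  proof (intro nn_integral_mono ennreal_leI)
    fix s
    have "\<bar>(F x s - m x) \<bullet> v\<bar> \<le> dual_norm n (F x s - m x) * D"
      using abs_inner_le_dual_norm[OF n, of "F x s - m x" v]
        mult_left_mono[OF v dual_norm_nonneg[OF n, of "F x s - m x"]] by linarith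
    then have "\<bar>Z s\<bar> \<le> dual_norm n (F x s - m x) * D / c"
      using c by (simp add: Z_def divide_right_mono)
    also have "\<dots> = dual_norm n (F x s - m x) / \<sigma>" using D_pos by (simp add: c_def)
    finally have "\<bar>Z s\<bar>\<^sup>2 \<le> (dual_norm n (F x s - m x) / \<sigma>)\<^sup>2" by (intro power_mono) auto
    then show "exp ((Z s)\<^sup>2) \<le> exp ((dual_norm n (F x s - m x))\<^sup>2 / \<sigma>\<^sup>2)"
      by (simp add: power_divide)
  qed
  also note light_tail_error[OF light x]
  finally have "(\<integral>\<^sup>+s. ennreal (exp (\<mu> * c * Z s)) \<partial>P) \<le> ennreal (exp ((\<mu> * c)\<^sup>2))"
    using mean by (intro P.subgaussian_exp_moment) (auto simp: has_bochner_integral_iff)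
  moreover have Z_scaled: "\<mu> * c * Z s = \<mu> * ((F x s - m x) \<bullet> v)" for s
    using c by (simp add: Z_def)
  moreover have "(\<mu> * c)\<^sup>2 = \<mu>\<^sup>2 * (\<sigma> * D)\<^sup>2" by (simp add: c_def power_mult_distrib)
  ultimately show ?thesis by (simp only:)
qed

text \<open>The last summand is integrated out first, with the earlier ones as a weight that is determined by
  the past.\<close>

lemma martingale_exp_moment:
  assumes \<sigma>0: "\<sigma> > 0" and "k \<le> T"
  shows "(\<integral>\<^sup>+\<omega>. ennreal (exp (\<mu> * (\<Sum>t=1..k. real t * (err t \<omega> \<bullet> w t \<omega>)))) \<partial>M)
    \<le> ennreal (exp (\<mu>\<^sup>2 * (\<sigma> * D)\<^sup>2 * (\<Sum>t=1..k. (real t)\<^sup>2)))"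
  using assms(2)
proof (induction k)
  case 0
  show ?case by (simp add: emeasure_space_1)
next
  case (Suc k)
  then have t: "Suc k \<in> {1..T}" by simp
  let ?t = "Suc k"
  define Z where "Z \<omega> = ennreal (exp (\<mu> * (\<Sum>t=1..k. real t * (err t \<omega> \<bullet> w t \<omega>))))" for \<omega>
  define c where "c = ennreal (exp ((\<mu> * real ?t)\<^sup>2 * (\<sigma> * D)\<^sup>2))"
  have Z: "Z \<in> borel_measurable (past (A ?t))"
    unfolding Z_def[abs_def]
  proof (intro measurable_ennreal borel_measurable_exp borel_measurable_times borel_measurable_const
      borel_measurable_sum measurable_compose[OF _ borel_measurable_exp] measurable_compose[OF _ measurable_ennreal]
      borel_measurable_inner)
    fix s assume s: "s \<in> {1..k}"
    then have s': "s \<in> {1..T}" "insert (i s) (A s) \<subseteq> A ?t"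
      using Suc.prems past_increasing[of s ?t] by auto
    show "err s \<in> borel_measurable (past (A ?t))"
      by (rule err_measurable_past[OF s' past_subset[OF t]])
    show "w s \<in> borel_measurable (past (A ?t))"
      using s' by (intro measurable_past_mono[OF _ past_subset[OF t] direction[OF s'(1)]]) auto
  qed
  have "(\<lambda>(\<omega>, s). ennreal (exp (\<mu> * real ?t * ((F (q ?t \<omega>) s - m (q ?t \<omega>)) \<bullet> w ?t \<omega>))))
      \<in> borel_measurable (past (A ?t) \<Otimes>\<^sub>M P)"
    using fibre_error_measurable[OF t] measurable_compose[OF measurable_fst direction[OF t], of P]
    by (simp add: split_beta')
  then have "(\<integral>\<^sup>+\<omega>. Z \<omega> * ennreal (exp (\<mu> * real ?t * (err ?t \<omega> \<bullet> w ?t \<omega>))) \<partial>M) \<le> c * (\<integral>\<^sup>+\<omega>. Z \<omega> \<partial>M)"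
    unfolding c_def
    by (rule nn_integral_err[OF t Z, where f = "\<lambda>\<omega> e. ennreal (exp (\<mu> * real ?t * (e \<bullet> w ?t \<omega>)))"])
      (intro fibre_exp_moment \<sigma>0 query_mem t direction_bound)
  also have "\<dots> \<le> c * ennreal (exp (\<mu>\<^sup>2 * (\<sigma> * D)\<^sup>2 * (\<Sum>t=1..k. (real t)\<^sup>2)))"
    unfolding Z_def using Suc by (intro mult_left_mono) auto
  also have "\<dots> = ennreal (exp (\<mu>\<^sup>2 * (\<sigma> * D)\<^sup>2 * (\<Sum>t=1..Suc k. (real t)\<^sup>2)))"
  proof -
    have "(\<mu> * real ?t)\<^sup>2 * (\<sigma> * D)\<^sup>2 + \<mu>\<^sup>2 * (\<sigma> * D)\<^sup>2 * (\<Sum>t=1..k. (real t)\<^sup>2)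
        = \<mu>\<^sup>2 * (\<sigma> * D)\<^sup>2 * (\<Sum>t=1..Suc k. (real t)\<^sup>2)"
      by (simp add: power_mult_distrib distrib_left mult_ac del: of_nat_Suc)
    then show ?thesis unfolding c_def by (simp add: ennreal_mult[symmetric] exp_add[symmetric])
  qed
  also have "(\<integral>\<^sup>+\<omega>. Z \<omega> * ennreal (exp (\<mu> * real ?t * (err ?t \<omega> \<bullet> w ?t \<omega>))) \<partial>M)
      = (\<integral>\<^sup>+\<omega>. ennreal (exp (\<mu> * (\<Sum>t=1..Suc k. real t * (err t \<omega> \<bullet> w t \<omega>)))) \<partial>M)"
    unfolding Z_def
    by (intro nn_integral_cong) (simp add: ennreal_mult[symmetric] exp_add[symmetric] algebra_simps)
  finally show ?case .
qed

text \<open>The exponential Markov inequality, with the exponent \<open>\<mu>\<close> that minimizes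
  \<open>\<mu>\<^sup>2 c\<^sup>2 - \<mu> r\<close>.\<close>

lemma correlation_tail:
  assumes lam: "lam > 0"
  shows "prob {\<omega> \<in> space M. correlation \<omega> > 2 / sqrt 3 * lam * sqrt sum_squares * (\<sigma> * D)}
    \<le> exp (- (lam\<^sup>2 / 3))"
proof (cases "\<sigma> = 0 \<or> T = 0")
  case True
  have "AE \<omega> in M. correlation \<omega> = 0"
    using err_eq_0[OF True] by eventually_elim (auto simp: correlation_def intro: sum.neutral)
  then show ?thesis
    using lam \<sigma> D_pos sum_squares_nonneg by (subst AE_zero_tail[OF correlation_measurable]) auto
next
  case False
  then have \<sigma>0: "\<sigma> > 0" and W: "sum_squares > 0" using \<sigma> sum_squares_pos by auto
  \<comment> \<open>The scale of the sum: its exponential moments are those of a variable with \<open>E (exp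
    (\<mu> Z)) \<le> exp (\<mu>\<^sup>2 c\<^sup>2)\<close>.\<close>
  define c where "c = \<sigma> * D * sqrt sum_squares"
  have c: "c > 0" using \<sigma>0 D_pos W by (simp add: c_def)
  have c2: "(\<sigma> * D)\<^sup>2 * sum_squares = c\<^sup>2" using W by (simp add: c_def power_mult_distrib)
  define \<mu> where "\<mu> = lam / (sqrt 3 * c)"
  define r where "r = 2 / sqrt 3 * lam * c"
  have \<mu>: "\<mu> > 0" using lam c by (simp add: \<mu>_def)
  have \<mu>2: "\<mu>\<^sup>2 * c\<^sup>2 = lam\<^sup>2 / 3" using c by (simp add: \<mu>_def power_divide power_mult_distrib)
  have \<mu>r: "\<mu> * r = 2 * lam\<^sup>2 / 3" using c by (simp add: \<mu>_def r_def power2_eq_square)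
  have "(\<integral>\<^sup>+\<omega>. ennreal (exp (\<mu> * correlation \<omega>)) \<partial>M) \<le> ennreal (exp (\<mu>\<^sup>2 * ((\<sigma> * D)\<^sup>2 * sum_squares)))"
    using martingale_exp_moment[OF \<sigma>0 order_refl, of \<mu>] unfolding correlation_def sum_squares_def
    by (simp add: mult.assoc)
  then have "(\<integral>\<^sup>+\<omega>. ennreal (exp (\<mu> * correlation \<omega>)) \<partial>M) \<le> ennreal (exp (lam\<^sup>2 / 3))"
    unfolding c2 \<mu>2 .
  from exp_moment_tail[OF correlation_measurable \<mu> this, of r]
  have "prob {\<omega> \<in> space M. correlation \<omega> > r} \<le> exp (- (lam\<^sup>2 / 3))"
    unfolding \<mu>r by simp
  moreover have "r = 2 / sqrt 3 * lam * sqrt sum_squares * (\<sigma> * D)"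
    by (simp add: r_def c_def)
  ultimately show ?thesis by simp
qed

end

end

section \<open>Measurability of the gap and of the iterates\<close>

lemma lower_semicontinuous_on_borel_measurable:
  assumes "lower_semicontinuous_on S f"
  shows "f \<in> borel_measurable (restrict_space borel S)"
  unfolding borel_measurable_iff_greater
proof
  fix c :: real
  have "\<exists>U. open U \<and> y \<in> U \<and> (\<forall>z\<in>U \<inter> S. c < f z)" if y: "y \<in> S" "c < f y" for y
  proof -
    have "\<forall>\<^sub>F z in at y within S. c < f z"
      using assms y by (simp add: lower_semicontinuous_on_def)
    then obtain U where U: "open U" "y \<in> U" "\<And>z. z \<in> U \<Longrightarrow> z \<noteq> y \<Longrightarrow> z \<in> S \<Longrightarrow> c < f z"
      unfolding eventually_at_topological by blast
    have "c < f z" if "z \<in> U \<inter> S" for z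
      using U(3)[of z] y(2) that by (cases "z = y") auto
    then show ?thesis using U(1,2) by (intro exI[of _ U]) simp
  qed
  then have "{y \<in> S. c < f y} = S \<inter> \<Union>{U. open U \<and> (\<forall>z\<in>U \<inter> S. c < f z)}"
    by (intro set_eqI iffI) fastforce+
  moreover have "open (\<Union>{U. open U \<and> (\<forall>z\<in>U \<inter> S. c < f z)})" by auto
  ultimately show "{w \<in> space (restrict_space borel S). c < f w} \<in> sets (restrict_space borel S)"
    by (auto simp: space_restrict_space sets_restrict_space)
qed

lemma SUP_continuous_borel_measurable:
  fixes f :: "'i \<Rightarrow> 'a::topological_space \<Rightarrow> real"
  assumes "\<And>i. i \<in> I \<Longrightarrow> continuous_on UNIV (f i)"
  shows "(\<lambda>x. SUP i\<in>I. ereal (f i x)) \<in> borel_measurable borel"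
proof (rule borel_measurableI_greater)
  fix c :: ereal
  have "{x. c < (SUP i\<in>I. ereal (f i x))} = (\<Union>i\<in>I. {x. c < ereal (f i x)})"
    by (auto simp: less_SUP_iff)
  moreover have "open (\<Union>i\<in>I. {x. c < ereal (f i x)})"
    using assms by (intro open_UN ballI open_Collect_less continuous_intros) auto
  ultimately show "{x \<in> space borel. c < (SUP i\<in>I. ereal (f i x))} \<in> sets borel" by simp
qed

context saddle_point
begin

text \<open>For fixed \<open>z\<close> the gap function is the sum of a measurable function of the first
  argument, common to all \<open>z\<close>, and of an affine function of it. A supremum of affine functions,
  even over uncountably many \<open>z\<close>, is lower semicontinuous.\<close>

lemma gap_borel_measurable:
  assumes p: "p \<in> measurable A (restrict_space borel X)" and q: "q \<in> measurable A (restrict_space borel Y)"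
    and ne: "X \<noteq> {}" "Y \<noteq> {}"
  shows "(\<lambda>\<omega>. gap X Y G K J (p \<omega>, q \<omega>)) \<in> borel_measurable A"
proof -
  define h where "h z' = (SUP z\<in>X \<times> Y. ereal (K (fst z') \<bullet> snd z - K (fst z) \<bullet> snd z' - J (snd z) - G (fst z)))" for z'
  have pq: "p \<in> borel_measurable A" "q \<in> borel_measurable A"
    using p q by (simp_all add: measurable_restrict_space2_iff)
  have K_cont: "continuous_on UNIV (\<lambda>z'::'a \<times> 'b. K (fst z'))"
    using K_linear
    by (intro bounded_linear.continuous_on[of K] continuous_on_fst continuous_on_id)
      (simp add: linear_conv_bounded_linear)
  have "h \<in> borel_measurable borel"
    unfolding h_def by (intro SUP_continuous_borel_measurable continuous_intros K_cont)
  then have "(\<lambda>\<omega>. h (p \<omega>, q \<omega>)) \<in> borel_measurable A"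
    using pq by (intro measurable_compose[of "\<lambda>\<omega>. (p \<omega>, q \<omega>)" A borel h]) auto
  moreover have "(\<lambda>\<omega>. G (p \<omega>)) \<in> borel_measurable A"
    by (rule measurable_compose[OF p borel_measurable_continuous_on_restrict[OF
            has_gradient_on_continuous_on[OF G_gradient]]])
  moreover have "(\<lambda>\<omega>. J (q \<omega>)) \<in> borel_measurable A"
    by (rule measurable_compose[OF q lower_semicontinuous_on_borel_measurable[OF J(2)]])
  moreover have "gap X Y G K J z' = ereal (G (fst z') + J (snd z')) + h z'" for z'
  proof -
    have "gap X Y G K J z' = (SUP z\<in>X \<times> Y. ereal (G (fst z') + J (snd z'))
        + ereal (K (fst z') \<bullet> snd z - K (fst z) \<bullet> snd z' - J (snd z) - G (fst z)))"
      unfolding gap_def gap_Q_def by (intro SUP_cong refl) (auto simp: split_beta)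
    also have "\<dots> = ereal (G (fst z') + J (snd z')) + h z'"
      unfolding h_def using ne by (intro SUP_ereal_add_right) auto
    finally show ?thesis .
  qed
  ultimately show ?thesis by simp
qed

end

text \<open>The method with its oracles, under the assumptions of the theorem apart from light tails.\<close>

locale stochastic_apd = saddle_point + prob_space M + P: prob_space P
  for M :: "'w measure" and P :: "'s measure" +
  fixes oG :: "'a \<Rightarrow> 's \<Rightarrow> 'a" and oKx :: "'a \<Rightarrow> 's \<Rightarrow> 'b" and oKy :: "'b \<Rightarrow> 's \<Rightarrow> 'a"
    and \<sigma>xG \<sigma>y \<sigma>xK \<sigma>x :: real
    and \<xi> :: "oracle_call \<Rightarrow> nat \<Rightarrow> 'w \<Rightarrow> 's" and N :: nat
    and \<beta> \<theta> \<eta> \<tau> :: "nat \<Rightarrow> real"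
    and x1 :: 'a and y1 :: 'b
    and x xmd xag xbar :: "nat \<Rightarrow> 'w \<Rightarrow> 'a" and y yag :: "nat \<Rightarrow> 'w \<Rightarrow> 'b"
  assumes unbiased: "unbiased_oracle P X oG dG"
      "unbiased_oracle P (extrapolations X) oKx K"
      "unbiased_oracle P Y oKy (adjoint K)"
    and \<xi>_indep: "indep_vars (\<lambda>_. P) (\<lambda>(c, t). \<xi> c t) (UNIV \<times> {1..N - 1})"
    and \<xi>_distr: "\<And>c t. t \<in> {1..N - 1} \<Longrightarrow> distr M P (\<xi> c t) = P"
    and \<sigma>_nonneg: "\<sigma>xG \<ge> 0" "\<sigma>y \<ge> 0" "\<sigma>xK \<ge> 0"
    and \<sigma>x: "\<sigma>x = sqrt (\<sigma>xG\<^sup>2 + \<sigma>xK\<^sup>2)"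
    and variances: "bounded_variance nX P X oG dG \<sigma>xG"
      "bounded_variance nY P (extrapolations X) oKx K \<sigma>y"
      "bounded_variance nX P Y oKy (adjoint K) \<sigma>xK"
    and N: "N \<ge> 2"
    and denominators_pos:
      "6 * LG * DX + 3 * LK * DY * (real N - 1) + 3 * \<sigma>x * real N * sqrt (real N - 1) > 0"
      "3 * LK * DX * (real N - 1) + 3 * \<sigma>y * real N * sqrt (real N - 1) > 0"
    and \<beta>: "\<And>t. \<beta> t = (real t + 1) / 2"
    and \<theta>: "\<And>t. \<theta> t = (real t - 1) / real t"
    and \<eta>: "\<And>t. \<eta> t = 2 * \<alpha>X * DX * real t /
        (6 * LG * DX + 3 * LK * DY * (real N - 1) + 3 * \<sigma>x * real N * sqrt (real N - 1))"
    and \<tau>: "\<And>t. \<tau> t = 2 * \<alpha>Y * DY * real t /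
        (3 * LK * DX * (real N - 1) + 3 * \<sigma>y * real N * sqrt (real N - 1))"
    and start: "x1 \<in> X" "y1 \<in> Y"
    and algorithm: "\<And>\<omega>. \<omega> \<in> space M \<Longrightarrow>
      APD_trajectory X Y J (bregman dX ddX) (bregman dY ddY) \<beta> \<theta> \<eta> \<tau> N
        (\<lambda>t q. oG q (\<xi> Call_G t \<omega>)) (\<lambda>t q. oKx q (\<xi> Call_Kx t \<omega>)) (\<lambda>t q. oKy q (\<xi> Call_Ky t \<omega>))
        x1 y1 (\<lambda>t. x t \<omega>) (\<lambda>t. y t \<omega>) (\<lambda>t. xmd t \<omega>)
        (\<lambda>t. xag t \<omega>) (\<lambda>t. yag t \<omega>) (\<lambda>t. xbar t \<omega>)"
begin

abbreviation \<zeta> :: "oracle_call \<times> nat \<Rightarrow> 'w \<Rightarrow> 's" where "\<zeta> \<equiv> (\<lambda>(c, t). \<xi> c t)"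

sublocale iid_samples M P \<zeta> "UNIV \<times> {1..N - 1}"
  using \<xi>_indep \<xi>_distr by unfold_locales auto

definition hX :: real where
  "hX = (6 * LG * DX + 3 * LK * DY * (real N - 1) + 3 * \<sigma>x * real N * sqrt (real N - 1)) / (4 * DX)"
definition hY :: real where
  "hY = (3 * LK * DX * (real N - 1) + 3 * \<sigma>y * real N * sqrt (real N - 1)) / (4 * DY)"
definition aX :: real where
  "aX = (2 * LG * DX + LK * DY * (real N - 1) + 3 * \<sigma>x * real N * sqrt (real N - 1)) / (4 * DX)"
definition aY :: real where
  "aY = (LK * DX * (real N - 1) + 3 * \<sigma>y * real N * sqrt (real N - 1)) / (4 * DY)"

lemma \<sigma>x_nonneg: "\<sigma>x \<ge> 0"
  by (simp add: \<sigma>x)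

text \<open>What remains of \<open>hX\<close> is at least a third of it, hence positive, and contains the
  whole \<open>\<sigma>x\<close>-part.\<close>

lemma aX_bounds: "aX > 0" "aX + LG + (real N - 1) * (LK * DY / (2 * DX)) \<le> hX"
  "3 * \<sigma>x * real N * sqrt (real N - 1) \<le> 4 * DX * aX"
proof -
  have nonneg: "0 \<le> LG * DX" "0 \<le> LK * DY * (real N - 1)" "0 \<le> \<sigma>x * real N * sqrt (real N - 1)"
    using LG_nonneg LK_nonneg D_pos N \<sigma>x_nonneg by auto
  then have "0 < 2 * LG * DX + LK * DY * (real N - 1) + 3 * \<sigma>x * real N * sqrt (real N - 1)"
    using denominators_pos(1) by linarith
  then show "aX > 0" using D_pos by (simp add: aX_def)
  have "aX + LG + (real N - 1) * (LK * DY / (2 * DX)) = hX"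
    using D_pos by (simp add: aX_def hX_def field_simps)
  then show "aX + LG + (real N - 1) * (LK * DY / (2 * DX)) \<le> hX" by simp
  show "3 * \<sigma>x * real N * sqrt (real N - 1) \<le> 4 * DX * aX"
    using nonneg D_pos by (simp add: aX_def mult.assoc)
qed

lemma aY_bounds: "aY > 0" "aY + (real N - 1) * (LK * DX / (2 * DY)) \<le> hY"
  "3 * \<sigma>y * real N * sqrt (real N - 1) \<le> 4 * DY * aY"
proof -
  have nonneg: "0 \<le> LK * DX * (real N - 1)" "0 \<le> \<sigma>y * real N * sqrt (real N - 1)"
    using LK_nonneg D_pos N \<sigma>_nonneg by auto
  then have "0 < LK * DX * (real N - 1) + 3 * \<sigma>y * real N * sqrt (real N - 1)"
    using denominators_pos(2) by linarith
  then show "aY > 0" using D_pos by (simp add: aY_def)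
  have "aY + (real N - 1) * (LK * DX / (2 * DY)) = hY"
    using D_pos by (simp add: aY_def hY_def field_simps)
  then show "aY + (real N - 1) * (LK * DX / (2 * DY)) \<le> hY" by simp
  show "3 * \<sigma>y * real N * sqrt (real N - 1) \<le> 4 * DY * aY"
    using nonneg D_pos by (simp add: aY_def mult.assoc)
qed

lemma apd_path:
  assumes "\<omega> \<in> space M"
  shows "apd_path nX nY X Y G dG LG K LK J dX ddX \<alpha>X dY ddY \<alpha>Y \<Omega>X \<Omega>Y DX DY N \<beta> \<theta> \<eta> \<tau> hX hY aX aY
    (\<lambda>t q. oG q (\<xi> Call_G t \<omega>)) (\<lambda>t q. oKx q (\<xi> Call_Kx t \<omega>)) (\<lambda>t q. oKy q (\<xi> Call_Ky t \<omega>))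
    x1 y1 (\<lambda>t. x t \<omega>) (\<lambda>t. xmd t \<omega>) (\<lambda>t. xag t \<omega>) (\<lambda>t. xbar t \<omega>) (\<lambda>t. y t \<omega>) (\<lambda>t. yag t \<omega>)"
proof -
  have step: "2 * a * D * r / d = a * r / (2 * (d / (4 * D)))" if "D > 0" for a D r d :: real
    using that by simp
  show ?thesis
  proof unfold_locales
    show "\<eta> t = \<alpha>X * real t / (2 * hX)" for t
      unfolding \<eta> hX_def by (rule step[OF D_pos(1)])
    show "\<tau> t = \<alpha>Y * real t / (2 * hY)" for t
      unfolding \<tau> hY_def by (rule step[OF D_pos(2)])
  qed (use N aX_bounds aY_bounds \<beta> \<theta> start algorithm[OF assms] in \<open>simp_all only:\<close>)
qed

text \<open>The samples of the iterations preceding \<open>t\<close>. In iteration \<open>t\<close> they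
  determine the queries for \<open>G\<close> and \<open>K\<close>, whereas the query \<open>y (t + 1)\<close>
  for the transpose also depends on the sample \<open>(Call_Kx, t)\<close>.\<close>

definition before :: "nat \<Rightarrow> (oracle_call \<times> nat) set" where
  "before t = UNIV \<times> {1..<t}"

lemma before_subset: "t \<in> {1..N} \<Longrightarrow> before t \<subseteq> UNIV \<times> {1..N - 1}"
  by (auto simp: before_def)

lemma answer_measurable:
  assumes F: "unbiased_oracle P S F m" and q: "q \<in> measurable (past A) (restrict_space borel S)"
    and A: "(c, t) \<in> A" "A \<subseteq> UNIV \<times> {1..N - 1}"
  shows "(\<lambda>\<omega>. F (q \<omega>) (\<xi> c t \<omega>)) \<in> borel_measurable (past A)"
proof -
  have pair: "(\<lambda>\<omega>. (q \<omega>, \<xi> c t \<omega>)) \<in> measurable (past A) (restrict_space borel S \<Otimes>\<^sub>M P)"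
    using sample_measurable_past[OF A(2,1)] q by (intro measurable_Pair) auto
  have "(\<lambda>(q, s). F q s) \<in> borel_measurable (restrict_space borel S \<Otimes>\<^sub>M P)"
    using F by (simp add: unbiased_oracle_def)
  from measurable_compose[OF pair this] show ?thesis by simp
qed

text \<open>The induction hypothesis for the measurability of all iterates: \<open>x\<close>, \<open>y\<close>
  and \<open>xbar\<close> are queries or centres of proximal steps, so they are considered as maps into their
  domains.\<close>

definition measurable_up_to :: "nat \<Rightarrow> bool" where
  "measurable_up_to t \<longleftrightarrow>
     x t \<in> measurable (past (before t)) (restrict_space borel X) \<and>
     y t \<in> measurable (past (before t)) (restrict_space borel Y) \<and>
     xag t \<in> borel_measurable (past (before t)) \<and>
     yag t \<in> borel_measurable (past (before t)) \<and>
     xbar t \<in> measurable (past (before t)) (restrict_space borel (extrapolations X))"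

lemma combination_measurable:
  fixes f g h :: "'w \<Rightarrow> 'v::euclidean_space"
  assumes "f \<in> borel_measurable (past A)" "g \<in> borel_measurable (past A)"
    and "\<And>\<omega>. \<omega> \<in> space M \<Longrightarrow> h \<omega> = a *\<^sub>R f \<omega> + b *\<^sub>R g \<omega>"
  shows "h \<in> borel_measurable (past A)"
proof -
  have "(\<lambda>\<omega>. a *\<^sub>R f \<omega> + b *\<^sub>R g \<omega>) \<in> borel_measurable (past A)" using assms(1,2) by simp
  then show ?thesis using assms(3) by (subst measurable_cong) auto
qed

lemma measurable_steps:
  assumes t: "t \<in> {1..N - 1}" and IH: "measurable_up_to t"
  shows "xmd t \<in> measurable (past (before t)) (restrict_space borel X)"
    "y (t + 1) \<in> measurable (past (insert (Call_Kx, t) (before t))) (restrict_space borel Y)"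
    "measurable_up_to (t + 1)"
proof -
  let ?A = "insert (Call_Kx, t) (before t)" and ?B = "before (t + 1)"
  have sub: "before t \<subseteq> ?A" "?A \<subseteq> ?B" "before t \<subseteq> ?B" "?B \<subseteq> UNIV \<times> {1..N - 1}"
    using t by (auto simp: before_def)
  then have subI: "?A \<subseteq> UNIV \<times> {1..N - 1}" by blast
  have t': "t \<in> {1..N}" "t + 1 \<in> {1..N}" using t by auto
  note mono = measurable_past_mono[OF sub(1) subI] measurable_past_mono[OF sub(2,4)]
    measurable_past_mono[OF sub(3,4)]
  have xt: "x t \<in> measurable (past (before t)) (restrict_space borel X)"
    and yt: "y t \<in> measurable (past (before t)) (restrict_space borel Y)"
    and xagt: "xag t \<in> borel_measurable (past (before t))"
    and yagt: "yag t \<in> borel_measurable (past (before t))"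
    and xbart: "xbar t \<in> measurable (past (before t)) (restrict_space borel (extrapolations X))"
    using IH by (simp_all add: measurable_up_to_def)
  have xt': "x t \<in> borel_measurable (past (before t))"
    using xt by (simp add: measurable_restrict_space2_iff)
  have "xmd t \<in> borel_measurable (past (before t))"
    by (rule combination_measurable[OF xagt xt' apd_path.recursion(1)[OF apd_path t]])
  then show md: "xmd t \<in> measurable (past (before t)) (restrict_space borel X)"
    using apd_path.xmd_mem[OF apd_path t] by (intro measurable_restrict_space2) auto
  show ynext: "y (t + 1) \<in> measurable (past ?A) (restrict_space borel Y)"
  proof (rule prox_step_borel_measurable[OF norms(2) dY(1) \<alpha>_pos(2) dY(2) J(1)])
    show "0 < 2 * hY / (\<alpha>Y * real t)"
      using apd_path.h_pos[OF apd_path] not_empty \<alpha>_pos t by auto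
    show "(\<lambda>\<omega>. - oKx (xbar t \<omega>) (\<xi> Call_Kx t \<omega>)) \<in> borel_measurable (past ?A)"
      using answer_measurable[OF unbiased(2) mono(1)[OF xbart] insertI1 subI] by simp
    show "y t \<in> measurable (past ?A) (restrict_space borel Y)" by (rule mono(1)[OF yt])
    show "is_arg_min (\<lambda>v. - oKx (xbar t \<omega>) (\<xi> Call_Kx t \<omega>) \<bullet> v + J v
        + 2 * hY / (\<alpha>Y * real t) * VY v (y t \<omega>)) (\<lambda>v. v \<in> Y) (y (t + 1) \<omega>)"
      if "\<omega> \<in> space (past ?A)" for \<omega>
      using apd_path.recursion(2)[OF apd_path t] that by simp
  qed
  have xnext: "x (t + 1) \<in> measurable (past ?B) (restrict_space borel X)"
  proof (rule prox_step_borel_measurable[OF norms(1) dX(1) \<alpha>_pos(1) dX(2)])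
    show "convex_on X (\<lambda>_. 0)" using sets by (simp add: convex_on_def)
    show "0 < 2 * hX / (\<alpha>X * real t)"
      using apd_path.h_pos[OF apd_path] not_empty \<alpha>_pos t by auto
    have "(Call_G, t) \<in> ?B" "(Call_Ky, t) \<in> ?B" using t by (auto simp: before_def)
    then show "(\<lambda>\<omega>. oG (xmd t \<omega>) (\<xi> Call_G t \<omega>) + oKy (y (t + 1) \<omega>) (\<xi> Call_Ky t \<omega>))
        \<in> borel_measurable (past ?B)"
      by (intro borel_measurable_add answer_measurable[OF unbiased(1) mono(3)[OF md]]
          answer_measurable[OF unbiased(3) mono(2)[OF ynext]] sub)
    show "x t \<in> measurable (past ?B) (restrict_space borel X)" by (rule mono(3)[OF xt])
    show "is_arg_min (\<lambda>u. (oG (xmd t \<omega>) (\<xi> Call_G t \<omega>) + oKy (y (t + 1) \<omega>) (\<xi> Call_Ky t \<omega>)) \<bullet> u + 0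
        + 2 * hX / (\<alpha>X * real t) * VX u (x t \<omega>)) (\<lambda>u. u \<in> X) (x (t + 1) \<omega>)"
      if "\<omega> \<in> space (past ?B)" for \<omega>
      using apd_path.recursion(3)[OF apd_path t] that by simp
  qed
  have next': "x (t + 1) \<in> borel_measurable (past ?B)" "y (t + 1) \<in> borel_measurable (past ?B)"
    using xnext mono(2)[OF ynext] by (simp_all add: measurable_restrict_space2_iff)
  note old = mono(3)[OF xt'] mono(3)[OF xagt] mono(3)[OF yagt]
  have "xag (t + 1) \<in> borel_measurable (past ?B)"
    by (rule combination_measurable[OF old(2) next'(1) apd_path.recursion(4)[OF apd_path t]])
  moreover have "yag (t + 1) \<in> borel_measurable (past ?B)"
    by (rule combination_measurable[OF old(3) next'(2) apd_path.recursion(5)[OF apd_path t]])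
  moreover have "(\<lambda>\<omega>. x (t + 1) \<omega> - x t \<omega>) \<in> borel_measurable (past ?B)"
    by (intro borel_measurable_diff next'(1) old(1))
  from combination_measurable[OF this next'(1), where b = 1] apd_path.recursion(6)[OF apd_path t]
  have "xbar (t + 1) \<in> borel_measurable (past ?B)" by simp
  then have "xbar (t + 1) \<in> measurable (past ?B) (restrict_space borel (extrapolations X))"
    using apd_path.xbar_mem[OF apd_path t'(2)] by (intro measurable_restrict_space2) auto
  ultimately show "measurable_up_to (t + 1)"
    using xnext mono(2)[OF ynext] by (simp add: measurable_up_to_def)
qed

lemma iterates_measurable:
  assumes "t \<in> {1..N}"
  shows "measurable_up_to t"
  using assms
proof (induction t)
  case 0
  then show ?case by simp
next
  case (Suc t)
  show ?case
  proof (cases "t = 0")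
    case True
    have one: "1 \<in> {1..N}" using N by simp
    have const: "f \<in> measurable (past (before 1)) L" if "\<And>\<omega>. \<omega> \<in> space M \<Longrightarrow> f \<omega> = c" "c \<in> space L"
      for f c and L :: "'z measure"
      using that by (subst measurable_cong[where g = "\<lambda>_. c"]) auto
    have "x1 \<in> extrapolations X"
      using apd_path.xbar_mem[OF apd_path one] apd_path.initial(5)[OF apd_path] not_empty by fastforce
    then have "measurable_up_to 1"
      unfolding measurable_up_to_def using apd_path.initial[OF apd_path] start
      by (intro conjI const) (auto simp: space_restrict_space)
    then show ?thesis using True by simp
  next
    case False
    with Suc have "t \<in> {1..N - 1}" "measurable_up_to t" by auto
    from measurable_steps(3)[OF this] show ?thesis by simp
  qed
qed

end

section \<open>Expectation and tail of the gap\<close>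

lemma sum_of_squares_le: "(\<Sum>t=1..N - 1. (real t)\<^sup>2) \<le> (real N)\<^sup>2 * (real N - 1) / 3" if "N \<ge> 1"
proof -
  have "6 * (\<Sum>t=1..k. (real t)\<^sup>2) = real k * (real k + 1) * (2 * real k + 1)" for k
    by (induction k) (simp_all add: algebra_simps power2_eq_square)
  from this[of "N - 1"] that
  have "6 * (\<Sum>t=1..N - 1. (real t)\<^sup>2) = (real N - 1) * real N * (2 * real N - 1)"
    by (simp add: of_nat_diff algebra_simps)
  also have "\<dots> \<le> (real N - 1) * real N * (2 * real N)"
    using that by (intro mult_left_mono) auto
  finally show ?thesis by (simp add: power2_eq_square field_simps)
qed

lemma scaled_bound_identity:
  fixes n s :: real
  assumes "n > 0" "s > 0"
  shows "2 / (n * s\<^sup>2) *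
      ((6 * L * D + 3 * k * E * s\<^sup>2 + 3 * \<sigma> * n * s) * D / 2 + (3 * k * D * s\<^sup>2 + 3 * \<rho> * n * s) * E / 2
        + r * (n * s) * (\<sigma> * D + \<rho> * E))
    = 6 * L * D\<^sup>2 / (n * s\<^sup>2) + 6 * k * D * E / n + (3 + 2 * r) * (\<sigma> * D + \<rho> * E) / s"
proof -
  have "2 / m * (p * D / 2 + q * E / 2 + z) = (p * D + q * E + 2 * z) / m" for m p q z
    by (simp add: distrib_left add_divide_distrib)
  then have "2 / (n * s\<^sup>2) *
      ((6 * L * D + 3 * k * E * s\<^sup>2 + 3 * \<sigma> * n * s) * D / 2 + (3 * k * D * s\<^sup>2 + 3 * \<rho> * n * s) * E / 2
        + r * (n * s) * (\<sigma> * D + \<rho> * E))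
    = (6 * L * D\<^sup>2 + 6 * k * D * E * s\<^sup>2 + (3 + 2 * r) * (\<sigma> * D + \<rho> * E) * (n * s)) / (n * s\<^sup>2)"
    by (simp only:) (rule arg_cong[where f = "\<lambda>z. z / _"], simp add: algebra_simps power2_eq_square)
  also have "\<dots> = 6 * L * D\<^sup>2 / (n * s\<^sup>2) + 6 * k * D * E / n + (3 + 2 * r) * (\<sigma> * D + \<rho> * E) / s"
    using assms by (simp add: add_divide_distrib power2_eq_square)
  finally show ?thesis .
qed

context stochastic_apd
begin

sublocale oracle_G: sampled_oracle M P \<zeta> "UNIV \<times> {1..N - 1}" nX X oG dG \<sigma>xG "N - 1"
  "\<lambda>t. (Call_G, t)" before xmd
proof unfold_locales
  show "xmd t \<in> measurable (past (before t)) (restrict_space borel X)" if "t \<in> {1..N - 1}" for t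
    using measurable_steps(1)[OF that iterates_measurable] that by auto
qed (use norms unbiased variances \<sigma>_nonneg in \<open>auto simp: before_def\<close>)

sublocale oracle_Kx: sampled_oracle M P \<zeta> "UNIV \<times> {1..N - 1}" nY "extrapolations X" oKx K \<sigma>y "N - 1"
  "\<lambda>t. (Call_Kx, t)" before xbar
proof unfold_locales
  show "xbar t \<in> measurable (past (before t)) (restrict_space borel (extrapolations X))"
    if "t \<in> {1..N - 1}" for t
    using iterates_measurable[of t] that by (auto simp: measurable_up_to_def)
qed (use norms unbiased variances \<sigma>_nonneg in \<open>auto simp: before_def\<close>)

sublocale oracle_Ky: sampled_oracle M P \<zeta> "UNIV \<times> {1..N - 1}" nX Y oKy "adjoint K" \<sigma>xK "N - 1"
  "\<lambda>t. (Call_Ky, t)" "\<lambda>t. insert (Call_Kx, t) (before t)" "\<lambda>t. y (t + 1)"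
proof unfold_locales
  show "y (t + 1) \<in> measurable (past (insert (Call_Kx, t) (before t))) (restrict_space borel Y)"
    if "t \<in> {1..N - 1}" for t
    using measurable_steps(2)[OF that iterates_measurable] that by auto
qed (use norms unbiased variances \<sigma>_nonneg in \<open>auto simp: before_def\<close>)

text \<open>The leaders that replace the two components of the comparison point.\<close>

definition pX :: "nat \<Rightarrow> 'w \<Rightarrow> 'a" where
  "pX t \<omega> = leader X (\<lambda>u. 2 * aX / \<alpha>X * VX u x1) (\<lambda>s. oracle_G.err s \<omega> + oracle_Ky.err s \<omega>) t"

definition pY :: "nat \<Rightarrow> 'w \<Rightarrow> 'b" where
  "pY t \<omega> = leader Y (\<lambda>v. 2 * aY / \<alpha>Y * VY v y1) (\<lambda>s. - oracle_Kx.err s \<omega>) t"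

lemma domains_nonempty: "X \<noteq> {}" "Y \<noteq> {}"
  using start by auto

lemma leaders_mem: "pX t \<omega> \<in> X" "pY t \<omega> \<in> Y"
proof -
  have "leader X (\<lambda>u. r * VX u w) e t \<in> X" for r w e
    using leader_is_arg_min[OF compact_domains(1) domains_nonempty(1) dX(2)]
    unfolding is_arg_min_iff_le by blast
  then show "pX t \<omega> \<in> X" unfolding pX_def .
  have "leader Y (\<lambda>v. r * VY v w) e t \<in> Y" for r w e
    using leader_is_arg_min[OF compact_domains(2) domains_nonempty(2) dY(2)]
    unfolding is_arg_min_iff_le by blast
  then show "pY t \<omega> \<in> Y" unfolding pY_def .
qed

lemma leaders_measurable:
  assumes t: "t \<in> {1..N - 1}"
  shows "pX t \<in> borel_measurable (past (before t))" "pY t \<in> borel_measurable (past (before t))"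
proof -
  have sub: "before t \<subseteq> UNIV \<times> {1..N - 1}" using t by (auto simp: before_def)
  have err_G: "oracle_G.err s \<in> borel_measurable (past (before t))" if "s \<in> {1..<t}" for s
    by (rule oracle_G.err_measurable_past[OF _ _ sub]) (use that t in \<open>auto simp: before_def\<close>)
  have err_Kx: "oracle_Kx.err s \<in> borel_measurable (past (before t))" if "s \<in> {1..<t}" for s
    by (rule oracle_Kx.err_measurable_past[OF _ _ sub]) (use that t in \<open>auto simp: before_def\<close>)
  have err_Ky: "oracle_Ky.err s \<in> borel_measurable (past (before t))" if "s \<in> {1..<t}" for s
    by (rule oracle_Ky.err_measurable_past[OF _ _ sub]) (use that t in \<open>auto simp: before_def\<close>)
  show "pX t \<in> borel_measurable (past (before t))"
    unfolding pX_def using aX_bounds \<alpha>_pos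
    by (intro leader_borel_measurable[OF compact_domains(1) domains_nonempty(1) dX(2) norms(1) dX(1)]
        borel_measurable_add err_G err_Ky) auto
  show "pY t \<in> borel_measurable (past (before t))"
    unfolding pY_def using aY_bounds \<alpha>_pos
    by (intro leader_borel_measurable[OF compact_domains(2) domains_nonempty(2) dY(2) norms(2) dY(1)]
        borel_measurable_uminus err_Kx) auto
qed

lemma current_iterates_measurable:
  assumes "t \<in> {1..N - 1}"
  shows "x t \<in> borel_measurable (past (before t))" "y t \<in> borel_measurable (past (before t))"
  using iterates_measurable[of t] assms
  by (auto simp: measurable_up_to_def measurable_restrict_space2_iff)

lemma iterates_mem:
  assumes "t \<in> {1..N}" "\<omega> \<in> space M"
  shows "x t \<omega> \<in> X" "y t \<omega> \<in> Y" "xag t \<omega> \<in> X" "yag t \<omega> \<in> Y"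
  using apd_path.iterates_mem[OF apd_path[OF assms(2)] assms(1)] by simp_all

sublocale martingale_G: oracle_martingale M P \<zeta> "UNIV \<times> {1..N - 1}" nX X oG dG \<sigma>xG "N - 1"
  "\<lambda>t. (Call_G, t)" before xmd "\<lambda>t \<omega>. pX t \<omega> - x t \<omega>" DX
proof unfold_locales
  show "nX (pX t \<omega> - x t \<omega>) \<le> DX" if "t \<in> {1..N - 1}" "\<omega> \<in> space M" for t \<omega>
    using that by (intro diameter leaders_mem iterates_mem) auto
qed (use leaders_measurable current_iterates_measurable D_pos in auto)

sublocale martingale_Ky: oracle_martingale M P \<zeta> "UNIV \<times> {1..N - 1}" nX Y oKy "adjoint K" \<sigma>xK "N - 1"
  "\<lambda>t. (Call_Ky, t)" "\<lambda>t. insert (Call_Kx, t) (before t)" "\<lambda>t. y (t + 1)" "\<lambda>t \<omega>. pX t \<omega> - x t \<omega>" DX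
proof unfold_locales
  show "nX (pX t \<omega> - x t \<omega>) \<le> DX" if "t \<in> {1..N - 1}" "\<omega> \<in> space M" for t \<omega>
    using that by (intro diameter leaders_mem iterates_mem) auto
  show "(\<lambda>\<omega>. pX t \<omega> - x t \<omega>) \<in> borel_measurable (past (insert (Call_Kx, t) (before t)))"
    if t: "t \<in> {1..N - 1}" for t
  proof (rule measurable_past_mono)
    show "(\<lambda>\<omega>. pX t \<omega> - x t \<omega>) \<in> borel_measurable (past (before t))"
      by (intro borel_measurable_diff leaders_measurable current_iterates_measurable t)
  qed (use t in \<open>auto simp: before_def\<close>)
qed (use D_pos in auto)

sublocale martingale_Kx: oracle_martingale M P \<zeta> "UNIV \<times> {1..N - 1}" nY "extrapolations X" oKx K \<sigma>y "N - 1"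
  "\<lambda>t. (Call_Kx, t)" before xbar "\<lambda>t \<omega>. y t \<omega> - pY t \<omega>" DY
proof unfold_locales
  show "nY (y t \<omega> - pY t \<omega>) \<le> DY" if "t \<in> {1..N - 1}" "\<omega> \<in> space M" for t \<omega>
    using that by (intro diameter leaders_mem iterates_mem) auto
qed (use leaders_measurable current_iterates_measurable D_pos in auto)

abbreviation "linear_G \<equiv> martingale_G.correlation"
abbreviation "linear_Kx \<equiv> martingale_Kx.correlation"
abbreviation "linear_Ky \<equiv> martingale_Ky.correlation"
abbreviation "square_G \<equiv> oracle_G.squared_err"
abbreviation "square_Kx \<equiv> oracle_Kx.squared_err"
abbreviation "square_Ky \<equiv> oracle_Ky.squared_err"

text \<open>The random variable of \<open>gap_path_bound\<close>, without the factor \<open>2 / (N (N -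
  1))\<close>.\<close>

definition gap_bound :: "'w \<Rightarrow> real" where
  "gap_bound \<omega> = 2 * hX * DX\<^sup>2 + 2 * hY * DY\<^sup>2 + linear_G \<omega> + linear_Ky \<omega> + linear_Kx \<omega>
    + (square_G \<omega> + square_Ky \<omega>) / aX + square_Kx \<omega> / aY"

lemma gap_le_gap_bound:
  assumes \<omega>: "\<omega> \<in> space M"
  shows "gap X Y G K J (xag N \<omega>, yag N \<omega>) \<le> ereal (2 / (real N * (real N - 1)) * gap_bound \<omega>)"
proof -
  interpret path: apd_path nX nY X Y G dG LG K LK J dX ddX \<alpha>X dY ddY \<alpha>Y \<Omega>X \<Omega>Y DX DY N \<beta> \<theta> \<eta> \<tau> hX hY aX aY
    "\<lambda>t q. oG q (\<xi> Call_G t \<omega>)" "\<lambda>t q. oKx q (\<xi> Call_Kx t \<omega>)" "\<lambda>t q. oKy q (\<xi> Call_Ky t \<omega>)"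
    x1 y1 "\<lambda>t. x t \<omega>" "\<lambda>t. xmd t \<omega>" "\<lambda>t. xag t \<omega>" "\<lambda>t. xbar t \<omega>" "\<lambda>t. y t \<omega>" "\<lambda>t. yag t \<omega>"
    by (rule apd_path[OF \<omega>])
  have eG: "path.eG t = oracle_G.err t \<omega>" for t
    by (simp add: path.eG_def oracle_G.err_def)
  have eK: "path.eK t = oracle_Ky.err t \<omega>" for t
    unfolding path.eK_def oracle_Ky.err_def by simp
  \<comment> \<open>The objective of the \<open>y\<close>-step contains the estimator with a minus sign; the
    direction is reversed accordingly.\<close>
  have eY: "path.eY t = - oracle_Kx.err t \<omega>" for t
    by (simp add: path.eY_def oracle_Kx.err_def)
  have flip: "- oracle_Kx.err t \<omega> \<bullet> (pY t \<omega> - y t \<omega>) = oracle_Kx.err t \<omega> \<bullet> (y t \<omega> - pY t \<omega>)" for t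
    by (simp add: inner_diff_right)
  note bound = path.gap_path_bound[of "\<lambda>t. pX t \<omega>" "\<lambda>t. pY t \<omega>", unfolded eG eK eY]
  have "gap X Y G K J (xag N \<omega>, yag N \<omega>) \<le> ereal (2 / (real N * (real N - 1)) *
     (2 * hX * DX\<^sup>2 + 2 * hY * DY\<^sup>2 + linear_G \<omega> + linear_Ky \<omega>
      + (\<Sum>t=1..N - 1. real t * (- oracle_Kx.err t \<omega> \<bullet> (pY t \<omega> - y t \<omega>)))
      + (square_G \<omega> + square_Ky \<omega>) / aX
      + (\<Sum>t=1..N - 1. (real t)\<^sup>2 * (dual_norm nY (- oracle_Kx.err t \<omega>))\<^sup>2) / aY))"
    unfolding martingale_G.correlation_def martingale_Ky.correlation_def
      oracle_G.squared_err_def oracle_Ky.squared_err_def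
    by (rule bound; unfold pX_def pY_def; rule leader_is_arg_min)
      (use compact_domains domains_nonempty dX dY in auto)
  then show ?thesis
    unfolding flip is_norm_minus[OF dual_norm_is_norm[OF norms(2)]]
    by (simp only: gap_bound_def martingale_Kx.correlation_def oracle_Kx.squared_err_def)
qed

abbreviation W :: real where "W \<equiv> oracle_G.sum_squares"
abbreviation rN :: real where "rN \<equiv> sqrt (real N - 1)"

lemma rN: "rN > 0" "rN\<^sup>2 = real N - 1"
  using N by auto

lemma W_bounds: "W \<ge> 0" "W \<le> (real N * rN)\<^sup>2 / 3" "sqrt W \<le> real N * rN / sqrt 3"
proof -
  show "W \<ge> 0" by (rule oracle_G.sum_squares_nonneg)
  show le: "W \<le> (real N * rN)\<^sup>2 / 3"
    unfolding oracle_G.sum_squares_def power_mult_distrib rN using sum_of_squares_le[of N] N by simp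
  have "sqrt W \<le> sqrt ((real N * rN)\<^sup>2 / 3)" using le by simp
  also have "\<dots> = real N * rN / sqrt 3" using rN N by (simp add: real_sqrt_divide)
  finally show "sqrt W \<le> real N * rN / sqrt 3" .
qed

text \<open>Division by \<open>a\<close> is harmless for \<open>\<sigma> = 0\<close> as well, since
  \<open>a\<close> stays positive; otherwise \<open>a\<close> is at least of the order of
  \<open>\<sigma>\<close>, and one factor \<open>\<sigma>\<close> cancels.\<close>

lemma square_noise_bound:
  assumes "\<sigma> \<ge> 0" "a > 0" and le: "3 * \<sigma> * real N * rN \<le> 4 * D * a"
  shows "\<sigma>\<^sup>2 * W / a \<le> 4 / 9 * (real N * rN) * (\<sigma> * D)"
proof -
  have "\<sigma>\<^sup>2 * W \<le> \<sigma>\<^sup>2 * ((real N * rN)\<^sup>2 / 3)" by (intro mult_left_mono W_bounds) auto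
  also have "\<dots> = (\<sigma> * (real N * rN)) / 9 * (3 * \<sigma> * real N * rN)"
    by (simp add: power2_eq_square)
  also have "\<dots> \<le> (\<sigma> * (real N * rN)) / 9 * (4 * D * a)"
    using assms(1) rN by (intro mult_left_mono le) auto
  also have "\<dots> = 4 / 9 * (real N * rN) * (\<sigma> * D) * a" by simp
  finally show ?thesis using assms(2) by (simp add: divide_le_eq)
qed

text \<open>The bounds of the theorem differ only in the factor of the last term: \<open>C0 = rate 4\<close>
  and \<open>C0 + lam * C1 = rate (4 + 3 * lam)\<close>.\<close>

definition rate :: "real \<Rightarrow> real" where
  "rate c = 6 * LG * DX\<^sup>2 / (real N * (real N - 1)) + 6 * LK * DX * DY / real N
    + c * (\<sigma>x * DX + \<sigma>y * DY) / rN"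

lemma rate_mono: "c \<le> c' \<Longrightarrow> rate c \<le> rate c'"
  unfolding rate_def using rN \<sigma>x_nonneg \<sigma>_nonneg D_pos
  by (intro add_left_mono divide_right_mono mult_right_mono) auto

text \<open>The deterministic part contributes \<open>rate 3\<close>: twice the squared diameters weighted by
  \<open>hX\<close> and \<open>hY\<close>, once for the Bregman distances at the start and once for the
  leaders.\<close>

lemma scaled_bound:
  assumes "R \<le> 2 * hX * DX\<^sup>2 + 2 * hY * DY\<^sup>2 + r * (real N * rN) * (\<sigma>x * DX + \<sigma>y * DY)"
  shows "2 / (real N * (real N - 1)) * R \<le> rate (3 + 2 * r)"
proof -
  have N0: "real N > 0" "real N - 1 > 0" using N by auto
  have "2 / (real N * (real N - 1)) * R \<le> 2 / (real N * (real N - 1)) *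
      (2 * hX * DX\<^sup>2 + 2 * hY * DY\<^sup>2 + r * (real N * rN) * (\<sigma>x * DX + \<sigma>y * DY))"
    using N0 by (intro mult_left_mono assms) auto
  also have "2 * hX * DX\<^sup>2 = (6 * LG * DX + 3 * LK * DY * (real N - 1) + 3 * \<sigma>x * real N * rN) * DX / 2"
    using D_pos by (simp add: hX_def power2_eq_square)
  also have "2 * hY * DY\<^sup>2 = (3 * LK * DX * (real N - 1) + 3 * \<sigma>y * real N * rN) * DY / 2"
    using D_pos by (simp add: hY_def power2_eq_square)
  also have "2 / (real N * (real N - 1)) *
      ((6 * LG * DX + 3 * LK * DY * (real N - 1) + 3 * \<sigma>x * real N * rN) * DX / 2
        + (3 * LK * DX * (real N - 1) + 3 * \<sigma>y * real N * rN) * DY / 2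
        + r * (real N * rN) * (\<sigma>x * DX + \<sigma>y * DY))
    = rate (3 + 2 * r)"
    unfolding rate_def using scaled_bound_identity[OF N0(1) rN(1), of LG DX LK DY \<sigma>x \<sigma>y r] unfolding rN(2) .
  finally show ?thesis .
qed

lemma \<sigma>x_power2: "\<sigma>x\<^sup>2 = \<sigma>xG\<^sup>2 + \<sigma>xK\<^sup>2"
  by (simp add: \<sigma>x)

lemma gap_measurable: "(\<lambda>\<omega>. gap X Y G K J (xag N \<omega>, yag N \<omega>)) \<in> borel_measurable M"
proof -
  have N': "N \<in> {1..N}" using N by simp
  have "before N \<subseteq> UNIV \<times> {1..N - 1}" by (rule before_subset[OF N'])
  then have "xag N \<in> borel_measurable M" "yag N \<in> borel_measurable M"
    using iterates_measurable[OF N'] measurable_from_past by (auto simp: measurable_up_to_def)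
  then show ?thesis
    using iterates_mem[OF N'] by (intro gap_borel_measurable domains_nonempty measurable_restrict_space2) auto
qed

lemma expected_gap_bound:
  "(\<integral>\<^sup>+ \<omega>. e2ennreal (gap X Y G K J (xag N \<omega>, yag N \<omega>)) \<partial>M)
    \<le> ennreal (rate 4)"
proof -
  define c where "c = 2 / (real N * (real N - 1))"
  have c: "c > 0" using N by (simp add: c_def)
  note int = martingale_G.correlation_expectation(1) martingale_Kx.correlation_expectation(1)
    martingale_Ky.correlation_expectation(1) oracle_G.squared_err_expectation(1)
    oracle_Kx.squared_err_expectation(1) oracle_Ky.squared_err_expectation(1)
  note linear = martingale_G.correlation_expectation(2) martingale_Kx.correlation_expectation(2)
    martingale_Ky.correlation_expectation(2)
  note square = oracle_G.squared_err_expectation(2) oracle_Kx.squared_err_expectation(2)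
    oracle_Ky.squared_err_expectation(2)
  have gap_int: "integrable M gap_bound"
    unfolding gap_bound_def[abs_def] using int by simp
  have "expectation gap_bound = 2 * hX * DX\<^sup>2 + 2 * hY * DY\<^sup>2
      + (expectation square_G + expectation square_Ky) / aX + expectation square_Kx / aY"
    unfolding gap_bound_def[abs_def] using int linear by (simp add: prob_space)
  also have "(expectation square_G + expectation square_Ky) / aX \<le> (\<sigma>xG\<^sup>2 * W + \<sigma>xK\<^sup>2 * W) / aX"
    using aX_bounds by (intro divide_right_mono add_mono square) auto
  also have "\<dots> = \<sigma>x\<^sup>2 * W / aX" by (simp add: \<sigma>x_power2 distrib_right)
  also have "\<dots> \<le> 4 / 9 * (real N * rN) * (\<sigma>x * DX)"
    by (rule square_noise_bound[OF \<sigma>x_nonneg aX_bounds(1,3)])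
  also have "expectation square_Kx / aY \<le> \<sigma>y\<^sup>2 * W / aY"
    using aY_bounds by (intro divide_right_mono square) auto
  also have "\<dots> \<le> 4 / 9 * (real N * rN) * (\<sigma>y * DY)"
    by (rule square_noise_bound[OF \<sigma>_nonneg(2) aY_bounds(1,3)])
  finally have "expectation gap_bound
      \<le> 2 * hX * DX\<^sup>2 + 2 * hY * DY\<^sup>2 + 4 / 9 * (real N * rN) * (\<sigma>x * DX + \<sigma>y * DY)"
    by (simp add: distrib_left)
  from scaled_bound[OF this] have "c * expectation gap_bound \<le> rate (3 + 2 * (4 / 9))"
    unfolding c_def .
  also have "\<dots> \<le> rate 4" by (rule rate_mono) simp
  finally have le: "c * expectation gap_bound \<le> rate 4" .
  \<comment> \<open>The gap is nonnegative, hence so is its bound, whose integral as an \<open>ennreal\<close>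
    function is then its expectation.\<close>
  have nonneg: "0 \<le> c * gap_bound \<omega>" if "\<omega> \<in> space M" for \<omega>
  proof -
    have "(xag N \<omega>, yag N \<omega>) \<in> X \<times> Y" using iterates_mem[OF _ that, of N] N by auto
    from order_trans[OF gap_nonneg[OF this] gap_le_gap_bound[OF that]]
    show ?thesis by (simp add: c_def)
  qed
  have "(\<integral>\<^sup>+ \<omega>. e2ennreal (gap X Y G K J (xag N \<omega>, yag N \<omega>)) \<partial>M) \<le> (\<integral>\<^sup>+ \<omega>. ennreal (c * gap_bound \<omega>) \<partial>M)"
  proof (intro nn_integral_mono)
    fix \<omega> assume "\<omega> \<in> space M"
    from e2ennreal_mono[OF gap_le_gap_bound[OF this]]
    show "e2ennreal (gap X Y G K J (xag N \<omega>, yag N \<omega>)) \<le> ennreal (c * gap_bound \<omega>)"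
      by (simp add: c_def ennreal.abs_eq[symmetric] e2ennreal_ereal)
  qed
  also have "\<dots> = ennreal (expectation (\<lambda>\<omega>. c * gap_bound \<omega>))"
    using gap_int nonneg by (intro nn_integral_eq_integral) auto
  also have "\<dots> \<le> ennreal (rate 4)"
    using le by (intro ennreal_leI) simp
  finally show ?thesis .
qed

text \<open>The factor \<open>2 / 3\<close> is the one by which the martingale deviations are smaller than
  \<open>lam * (N * rN)\<close> times \<open>\<sigma>\<close> times the diameter; it outweighs the factor
  \<open>sqrt 2\<close> between the sum of the two deviations and \<open>\<sigma>x\<close>.\<close>

lemma \<sigma>_sum_le: "2 / 3 * (\<sigma>xG + \<sigma>xK) \<le> \<sigma>x"
proof (rule power2_le_imp_le)
  have "(2 / 3 * (\<sigma>xG + \<sigma>xK))\<^sup>2 \<le> 8 / 9 * (\<sigma>xG\<^sup>2 + \<sigma>xK\<^sup>2)"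
    using sum_squares_bound[of \<sigma>xG \<sigma>xK] by (simp add: power_mult_distrib power2_sum field_simps)
  also have "\<dots> \<le> \<sigma>x\<^sup>2" by (simp add: \<sigma>x_power2)
  finally show "(2 / 3 * (\<sigma>xG + \<sigma>xK))\<^sup>2 \<le> \<sigma>x\<^sup>2" .
qed (rule \<sigma>x_nonneg)

text \<open>Outside six exceptional events, one for each martingale sum and one for each sum of squares, the
  pathwise bound is at most \<open>rate (4 + 3 * lam)\<close>.\<close>

lemma gap_tail_bound:
  assumes light: "light_tail nX P X oG dG \<sigma>xG" "light_tail nY P (extrapolations X) oKx K \<sigma>y"
      "light_tail nX P Y oKy (adjoint K) \<sigma>xK"
    and lam: "lam > 0"
  shows "measure M {\<omega> \<in> space M. gap X Y G K J (xag N \<omega>, yag N \<omega>) > ereal (rate (4 + 3 * lam))}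
    \<le> 3 * exp (- (lam\<^sup>2 / 3)) + 3 * exp (- lam)"
proof -
  define k where "k = 2 / sqrt 3 * lam * sqrt W"
  define L1 where "L1 = {\<omega> \<in> space M. linear_G \<omega> > k * (\<sigma>xG * DX)}"
  define L2 where "L2 = {\<omega> \<in> space M. linear_Ky \<omega> > k * (\<sigma>xK * DX)}"
  define L3 where "L3 = {\<omega> \<in> space M. linear_Kx \<omega> > k * (\<sigma>y * DY)}"
  define S1 where "S1 = {\<omega> \<in> space M. square_G \<omega> > (1 + lam) * \<sigma>xG\<^sup>2 * W}"
  define S2 where "S2 = {\<omega> \<in> space M. square_Ky \<omega> > (1 + lam) * \<sigma>xK\<^sup>2 * W}"
  define S3 where "S3 = {\<omega> \<in> space M. square_Kx \<omega> > (1 + lam) * \<sigma>y\<^sup>2 * W}"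
  note sets = L1_def L2_def L3_def S1_def S2_def S3_def
  have events: "L1 \<in> events" "L2 \<in> events" "L3 \<in> events" "S1 \<in> events" "S2 \<in> events" "S3 \<in> events"
    unfolding sets using martingale_G.correlation_measurable martingale_Ky.correlation_measurable
      martingale_Kx.correlation_measurable oracle_G.squared_err_measurable
      oracle_Ky.squared_err_measurable oracle_Kx.squared_err_measurable by measurable
  have L: "prob L1 \<le> exp (- (lam\<^sup>2 / 3))" "prob L2 \<le> exp (- (lam\<^sup>2 / 3))" "prob L3 \<le> exp (- (lam\<^sup>2 / 3))"
    unfolding sets k_def
    by (fact martingale_G.correlation_tail[OF light(1) lam] martingale_Ky.correlation_tail[OF light(3) lam]
        martingale_Kx.correlation_tail[OF light(2) lam])+
  have S: "prob S1 \<le> exp (- lam)" "prob S2 \<le> exp (- lam)" "prob S3 \<le> exp (- lam)"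
    unfolding sets
    by (fact oracle_G.squared_err_tail[OF light(1) lam] oracle_Ky.squared_err_tail[OF light(3) lam]
        oracle_Kx.squared_err_tail[OF light(2) lam])+
  have good: "gap X Y G K J (xag N \<omega>, yag N \<omega>) \<le> ereal (rate (4 + 3 * lam))"
    if \<omega>: "\<omega> \<in> space M" and not: "\<omega> \<notin> L1 \<union> L2 \<union> L3 \<union> (S1 \<union> S2 \<union> S3)" for \<omega>
  proof -
    have lin: "linear_G \<omega> \<le> k * (\<sigma>xG * DX)" "linear_Ky \<omega> \<le> k * (\<sigma>xK * DX)" "linear_Kx \<omega> \<le> k * (\<sigma>y * DY)"
      and sq: "square_G \<omega> \<le> (1 + lam) * \<sigma>xG\<^sup>2 * W" "square_Ky \<omega> \<le> (1 + lam) * \<sigma>xK\<^sup>2 * W"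
        "square_Kx \<omega> \<le> (1 + lam) * \<sigma>y\<^sup>2 * W"
      using \<omega> not unfolding sets by auto
    have "k \<le> 2 / sqrt 3 * lam * (real N * rN / sqrt 3)"
      unfolding k_def using lam by (intro mult_left_mono W_bounds) auto
    also have "\<dots> = 2 / 3 * (lam * (real N * rN))" by simp
    finally have k: "k \<le> 2 / 3 * (lam * (real N * rN))" .
    have NrN: "0 \<le> lam * (real N * rN)" using lam rN by auto
    have "linear_G \<omega> + linear_Ky \<omega> + linear_Kx \<omega> \<le> k * ((\<sigma>xG + \<sigma>xK) * DX + \<sigma>y * DY)"
      using lin by (simp add: algebra_simps)
    also have "\<dots> \<le> 2 / 3 * (lam * (real N * rN)) * ((\<sigma>xG + \<sigma>xK) * DX + \<sigma>y * DY)"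
      using \<sigma>_nonneg D_pos by (intro mult_right_mono k) auto
    also have "\<dots> = lam * (real N * rN) * (2 / 3 * (\<sigma>xG + \<sigma>xK) * DX + 2 / 3 * (\<sigma>y * DY))"
      by (simp add: algebra_simps)
    also have "\<dots> \<le> lam * (real N * rN) * (\<sigma>x * DX + \<sigma>y * DY)"
      using \<sigma>_nonneg D_pos by (intro mult_left_mono add_mono mult_right_mono \<sigma>_sum_le NrN) auto
    finally have linear: "linear_G \<omega> + linear_Ky \<omega> + linear_Kx \<omega> \<le> lam * (real N * rN) * (\<sigma>x * DX + \<sigma>y * DY)" .
    have "(square_G \<omega> + square_Ky \<omega>) / aX \<le> ((1 + lam) * \<sigma>xG\<^sup>2 * W + (1 + lam) * \<sigma>xK\<^sup>2 * W) / aX"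
      using aX_bounds by (intro divide_right_mono add_mono sq) auto
    also have "\<dots> = (1 + lam) * (\<sigma>x\<^sup>2 * W / aX)" by (simp add: \<sigma>x_power2 algebra_simps add_divide_distrib)
    also have "\<dots> \<le> (1 + lam) * (4 / 9 * (real N * rN) * (\<sigma>x * DX))"
      using lam by (intro mult_left_mono square_noise_bound[OF \<sigma>x_nonneg aX_bounds(1,3)]) auto
    finally have square_x: "(square_G \<omega> + square_Ky \<omega>) / aX \<le> (1 + lam) * (4 / 9 * (real N * rN) * (\<sigma>x * DX))" .
    have "square_Kx \<omega> / aY \<le> (1 + lam) * \<sigma>y\<^sup>2 * W / aY"
      using aY_bounds by (intro divide_right_mono sq) auto
    also have "\<dots> = (1 + lam) * (\<sigma>y\<^sup>2 * W / aY)" by simp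
    also have "\<dots> \<le> (1 + lam) * (4 / 9 * (real N * rN) * (\<sigma>y * DY))"
      using lam by (intro mult_left_mono square_noise_bound[OF \<sigma>_nonneg(2) aY_bounds(1,3)]) auto
    finally have square_y: "square_Kx \<omega> / aY \<le> (1 + lam) * (4 / 9 * (real N * rN) * (\<sigma>y * DY))" .
    have "gap_bound \<omega> \<le> 2 * hX * DX\<^sup>2 + 2 * hY * DY\<^sup>2
        + (lam + 4 / 9 * (1 + lam)) * (real N * rN) * (\<sigma>x * DX + \<sigma>y * DY)"
    proof -
      have "(lam + 4 / 9 * (1 + lam)) * q * (A + B)
          = lam * q * (A + B) + (1 + lam) * (4 / 9 * q * A) + (1 + lam) * (4 / 9 * q * B)" for q A B :: real
        by algebra
      from this[of "real N * rN" "\<sigma>x * DX" "\<sigma>y * DY"] show ?thesis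
        using linear square_x square_y unfolding gap_bound_def by linarith
    qed
    from scaled_bound[OF this]
    have "2 / (real N * (real N - 1)) * gap_bound \<omega> \<le> rate (3 + 2 * (lam + 4 / 9 * (1 + lam)))" .
    also have "\<dots> \<le> rate (4 + 3 * lam)" using lam by (intro rate_mono) simp
    finally have "2 / (real N * (real N - 1)) * gap_bound \<omega> \<le> rate (4 + 3 * lam)" .
    then show ?thesis using gap_le_gap_bound[OF \<omega>] by (meson ereal_less_eq(3) order_trans)
  qed
  have "prob {\<omega> \<in> space M. gap X Y G K J (xag N \<omega>, yag N \<omega>) > ereal (rate (4 + 3 * lam))}
      \<le> prob (L1 \<union> L2 \<union> L3 \<union> (S1 \<union> S2 \<union> S3))"
    using good events by (intro finite_measure_mono) (auto simp: not_le[symmetric])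
  also have "\<dots> \<le> prob L1 + prob L2 + prob L3 + (prob S1 + prob S2 + prob S3)"
    using events by (intro order_trans[OF measure_Un_le] add_mono order_refl) auto
  also have "\<dots> \<le> 3 * exp (- (lam\<^sup>2 / 3)) + 3 * exp (- lam)" using L S by linarith
  finally show ?thesis .
qed

end

theorem corollary3p2:
  fixes nX :: "'a::euclidean_space \<Rightarrow> real" and nY :: "'b::euclidean_space \<Rightarrow> real"
    and X :: "'a set" and Y :: "'b set"
    and G :: "'a \<Rightarrow> real" and dG :: "'a \<Rightarrow> 'a" and LG :: real
    and K :: "'a \<Rightarrow> 'b" and LK :: real and J :: "'b \<Rightarrow> real"
    and dX :: "'a \<Rightarrow> real" and ddX :: "'a \<Rightarrow> 'a" and \<alpha>X :: real
    and dY :: "'b \<Rightarrow> real" and ddY :: "'b \<Rightarrow> 'b" and \<alpha>Y :: real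
    and P :: "'s measure" and M :: "'w measure"
    and oG :: "'a \<Rightarrow> 's \<Rightarrow> 'a" and oKx :: "'a \<Rightarrow> 's \<Rightarrow> 'b" and oKy :: "'b \<Rightarrow> 's \<Rightarrow> 'a"
    and \<sigma>xG \<sigma>y \<sigma>xK \<sigma>x :: real
    and \<xi> :: "oracle_call \<Rightarrow> nat \<Rightarrow> 'w \<Rightarrow> 's"
    and \<Omega>X \<Omega>Y DX DY C0 C1 :: real and N :: nat
    and \<beta> \<theta> \<eta> \<tau> :: "nat \<Rightarrow> real"
    and x1 :: 'a and y1 :: 'b
    and x xmd xag xbar :: "nat \<Rightarrow> 'w \<Rightarrow> 'a" and y yag :: "nat \<Rightarrow> 'w \<Rightarrow> 'b"
  assumes norms: "is_norm nX" "is_norm nY"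
    and sets: "closed X" "convex X" "closed Y" "convex Y"
    and G_convex: "convex_on X G" and G_gradient: "has_gradient_on G dG X"
    and LG_nonneg: "LG \<ge> 0"
    and G_smooth: "\<And>u v. u \<in> X \<Longrightarrow> v \<in> X \<Longrightarrow> G v - G u - dG u \<bullet> (v - u) \<le> LG / 2 * (nX (v - u))\<^sup>2"
    and K_linear: "linear K" and LK: "LK = induced_norm nX nY K"
    and J: "convex_on Y J" "lower_semicontinuous_on Y J"
    and \<alpha>_pos: "\<alpha>X > 0" "\<alpha>Y > 0"
    and dX: "strongly_convex_on nX \<alpha>X X dX" "has_gradient_on dX ddX X"
    and dY: "strongly_convex_on nY \<alpha>Y Y dY" "has_gradient_on dY ddY Y"
    and P: "prob_space P"
    and unbiased: "unbiased_oracle P X oG dG"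
      "unbiased_oracle P (extrapolations X) oKx K"
      "unbiased_oracle P Y oKy (adjoint K)"
    and M: "prob_space M"
    and \<xi>_indep: "prob_space.indep_vars M (\<lambda>_. P) (\<lambda>(c, t). \<xi> c t) (UNIV \<times> {1..N - 1})"
    and \<xi>_distr: "\<And>c t. t \<in> {1..N - 1} \<Longrightarrow> distr M P (\<xi> c t) = P"
    and \<sigma>_nonneg: "\<sigma>xG \<ge> 0" "\<sigma>y \<ge> 0" "\<sigma>xK \<ge> 0"
    and \<sigma>x: "\<sigma>x = sqrt (\<sigma>xG\<^sup>2 + \<sigma>xK\<^sup>2)"
    and A1: "bounded_variance nX P X oG dG \<sigma>xG"
      "bounded_variance nY P (extrapolations X) oKx K \<sigma>y"
      "bounded_variance nX P Y oKy (adjoint K) \<sigma>xK"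
    and \<Omega>_pos: "\<Omega>X > 0" "\<Omega>Y > 0"
    and \<Omega>X: "\<And>u v. u \<in> X \<Longrightarrow> v \<in> X \<Longrightarrow> bregman dX ddX u v \<le> \<Omega>X\<^sup>2"
    and \<Omega>Y: "\<And>u v. u \<in> Y \<Longrightarrow> v \<in> Y \<Longrightarrow> bregman dY ddY u v \<le> \<Omega>Y\<^sup>2"
    and DX: "DX = \<Omega>X * sqrt (2 / \<alpha>X)" and DY: "DY = \<Omega>Y * sqrt (2 / \<alpha>Y)"
    and N: "N \<ge> 2"
    and denominators_pos:
      "6 * LG * DX + 3 * LK * DY * (real N - 1) + 3 * \<sigma>x * real N * sqrt (real N - 1) > 0"
      "3 * LK * DX * (real N - 1) + 3 * \<sigma>y * real N * sqrt (real N - 1) > 0"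
    and \<beta>: "\<And>t. \<beta> t = (real t + 1) / 2"
    and \<theta>: "\<And>t. \<theta> t = (real t - 1) / real t"
    and \<eta>: "\<And>t. \<eta> t = 2 * \<alpha>X * DX * real t /
        (6 * LG * DX + 3 * LK * DY * (real N - 1) + 3 * \<sigma>x * real N * sqrt (real N - 1))"
    and \<tau>: "\<And>t. \<tau> t = 2 * \<alpha>Y * DY * real t /
        (3 * LK * DX * (real N - 1) + 3 * \<sigma>y * real N * sqrt (real N - 1))"
    and start: "x1 \<in> X" "y1 \<in> Y"
    and algorithm: "\<And>\<omega>. \<omega> \<in> space M \<Longrightarrow>
      APD_trajectory X Y J (bregman dX ddX) (bregman dY ddY) \<beta> \<theta> \<eta> \<tau> N
        (\<lambda>t q. oG q (\<xi> Call_G t \<omega>)) (\<lambda>t q. oKx q (\<xi> Call_Kx t \<omega>)) (\<lambda>t q. oKy q (\<xi> Call_Ky t \<omega>))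
        x1 y1 (\<lambda>t. x t \<omega>) (\<lambda>t. y t \<omega>) (\<lambda>t. xmd t \<omega>)
        (\<lambda>t. xag t \<omega>) (\<lambda>t. yag t \<omega>) (\<lambda>t. xbar t \<omega>)"
    and C0: "C0 = 6 * LG * DX\<^sup>2 / (real N * (real N - 1)) + 6 * LK * DX * DY / real N
        + 4 * (\<sigma>x * DX + \<sigma>y * DY) / sqrt (real N - 1)"
    and C1: "C1 = 3 * (\<sigma>x * DX + \<sigma>y * DY) / sqrt (real N - 1)"
  shows "(\<lambda>\<omega>. gap X Y G K J (xag N \<omega>, yag N \<omega>)) \<in> borel_measurable M
    \<and> (\<integral>\<^sup>+ \<omega>. e2ennreal (gap X Y G K J (xag N \<omega>, yag N \<omega>)) \<partial>M) \<le> ennreal C0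
    \<and> (light_tail nX P X oG dG \<sigma>xG \<and>
       light_tail nY P (extrapolations X) oKx K \<sigma>y \<and>
       light_tail nX P Y oKy (adjoint K) \<sigma>xK \<longrightarrow>
       (\<forall>lam > 0.
          measure M {\<omega> \<in> space M. gap X Y G K J (xag N \<omega>, yag N \<omega>) > ereal (C0 + lam * C1)}
            \<le> 3 * exp (- (lam\<^sup>2 / 3)) + 3 * exp (- lam)))"
proof -
  interpret saddle_point nX nY X Y G dG LG K LK J dX ddX \<alpha>X dY ddY \<alpha>Y \<Omega>X \<Omega>Y DX DY
    by (rule saddle_point.intro) (fact assms)+
  interpret prob_space M by (rule M)
  interpret P: prob_space P by (rule P)
  interpret stochastic_apd nX nY X Y G dG LG K LK J dX ddX \<alpha>X dY ddY \<alpha>Y \<Omega>X \<Omega>Y DX DY M P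
    oG oKx oKy \<sigma>xG \<sigma>y \<sigma>xK \<sigma>x \<xi> N \<beta> \<theta> \<eta> \<tau> x1 y1 x xmd xag xbar y yag
    by unfold_locales (fact assms)+
  have "C0 = rate 4" unfolding C0 rate_def ..
  moreover have "C0 + lam * C1 = rate (4 + 3 * lam)" for lam
    unfolding C0 C1 rate_def by (simp add: algebra_simps add_divide_distrib)
  ultimately show ?thesis
    using gap_measurable expected_gap_bound gap_tail_bound by simp
qed

end
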